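(* Let $V:\mathbb{R}\to[0,+\infty)$ be continuous with $\liminf_{|x|\to+\infty}V(x)>0$ and $V^{-1}(0)=\{0\}$. Assume that $V$ is flat at $0$, i.e. $V(x)=\mathcal{O}(|x|^n)$ near $0$ for all $n\in\mathbb{N}$, and that, for every $n\in\mathbb{N}$, the function $x\mapsto|x|^{-n}V(x)$ is strictly increasing for small positive $x$ and strictly decreasing for small negative $x$ (the size of the neighborhood of $0$ may depend on $n$). Let $P=-h^2\Delta+V$ on $L^2(\mathbb{R})$, and for $h>0$ small enough let $\delta_-=\delta_-(h)<0<\delta_+=\delta_+(h)$ be the unique solutions of $$V(\delta_-)=V(\delta_+)=\frac{h^2}{(\delta_+-\delta_-)^2}.$$ Then, for every $k\in\mathbb{N}^*=\{1,2,\dots\}$, there exists (for $h$ small enough) an eigenvector $u_k$ of $P$, normalized in $L^2(\mathbb{R})$, associated with the eigenvalue $\lambda_k(P)$, such that in the limit $h\to0$ $$u_k(x)=\sqrt{\frac{2}{\delta_+-\delta_-}}\,\sin\Big(\pi k\,\frac{x-\delta_-}{\delta_+-\delta_-}\Big)\mathbf{1}_{[\delta_-,\delta_+]}(x)+o_{L^2(\mathbb{R})}(1),$$ where $o_{L^2(\mathbb{R})}(1)$ denotes a function whose $L^2(\mathbb{R})$ norm tends to $0$ as $h\to0$.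
   Context: The set $\mathbb{N}$ contains $0$. The operator $P=-h^2\Delta+V$ (with $\Delta=d^2/dx^2$) is the non-negative self-adjoint operator on $L^2(\mathbb{R})$ associated with the quadratic form $u\mapsto h^2\|u'\|^2+\|V^{1/2}u\|^2$ on $\{u\in H^1(\mathbb{R}): V^{1/2}u\in L^2(\mathbb{R})\}$; it depends on the semiclassical parameter $h>0$, and so does $u_k$. For a non-negative self-adjoint operator $T$, $\lambda_k(T)$ denotes its $k$-th eigenvalue (in increasing order, counted with multiplicity), or the bottom of its essential spectrum if $T$ has fewer than $k$ eigenvalues below it (equivalently, the $k$-th max-min value of $T$). $\mathbf{1}_A$ is the indicator function of $A$. Under the stated hypotheses the pair $(\delta_-,\delta_+)$ exists and is unique for all sufficiently small $h>0$. *)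

theory Defs
  imports "HOL-Analysis.Analysis" "HOL-Library.Landau_Symbols"
begin

(* Elements of the complex Hilbert space L^2(R) are represented by Borel functions; every notion
   below is insensitive to changes on null sets. *)

definition L2 :: "(real \<Rightarrow> complex) set" where
  "L2 = {u. u \<in> borel_measurable lborel \<and> integrable lborel (\<lambda>x. (cmod (u x))\<^sup>2)}"

definition L2_inner :: "(real \<Rightarrow> complex) \<Rightarrow> (real \<Rightarrow> complex) \<Rightarrow> complex" where
  "L2_inner u v = (LINT x|lborel. u x * cnj (v x))"

definition L2_norm :: "(real \<Rightarrow> complex) \<Rightarrow> real" where
  "L2_norm u = sqrt (LINT x|lborel. (cmod (u x))\<^sup>2)"

definition L2_independent :: "nat \<Rightarrow> (nat \<Rightarrow> real \<Rightarrow> complex) \<Rightarrow> bool" where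
  "L2_independent n us \<longleftrightarrow>
     (\<forall>c :: nat \<Rightarrow> complex. (AE x in lborel. (\<Sum>i<n. c i * us i x) = 0) \<longrightarrow> (\<forall>i<n. c i = 0))"

definition L2_dim :: "(real \<Rightarrow> complex) set \<Rightarrow> enat" where
  "L2_dim S = Sup {enat n | n us. (\<forall>i<n. us i \<in> S) \<and> L2_independent n us}"


definition test_function :: "(real \<Rightarrow> real) \<Rightarrow> bool" where
  "test_function \<phi> \<longleftrightarrow>
     (\<forall>n x. (deriv ^^ n) \<phi> differentiable (at x)) \<and> bounded {x. \<phi> x \<noteq> 0}"

definition has_weak_deriv :: "(real \<Rightarrow> complex) \<Rightarrow> (real \<Rightarrow> complex) \<Rightarrow> bool" where
  "has_weak_deriv u g \<longleftrightarrow>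
     (\<forall>\<phi>. test_function \<phi> \<longrightarrow>
        (LINT x|lborel. u x * of_real (deriv \<phi> x)) = - (LINT x|lborel. g x * of_real (\<phi> x)))"

definition H1 :: "(real \<Rightarrow> complex) set" where
  "H1 = {u \<in> L2. \<exists>g\<in>L2. has_weak_deriv u g}"

(* For u in H1 this is unique up to null sets. *)
definition weak_deriv :: "(real \<Rightarrow> complex) \<Rightarrow> real \<Rightarrow> complex" where
  "weak_deriv u = (SOME g. g \<in> L2 \<and> has_weak_deriv u g)"


(* Unbounded operators on L^2(R), given by their graphs. *)
type_synonym L2_operator = "((real \<Rightarrow> complex) \<times> (real \<Rightarrow> complex)) set"

definition form_operator ::
  "(real \<Rightarrow> complex) set \<Rightarrow> ((real \<Rightarrow> complex) \<Rightarrow> (real \<Rightarrow> complex) \<Rightarrow> complex) \<Rightarrow> L2_operator" where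
  "form_operator D q = {(u, f). u \<in> D \<and> f \<in> L2 \<and> (\<forall>v\<in>D. q u v = L2_inner f v)}"

definition sqrt_potential_mult :: "(real \<Rightarrow> real) \<Rightarrow> (real \<Rightarrow> complex) \<Rightarrow> real \<Rightarrow> complex" where
  "sqrt_potential_mult V u = (\<lambda>x. of_real (sqrt (V x)) * u x)"

definition schroedinger_form_domain :: "(real \<Rightarrow> real) \<Rightarrow> (real \<Rightarrow> complex) set" where
  "schroedinger_form_domain V = {u \<in> H1. sqrt_potential_mult V u \<in> L2}"

(* The sesquilinear form whose diagonal is h^2 ||u'||^2 + ||V^(1/2) u||^2. *)
definition schroedinger_form ::
  "real \<Rightarrow> (real \<Rightarrow> real) \<Rightarrow> (real \<Rightarrow> complex) \<Rightarrow> (real \<Rightarrow> complex) \<Rightarrow> complex" where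
  "schroedinger_form h V u v =
     of_real (h\<^sup>2) * L2_inner (weak_deriv u) (weak_deriv v)
     + L2_inner (sqrt_potential_mult V u) (sqrt_potential_mult V v)"

definition schroedinger :: "real \<Rightarrow> (real \<Rightarrow> real) \<Rightarrow> L2_operator" where
  "schroedinger h V = form_operator (schroedinger_form_domain V) (schroedinger_form h V)"


definition resolvent_set :: "L2_operator \<Rightarrow> complex set" where
  "resolvent_set T = {z.
     (\<exists>C. \<forall>(u, g)\<in>T. L2_norm u \<le> C * L2_norm (\<lambda>x. g x - z * u x)) \<and>
     (\<forall>f\<in>L2. \<exists>(u, g)\<in>T. AE x in lborel. g x - z * u x = f x)}"

definition spectrum :: "L2_operator \<Rightarrow> complex set" where
  "spectrum T = - resolvent_set T"

definition eigenspace :: "L2_operator \<Rightarrow> complex \<Rightarrow> (real \<Rightarrow> complex) set" where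
  "eigenspace T z = {u. (u, \<lambda>x. z * u x) \<in> T}"

definition multiplicity :: "L2_operator \<Rightarrow> complex \<Rightarrow> enat" where
  "multiplicity T z = L2_dim (eigenspace T z)"

definition discrete_spectrum :: "L2_operator \<Rightarrow> complex set" where
  "discrete_spectrum T =
     {z. z isolated_in spectrum T \<and> 0 < multiplicity T z \<and> multiplicity T z < \<infinity>}"

definition essential_spectrum :: "L2_operator \<Rightarrow> complex set" where
  "essential_spectrum T = spectrum T - discrete_spectrum T"

(* Equal to \<infinity> if the essential spectrum is empty. *)
definition essential_bottom :: "L2_operator \<Rightarrow> ereal" where
  "essential_bottom T = Inf {ereal t | t. complex_of_real t \<in> essential_spectrum T}"

(* Number of eigenvalues in A, counted with multiplicity; points that are not eigenvalues
   have multiplicity 0 and do not contribute. *)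
definition eigenvalue_count :: "L2_operator \<Rightarrow> real set \<Rightarrow> enat" where
  "eigenvalue_count T A =
     (SUP F\<in>{F. finite F \<and> F \<subseteq> A}. \<Sum>t\<in>F. multiplicity T (complex_of_real t))"

(* For self-adjoint T bounded below and k \<ge> 1. In the first case the infimum is a minimum: the
   eigenvalues below the bottom of the essential spectrum are discrete and can only accumulate
   at it. *)
definition kth_eigenvalue :: "nat \<Rightarrow> L2_operator \<Rightarrow> ereal" where
  "kth_eigenvalue k T =
     (if enat k \<le> eigenvalue_count T {t. ereal t < essential_bottom T}
      then Inf {ereal t | t. enat k \<le> eigenvalue_count T {..t}}
      else essential_bottom T)"

definition normalized_eigenvector :: "L2_operator \<Rightarrow> real \<Rightarrow> (real \<Rightarrow> complex) \<Rightarrow> bool" where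
  "normalized_eigenvector T t u \<longleftrightarrow> u \<in> eigenspace T (complex_of_real t) \<and> L2_norm u = 1"


definition flat_at_0 :: "(real \<Rightarrow> real) \<Rightarrow> bool" where
  "flat_at_0 V \<longleftrightarrow> (\<forall>n::nat. V \<in> O[nhds 0](\<lambda>x. \<bar>x\<bar> ^ n))"

definition well_edges :: "(real \<Rightarrow> real) \<Rightarrow> real \<Rightarrow> real \<times> real \<Rightarrow> bool" where
  "well_edges V h = (\<lambda>(a, b).
     a < 0 \<and> 0 < b \<and> V a = h\<^sup>2 / (b - a)\<^sup>2 \<and> V b = h\<^sup>2 / (b - a)\<^sup>2)"

definition dirichlet_mode :: "nat \<Rightarrow> real \<Rightarrow> real \<Rightarrow> real \<Rightarrow> complex" where
  "dirichlet_mode k a b x =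
     complex_of_real (sqrt (2 / (b - a)) * sin (pi * real k * ((x - a) / (b - a)))
                      * indicator {a..b} x)"

end

theory Submission
  imports Defs
begin

text \<open>
  Write \<open>L = \<delta>\<^sub>+ - \<delta>\<^sub>-\<close> and \<open>\<epsilon> = h\<^sup>2 / L\<^sup>2\<close>. Since \<open>V x / x ^ n\<close> is monotone near \<open>0\<close> for every \<open>n\<close>,
  a dilation by \<open>1 + \<eta>\<close> multiplies \<open>V\<close> by at least \<open>(1 + \<eta>) ^ n\<close>. So, seen at the scale \<open>L\<close> and
  with \<open>\<epsilon>\<close> as the unit of energy, \<open>V\<close> tends to an infinite square well: it is small inside
  \<open>[\<delta>\<^sub>-, \<delta>\<^sub>+]\<close>, at most \<open>\<epsilon>\<close> up to the edges, and huge outside (\<open>well_shape\<close>). One therefore expects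
  \<open>\<lambda>\<^sub>k(P) \<sim> (\<pi> k)\<^sup>2 \<epsilon>\<close>, with the eigenfunctions of the Dirichlet problem on \<open>[\<delta>\<^sub>-, \<delta>\<^sub>+]\<close>. Three
  estimates prove this.

  Upper bound (\<open>eigenvalue_upper\<close>): the Dirichlet modes, extended by \<open>0\<close>, are trial functions whose
  potential energy is \<open>o(\<epsilon>)\<close>.

  Lower bound (\<open>eigenvalue_lower\<close>): some combination of the first \<open>k\<close> eigenfunctions vanishes at the
  \<open>k - 1\<close> points that cut the well into \<open>k\<close> equal pieces. It is small close to the edges because the
  potential is huge there, so on each piece of length about \<open>L / k\<close> it has almost Dirichlet boundary
  values, and a Riccati substitution (\<open>Robin_inequality\<close>) bounds its energy from below by
  \<open>(\<pi> k)\<^sup>2 \<epsilon>\<close> up to \<open>o(\<epsilon>)\<close>. Completeness of the Fourier system is thus never used.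

  Eigenfunctions (\<open>eigenvector_near_mode\<close>): by induction the \<open>k\<close>-th mode is almost orthogonal to the
  first \<open>k - 1\<close> eigenfunctions; its energy is almost \<open>\<lambda>\<^sub>k\<close>, and \<open>\<lambda>\<^sub>k\<^sub>+\<^sub>1 - \<lambda>\<^sub>k\<close> is of order \<open>\<epsilon>\<close>, so it must
  be close to the line spanned by the \<open>k\<close>-th eigenfunction.

  These arguments presuppose the spectral theory of \<open>P\<close> below the level of \<open>V\<close> at infinity. It is
  derived for an abstract closed form that dominates a constant up to a finite-rank perturbation
  (\<open>finite_rank_form\<close>). Such a form has a finite orthonormal system of eigenvectors on whose
  orthogonal complement it is bounded below (\<open>complete_eigen_system_exists\<close>); resolvent, discrete
  spectrum and multiplicities can be read off from this system (\<open>kth_eigenvalue_eq\<close>). For the form of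
  \<open>P\<close> the finite-rank condition is a Poincare inequality on short intervals (\<open>finite_rank\<close>).
\<close>

section \<open>Complex Hilbert spaces\<close>

text \<open>The complex structure is added to a real Hilbert space as an isometry \<open>J\<close> with \<open>J\<^sup>2 = -1\<close>, so
  that norms, limits and completeness are those of the real classes.\<close>

class complex_hilbert = real_inner + complete_space +
  fixes J :: "'a \<Rightarrow> 'a"
  assumes J_add: "J (x + y) = J x + J y"
    and J_scaleR: "J (r *\<^sub>R x) = r *\<^sub>R J x"
    and J_J: "J (J x) = - x"
    and J_inner: "J x \<bullet> J y = x \<bullet> y"

instantiation prod :: (complex_hilbert, complex_hilbert) complex_hilbert
begin
definition J_prod :: "'a \<times> 'b \<Rightarrow> 'a \<times> 'b" where "J_prod w = (J (fst w), J (snd w))"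
instance
  by standard (auto simp: J_prod_def J_add J_scaleR J_J J_inner inner_prod_def)
end

lemma J_Pair: "J (u, p) = (J u, J p)" by (simp add: J_prod_def)

definition cscale :: "complex \<Rightarrow> 'a::complex_hilbert \<Rightarrow> 'a" where
  "cscale c x = Re c *\<^sub>R x + Im c *\<^sub>R J x"

text \<open>A form that is conjugate-linear in its second argument is determined by its real part, since its
  imaginary part at \<open>(x, y)\<close> is its real part at \<open>(x, i y)\<close>.\<close>

definition cinner :: "'a::complex_hilbert \<Rightarrow> 'a \<Rightarrow> complex" where
  "cinner x y = Complex (x \<bullet> y) (x \<bullet> J y)"

lemma J_zero [simp]: "J (0::'a::complex_hilbert) = 0"
  using J_scaleR[of 0 "0::'a"] by simp
lemma J_minus: "J (- x) = - J (x::'a::complex_hilbert)"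
  using J_scaleR[of "-1" x] by simp
lemma J_diff: "J (x - y) = J x - J (y::'a::complex_hilbert)"
  using J_add[of x "-y"] by (simp add: J_minus)
lemma inner_J_left: "J x \<bullet> y = - (x \<bullet> J (y::'a::complex_hilbert))"
  using J_inner[of "J x" y] by (simp add: J_J)
lemma inner_J_self [simp]: "x \<bullet> J (x::'a::complex_hilbert) = 0"
  using inner_J_left[of x x] by (simp add: inner_commute)

lemma Re_cinner [simp]: "Re (cinner x y) = x \<bullet> y" and Im_cinner: "Im (cinner x y) = x \<bullet> J y"
  by (simp_all add: cinner_def)
lemma cinner_add_left: "cinner (x + y) z = cinner x z + cinner y z"
  by (rule complex_eqI) (simp_all add: Im_cinner inner_add_left)
lemma cinner_add_right: "cinner x (y + z) = cinner x y + cinner x z"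
  by (rule complex_eqI) (simp_all add: Im_cinner inner_add_right J_add)
lemma cinner_diff_left: "cinner (x - y) z = cinner x z - cinner y z"
  by (rule complex_eqI) (simp_all add: Im_cinner inner_diff_left)
lemma cinner_diff_right: "cinner x (y - z) = cinner x y - cinner x z"
  by (rule complex_eqI) (simp_all add: Im_cinner inner_diff_right J_diff)
lemma cinner_cscale_left: "cinner (cscale c x) y = c * cinner x y"
  by (rule complex_eqI) (simp_all add: Im_cinner cscale_def inner_add_left inner_J_left J_J algebra_simps)
lemma cinner_cscale_right: "cinner x (cscale c y) = cnj c * cinner x y"
  by (rule complex_eqI) (simp_all add: Im_cinner cscale_def inner_add_right J_add J_scaleR J_J algebra_simps)
lemma cinner_commute: "cinner y x = cnj (cinner x y)"
  by (rule complex_eqI) (simp_all add: Im_cinner inner_commute inner_J_left[of x y, symmetric])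
lemma cinner_zero_left [simp]: "cinner 0 x = 0" and cinner_zero_right [simp]: "cinner x 0 = 0"
  by (auto simp: cinner_def complex_eq_iff)
lemma cinner_self: "cinner x x = of_real ((norm x)\<^sup>2)"
  by (rule complex_eqI) (simp_all add: Im_cinner power2_norm_eq_inner)
lemma cinner_sum_left: "cinner (sum f A) y = (\<Sum>i\<in>A. cinner (f i) y)"
  by (induction A rule: infinite_finite_induct) (simp_all add: cinner_add_left)
lemma cinner_sum_right: "cinner y (sum f A) = (\<Sum>i\<in>A. cinner y (f i))"
  by (induction A rule: infinite_finite_induct) (simp_all add: cinner_add_right)
lemma cinner_scaleR_left: "cinner (r *\<^sub>R x) y = of_real r * cinner x y"
  by (rule complex_eqI) (simp_all add: Im_cinner)
lemma norm_cscale: "norm (cscale c x) = cmod c * norm x"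
proof -
  have "complex_of_real ((norm (cscale c x))\<^sup>2) = cinner (cscale c x) (cscale c x)"
    by (simp add: cinner_self)
  also have "\<dots> = of_real ((cmod c * norm x)\<^sup>2)"
    unfolding cinner_cscale_left cinner_cscale_right
    using complex_norm_square[of c] by (simp add: cinner_self power_mult_distrib)
  finally have "(norm (cscale c x))\<^sup>2 = (cmod c * norm x)\<^sup>2"
    by (metis of_real_eq_iff)
  then show ?thesis by simp
qed
lemma cmod_cinner_le: "cmod (cinner x y) \<le> norm x * norm (y::'a::complex_hilbert)"
proof (cases "cinner x y = 0")
  case False
  define c where "c = cnj (cinner x y) / of_real (cmod (cinner x y))"
  have c: "cmod c = 1" using False by (simp add: c_def norm_divide)
  have "c * cinner x y = of_real (cmod (cinner x y))"
    using False by (simp add: c_def mult.commute[of "cnj _"] complex_norm_square[symmetric] power2_eq_square)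
  then have "cmod (cinner x y) = Re (cinner (cscale c x) y)"
    by (simp add: cinner_cscale_left)
  also have "\<dots> \<le> norm (cscale c x) * norm y" by (simp add: norm_cauchy_schwarz)
  finally show ?thesis by (simp add: norm_cscale c)
qed simp
lemma cinner_zero_iff: "cinner x y = 0 \<longleftrightarrow> x \<bullet> y = 0 \<and> x \<bullet> J y = 0"
  by (simp add: complex_eq_iff Im_cinner)

lemma cscale_zero [simp]: "cscale 0 x = 0" and cscale_one [simp]: "cscale 1 x = x"
  by (simp_all add: cscale_def)

lemma cscale_Pair: "cscale a (x, y) = (cscale a x, cscale a y)"
  by (simp add: cscale_def J_Pair)

lemma sum_Pair: "(\<Sum>i\<in>A. (f i, g i)) = (sum f A, sum g A)"
  by (rule prod_eqI) (simp_all add: fst_sum snd_sum)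

lemma cinner_Pair: "cinner (a, b) (c, d) = cinner a c + cinner b d"
  by (rule complex_eqI) (simp_all add: Im_cinner J_Pair inner_prod_def)

lemma cinner_minus_right: "cinner x (- y) = - cinner x y"
  using cinner_diff_right[of x 0 y] by simp

text \<open>The weights serve eigenvectors, where \<open>w i = 1\<close>, as well as their images in the form space, whose
  squared norms are the eigenvalues.\<close>

lemma Pythagoras_system:
  fixes e :: "nat \<Rightarrow> 'a::complex_hilbert"
  assumes e: "\<And>i j. i < m \<Longrightarrow> j < m \<Longrightarrow> cinner (e i) (e j) = (if i = j then of_real (w i) else 0)"
    and x': "\<And>i. i < m \<Longrightarrow> cinner x' (e i) = 0"
  shows "(norm ((\<Sum>i<m. cscale (a i) (e i)) + x'))\<^sup>2 = (\<Sum>i<m. (cmod (a i))\<^sup>2 * w i) + (norm x')\<^sup>2"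
proof -
  let ?s = "\<Sum>i<m. cscale (a i) (e i)"
  have *: "cinner (e i) x' = 0" if "i < m" for i
    using x'[OF that] cinner_commute[of "e i" x'] by simp
  have "complex_of_real ((norm (?s + x'))\<^sup>2) = cinner (?s + x') (?s + x')" by (simp add: cinner_self)
  also have "\<dots> = cinner ?s ?s + cinner x' x'"
    by (simp add: cinner_add_left cinner_add_right cinner_sum_left cinner_sum_right
        cinner_cscale_left cinner_cscale_right x' *)
  also have "cinner ?s ?s = (\<Sum>i<m. \<Sum>j<m. if i = j then a i * cnj (a i) * of_real (w i) else 0)"
    unfolding cinner_sum_left
    by (intro sum.cong refl) (simp add: cinner_sum_right cinner_cscale_left cinner_cscale_right e
        sum_distrib_left if_distrib[of "\<lambda>x. _ * x"] cong: if_cong)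
  also have "\<dots> = of_real (\<Sum>i<m. (cmod (a i))\<^sup>2 * w i)"
    by (simp add: complex_norm_square[symmetric] del: of_real_power)
  finally show ?thesis
    unfolding cinner_self of_real_add[symmetric] by (metis of_real_eq_iff)
qed

lemma Bessel_real:
  fixes e :: "nat \<Rightarrow> 'a::complex_hilbert"
  assumes e: "\<And>i j. i < m \<Longrightarrow> j < m \<Longrightarrow> cinner (e i) (e j) = (if i = j then 1 else 0)"
  shows "(\<Sum>i<m. (e i \<bullet> g)\<^sup>2) \<le> (norm g)\<^sup>2"
proof -
  define a where "a i = cinner g (e i)" for i
  define x' where "x' = g - (\<Sum>i<m. cscale (a i) (e i))"
  have x': "cinner x' (e j) = 0" if "j < m" for j
  proof -
    have "cinner (\<Sum>i<m. cscale (a i) (e i)) (e j) = (\<Sum>i<m. if i = j then a j else 0)"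
      unfolding cinner_sum_left by (intro sum.cong refl) (auto simp: cinner_cscale_left e that)
    then show ?thesis using that by (simp add: x'_def cinner_diff_left a_def)
  qed
  have "(norm g)\<^sup>2 = (norm ((\<Sum>i<m. cscale (a i) (e i)) + x'))\<^sup>2" by (simp add: x'_def)
  also have "\<dots> = (\<Sum>i<m. (cmod (a i))\<^sup>2 * 1) + (norm x')\<^sup>2"
    by (rule Pythagoras_system) (auto simp: e x')
  also have "\<dots> \<ge> (\<Sum>i<m. (cmod (a i))\<^sup>2)" by simp
  finally have 1: "(\<Sum>i<m. (cmod (a i))\<^sup>2) \<le> (norm g)\<^sup>2" .
  have "(e i \<bullet> g)\<^sup>2 \<le> (cmod (a i))\<^sup>2" for i
    using abs_Re_le_cmod[of "a i"] by (simp add: a_def abs_le_square_iff[symmetric] inner_commute)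
  then have "(\<Sum>i<m. (e i \<bullet> g)\<^sup>2) \<le> (\<Sum>i<m. (cmod (a i))\<^sup>2)" by (intro sum_mono)
  then show ?thesis using 1 by simp
qed

section \<open>Projections and the Lax--Milgram theorem\<close>

text \<open>By the parallelogram law every sequence in \<open>M\<close> that minimises the distance to \<open>x\<close> is Cauchy.\<close>

lemma orthogonal_projection_exists:
  fixes M :: "'a::{real_inner,complete_space} set"
  assumes "subspace M" "closed M"
  shows "\<exists>p\<in>M. \<forall>m\<in>M. (x - p) \<bullet> m = 0"
proof -
  define D where "D = (\<lambda>m. (norm (x - m))\<^sup>2) ` M"
  define d where "d = Inf D"
  have M0: "0 \<in> M" using assms(1) by (rule subspace_0)
  have bdd: "bdd_below D" unfolding D_def by (rule bdd_belowI2[of _ 0]) simp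
  have ne: "D \<noteq> {}" using M0 by (auto simp: D_def)
  have d_le: "d \<le> (norm (x - m))\<^sup>2" if "m \<in> M" for m
    unfolding d_def by (rule cInf_lower[OF _ bdd]) (use that in \<open>auto simp: D_def\<close>)
  have "\<exists>m\<in>M. (norm (x - m))\<^sup>2 < d + 1 / real (Suc n)" for n
    using cInf_lessD[OF ne, of "d + 1 / real (Suc n)"] by (auto simp: D_def d_def)
  then obtain s where s: "\<And>n. s n \<in> M" "\<And>n. (norm (x - s n))\<^sup>2 < d + 1 / real (Suc n)" by metis
  have key: "(norm (y - z))\<^sup>2 \<le> 2 * ((norm (x - y))\<^sup>2 - d) + 2 * ((norm (x - z))\<^sup>2 - d)"
    if "y \<in> M" "z \<in> M" for y z
  proof -
    have "(1/2) *\<^sub>R (y + z) \<in> M" using assms(1) that by (intro subspace_scale subspace_add)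
    then have "d \<le> (norm (x - (1/2) *\<^sub>R (y + z)))\<^sup>2" by (rule d_le)
    also have "\<dots> = (norm (x - y))\<^sup>2 / 2 + (norm (x - z))\<^sup>2 / 2 - (norm (y - z))\<^sup>2 / 4"
      unfolding power2_norm_eq_inner by (simp add: algebra_simps inner_commute) (simp add: field_simps)
    finally show ?thesis by simp
  qed
  have "Cauchy s"
  proof (rule CauchyI)
    fix e :: real assume "e > 0"
    then obtain N where N: "4 / (e\<^sup>2) < real N" using reals_Archimedean2 by blast
    have "norm (s m - s n) < e" if "m \<ge> N" "n \<ge> N" for m n
    proof -
      have *: "1 / real (Suc k) < e\<^sup>2 / 4" if "k \<ge> N" for k
      proof -
        have "4 / e\<^sup>2 < real (Suc k)" using N that by linarith
        then show ?thesis using \<open>e > 0\<close> by (simp add: field_simps)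
      qed
      have "(norm (s m - s n))\<^sup>2 < e\<^sup>2"
        using key[OF s(1)[of m] s(1)[of n]] s(2)[of m] s(2)[of n] *[OF that(1)] *[OF that(2)] by argo
      then show ?thesis using \<open>e > 0\<close> power_less_imp_less_base by fastforce
    qed
    then show "\<exists>N. \<forall>m\<ge>N. \<forall>n\<ge>N. norm (s m - s n) < e" by blast
  qed
  then obtain p where p: "s \<longlonglongrightarrow> p" using Cauchy_convergent_iff convergent_def by blast
  have pM: "p \<in> M" using closed_sequentially[OF assms(2)] s(1) p by blast
  have "(norm (x - p))\<^sup>2 \<le> d"
  proof (rule LIMSEQ_le)
    show "(\<lambda>n. (norm (x - s n))\<^sup>2) \<longlonglongrightarrow> (norm (x - p))\<^sup>2" by (intro tendsto_intros p)
    show "(\<lambda>n. d + 1 / real (Suc n)) \<longlonglongrightarrow> d"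
      using tendsto_add[OF tendsto_const LIMSEQ_inverse_real_of_nat, of d] by (simp add: field_simps)
  qed (use s(2) less_imp_le in blast)
  have "(x - p) \<bullet> m = 0" if "m \<in> M" for m
  proof (cases "m = 0")
    case False
    define t where "t = ((x - p) \<bullet> m) / (m \<bullet> m)"
    have "p + t *\<^sub>R m \<in> M" using assms(1) pM that by (intro subspace_add subspace_scale)
    then have "(norm (x - p))\<^sup>2 \<le> (norm (x - (p + t *\<^sub>R m)))\<^sup>2"
      using d_le \<open>(norm (x - p))\<^sup>2 \<le> d\<close> by (meson order_trans)
    also have "\<dots> = (norm (x - p))\<^sup>2 - 2 * t * ((x - p) \<bullet> m) + t * t * (m \<bullet> m)"
      unfolding power2_norm_eq_inner by (simp add: algebra_simps inner_commute)
    also have "\<dots> = (norm (x - p))\<^sup>2 - ((x - p) \<bullet> m)\<^sup>2 / (m \<bullet> m)"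
      using False by (simp add: t_def field_simps power2_eq_square)
    finally have "((x - p) \<bullet> m)\<^sup>2 / (m \<bullet> m) \<le> 0" by simp
    moreover have "m \<bullet> m > 0" using False by simp
    ultimately show ?thesis by (simp add: divide_le_0_iff)
  qed simp
  then show ?thesis using pM by blast
qed

text \<open>The solution is the fixed point of \<open>w \<mapsto> w - \<rho> P (B w - F)\<close>, with \<open>P\<close> the projection onto \<open>M\<close>:
  coercivity makes this map a contraction for small \<open>\<rho>\<close>. No symmetry is required of \<open>B\<close>, which allows
  non-real spectral parameters.\<close>

lemma Lax_Milgram:
  fixes M :: "'a::{real_inner,complete_space} set"
  assumes M: "subspace M" "closed M" and B: "bounded_linear B"
    and \<alpha>: "\<alpha> > 0" "\<And>w. w \<in> M \<Longrightarrow> B w \<bullet> w \<ge> \<alpha> * (norm w)\<^sup>2"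
  shows "\<exists>w\<in>M. \<forall>m\<in>M. B w \<bullet> m = F \<bullet> m"
proof -
  obtain P where P: "\<And>x. P x \<in> M" "\<And>x m. m \<in> M \<Longrightarrow> P x \<bullet> m = x \<bullet> m"
    using orthogonal_projection_exists[OF M] by (metis (no_types, lifting) inner_diff_left right_minus_eq)
  interpret B: bounded_linear B by fact
  obtain K where K: "K > 0" "\<And>x. norm (B x) \<le> norm x * K" using B.pos_bounded by blast
  define C where "C = max K \<alpha>"
  have C: "C > 0" "\<alpha> \<le> C" "\<And>x. norm (B x) \<le> norm x * C"
    using K \<alpha>(1) by (auto simp: C_def intro!: order_trans[OF K(2)] mult_left_mono)
  \<comment> \<open>the minimiser of the squared Lipschitz bound \<open>1 - 2 \<rho> \<alpha> + \<rho>\<^sup>2 C\<^sup>2\<close>\<close>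
  define \<rho> where "\<rho> = \<alpha> / C\<^sup>2"
  define f where "f w = w - \<rho> *\<^sub>R P (B w - F)" for w
  define c where "c = sqrt (1 - \<alpha>\<^sup>2 / C\<^sup>2)"
  have "\<alpha>\<^sup>2 / C\<^sup>2 \<le> 1" using C \<alpha>(1) by (simp add: power_mono)
  then have c: "0 \<le> c" "c < 1" "c\<^sup>2 = 1 - \<alpha>\<^sup>2 / C\<^sup>2" using \<alpha>(1) C(1) by (auto simp: c_def)
  have contr: "dist (f x) (f y) \<le> c * dist x y" if "x \<in> M" "y \<in> M" for x y
  proof -
    define d where "d = x - y"
    define \<pi> where "\<pi> = P (B x - F) - P (B y - F)"
    have dM: "d \<in> M" using that M(1) by (simp add: d_def subspace_diff)
    have \<pi>M: "\<pi> \<in> M" using P(1) M(1) by (simp add: \<pi>_def subspace_diff)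
    have \<pi>: "\<pi> \<bullet> m = B d \<bullet> m" if "m \<in> M" for m
      using that by (simp add: \<pi>_def inner_diff_left P(2) d_def B.diff)
    have "(norm \<pi>)\<^sup>2 \<le> (norm d * C)\<^sup>2"
    proof -
      have "norm \<pi> * norm \<pi> \<le> norm (B d) * norm \<pi>"
        using \<pi>[OF \<pi>M] norm_cauchy_schwarz[of "B d" \<pi>] by (simp add: power2_norm_eq_inner[symmetric] power2_eq_square)
      then have "norm \<pi> \<le> norm (B d)" by (cases "\<pi> = 0") auto
      then show ?thesis using C(3)[of d] by (intro power_mono) auto
    qed
    then have \<pi>2: "\<rho>\<^sup>2 * (norm \<pi>)\<^sup>2 \<le> \<rho>\<^sup>2 * ((norm d)\<^sup>2 * C\<^sup>2)"
      by (intro mult_left_mono) (auto simp: power_mult_distrib)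
    have d\<pi>: "\<rho> * (\<alpha> * (norm d)\<^sup>2) \<le> \<rho> * (d \<bullet> \<pi>)"
      using \<pi>[OF dM] \<alpha>(2)[OF dM] \<alpha>(1) by (intro mult_left_mono) (auto simp: inner_commute \<rho>_def)
    have "(dist (f x) (f y))\<^sup>2 = (norm (d - \<rho> *\<^sub>R \<pi>))\<^sup>2"
      by (simp add: dist_norm f_def d_def \<pi>_def algebra_simps)
    also have "\<dots> = (norm d)\<^sup>2 - 2 * (\<rho> * (d \<bullet> \<pi>)) + \<rho>\<^sup>2 * (norm \<pi>)\<^sup>2"
      unfolding power2_norm_eq_inner by (simp add: algebra_simps inner_commute power2_eq_square)
    also have "\<dots> \<le> (norm d)\<^sup>2 - 2 * (\<rho> * (\<alpha> * (norm d)\<^sup>2)) + \<rho>\<^sup>2 * ((norm d)\<^sup>2 * C\<^sup>2)"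
      using \<pi>2 d\<pi> by linarith
    also have "\<dots> = (c * dist x y)\<^sup>2"
      unfolding power_mult_distrib c(3) dist_norm d_def \<rho>_def
      using C(1) by (simp add: field_simps power2_eq_square)
    finally show ?thesis using c(1) by (meson abs_le_square_iff abs_of_nonneg mult_nonneg_nonneg power2_le_imp_le zero_le_dist)
  qed
  have "\<exists>!x\<in>M. f x = x"
  proof (rule Banach_fix[where c=c])
    show "complete M" using M(2) by (simp add: complete_eq_closed)
    show "M \<noteq> {}" using M(1) subspace_0 by blast
    show "f ` M \<subseteq> M" using M(1) P(1) by (auto simp: f_def intro!: subspace_diff subspace_scale)
  qed (use c contr in auto)
  then obtain w where w: "w \<in> M" "f w = w" by blast
  then have "P (B w - F) = 0" using \<alpha>(1) C(1) by (simp add: f_def \<rho>_def)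
  then have "\<forall>m\<in>M. (B w - F) \<bullet> m = 0" using P(2) by (metis inner_zero_left)
  then show ?thesis using w(1) by (auto simp: inner_diff_left)
qed

section \<open>Discrete spectrum of a form below a finite-rank threshold\<close>

lemma quadratic_nonneg_imp_linear_zero:
  fixes a b :: real
  assumes "\<And>s. 0 \<le> s * b + s\<^sup>2 * a"
  shows "b = 0"
proof (rule ccontr)
  assume "b \<noteq> 0"
  define A where "A = \<bar>a\<bar> + 1"
  have A: "A > 0" "a \<le> A" by (auto simp: A_def)
  have "0 \<le> (- b / (2 * A)) * b + (- b / (2 * A))\<^sup>2 * a" by (rule assms)
  also have "\<dots> \<le> (- b / (2 * A)) * b + (- b / (2 * A))\<^sup>2 * A"
    using A by (intro add_left_mono mult_left_mono) auto
  also have "\<dots> = - b\<^sup>2 / (4 * A)" using A by (simp add: field_simps power2_eq_square)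
  also have "\<dots> < 0" using A \<open>b \<noteq> 0\<close> by simp
  finally show False by simp
qed

text \<open>Convergence against finitely many vectors is the only compactness that enters the construction of
  eigenvectors.\<close>

lemma weakly_convergent_subsequence:
  fixes u :: "nat \<Rightarrow> 'a::real_inner"
  assumes "finite S" "\<And>n. norm (u n) \<le> B"
  shows "\<exists>r::nat\<Rightarrow>nat. strict_mono r \<and> (\<forall>g\<in>S. convergent (\<lambda>n. u (r n) \<bullet> g))"
  using assms(1)
proof (induction S)
  case empty
  show ?case by (intro exI[of _ id]) (auto simp: strict_mono_def)
next
  case (insert g S)
  then obtain r where r: "strict_mono r" "\<forall>g\<in>S. convergent (\<lambda>n. u (r n) \<bullet> g)" by auto
  have "bounded (range (\<lambda>n. u (r n) \<bullet> g))"
  proof (rule boundedI)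
    fix x assume "x \<in> range (\<lambda>n. u (r n) \<bullet> g)"
    then obtain n where "x = u (r n) \<bullet> g" by auto
    then show "norm x \<le> B * norm g"
      using Cauchy_Schwarz_ineq2[of "u (r n)" g] mult_right_mono[OF assms(2)[of "r n"], of "norm g"] by simp
  qed
  then obtain l s where s: "strict_mono s" "((\<lambda>n. u (r n) \<bullet> g) \<circ> s) \<longlonglongrightarrow> l"
    using bounded_imp_convergent_subsequence by blast
  have "convergent (\<lambda>n. u ((r \<circ> s) n) \<bullet> g')" if "g' \<in> insert g S" for g'
  proof (cases "g' = g")
    case True then show ?thesis using s(2) by (auto simp: convergent_def o_def)
  next
    case False
    then have "convergent (\<lambda>n. u (r n) \<bullet> g')" using r(2) that by simp
    then obtain l' where "(\<lambda>n. u (r n) \<bullet> g') \<longlonglongrightarrow> l'" unfolding convergent_def by (elim exE)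
    from LIMSEQ_subseq_LIMSEQ[OF this s(1)] show ?thesis by (auto simp: convergent_def o_def)
  qed
  then show ?case using strict_mono_o[OF r(1) s(1)] by blast
qed

text \<open>Gaussian elimination. Such systems are used to find a vector of a trial space that is orthogonal to
  given eigenvectors, to bound the dimension of an eigenspace, and to prescribe zeros of a
  combination of eigenfunctions.\<close>

lemma homogeneous_system_solvable:
  fixes a :: "nat \<Rightarrow> nat \<Rightarrow> 'a::field"
  assumes "m < n"
  shows "\<exists>c. (\<exists>i<n. c i \<noteq> 0) \<and> (\<forall>j<m. (\<Sum>i<n. c i * a i j) = 0)"
  using assms
proof (induction m arbitrary: n a)
  case 0
  then show ?case by (intro exI[of _ "\<lambda>_. 1"]) auto
next
  case (Suc m)
  show ?case
  proof (cases "\<forall>i<n. a i m = 0")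
    case True
    obtain c where c: "\<exists>i<n. c i \<noteq> 0" "\<forall>j<m. (\<Sum>i<n. c i * a i j) = 0" using Suc.IH[of n a] Suc.prems by auto
    then show ?thesis using True by (intro exI[of _ c]) (auto simp: less_Suc_eq)
  next
    case False
    then obtain q where q: "q < n" "a q m \<noteq> 0" by blast
    \<comment> \<open>the transposition moves the pivot row to the last position, where it is eliminated\<close>
    define \<sigma> where "\<sigma> = Transposition.transpose q (n - 1)"
    define b where "b i j = a (\<sigma> i) j - a (\<sigma> i) m / a q m * a q j" for i j
    have "m < n - 1" using Suc.prems by simp
    from Suc.IH[OF this, of b] obtain c where c: "\<exists>i<n-1. c i \<noteq> 0" "\<forall>j<m. (\<Sum>i<n-1. c i * b i j) = 0" by blast
    have \<sigma>: "bij_betw \<sigma> {..<n} {..<n}"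
      unfolding \<sigma>_def using q Suc.prems by (intro bij_betwI[where g=\<sigma>]) (auto simp: \<sigma>_def Transposition.transpose_def split: if_splits)
    have \<sigma>\<sigma>: "\<sigma> (\<sigma> i) = i" for i by (simp add: \<sigma>_def)
    define d where "d i = (if i < n - 1 then c i else - (\<Sum>i<n-1. c i * a (\<sigma> i) m) / a q m)" for i
    have n: "n = Suc (n - 1)" using Suc.prems by simp
    have last: "\<sigma> (n - 1) = q" by (simp add: \<sigma>_def)
    have sum: "(\<Sum>i<n. d (\<sigma> i) * a i j) = (\<Sum>i<n-1. c i * b i j)" for j
    proof -
      have "(\<Sum>i<n. d (\<sigma> i) * a i j) = (\<Sum>i<n. d (\<sigma> (\<sigma> i)) * a (\<sigma> i) j)"
        by (rule sum.reindex_bij_betw[OF \<sigma>, symmetric])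
      also have "\<dots> = (\<Sum>i<n. d i * a (\<sigma> i) j)" by (simp add: \<sigma>\<sigma>)
      also have "\<dots> = (\<Sum>i<n-1. d i * a (\<sigma> i) j) + d (n-1) * a q j"
        by (subst n) (simp add: last[simplified])
      also have "\<dots> = (\<Sum>i<n-1. c i * a (\<sigma> i) j) - (\<Sum>i<n-1. c i * a (\<sigma> i) m) / a q m * a q j"
        by (simp add: d_def)
      also have "\<dots> = (\<Sum>i<n-1. c i * b i j)"
        by (simp add: b_def algebra_simps sum_subtractf sum_distrib_left sum_distrib_right sum_divide_distrib)
      finally show ?thesis .
    qed
    have "b i m = 0" for i using q by (simp add: b_def)
    then have "(\<Sum>i<n. d (\<sigma> i) * a i j) = 0" if "j < Suc m" for j
      using c(2) that unfolding sum by (cases "j = m") (auto simp: less_Suc_eq)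
    moreover have "\<exists>i<n. d (\<sigma> i) \<noteq> 0"
    proof -
      from c(1) obtain i where i: "i < n - 1" "c i \<noteq> 0" by blast
      have "\<sigma> i < n" using bij_betwE[OF \<sigma>] i(1) by auto
      moreover have "d (\<sigma> (\<sigma> i)) \<noteq> 0" using i by (simp add: \<sigma>\<sigma> d_def)
      ultimately show ?thesis by blast
    qed
    ultimately show ?thesis by (intro exI[of _ "\<lambda>i. d (\<sigma> i)"]) auto
  qed
qed

text \<open>A closed form \<open>\<parallel>A u\<parallel>\<^sup>2\<close> is given through the graph \<open>G\<close> of the closed operator \<open>A\<close>; for the operator
  \<open>P\<close> one has \<open>A u = (h u', V\<^sup>1\<^sup>/\<^sup>2 u)\<close>. Closedness of the form is closedness of a subspace of the product.\<close>

locale form_graph =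
  fixes G :: "('a::complex_hilbert \<times> 'b::complex_hilbert) set"
  assumes subspace_G: "subspace G" and J_G: "w \<in> G \<Longrightarrow> J w \<in> G" and closed_G: "closed G"
begin

lemma G_add: "(u, p) \<in> G \<Longrightarrow> (v, r) \<in> G \<Longrightarrow> (u + v, p + r) \<in> G"
  using subspace_add[OF subspace_G] by force
lemma G_diff: "(u, p) \<in> G \<Longrightarrow> (v, r) \<in> G \<Longrightarrow> (u - v, p - r) \<in> G"
  using subspace_diff[OF subspace_G] by force
lemma G_scaleR: "(u, p) \<in> G \<Longrightarrow> (s *\<^sub>R u, s *\<^sub>R p) \<in> G"
  using subspace_scale[OF subspace_G] by force
lemma G_J: "(u, p) \<in> G \<Longrightarrow> (J u, J p) \<in> G"
  using J_G by (force simp: J_Pair)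
lemma G_cscale: "(u, p) \<in> G \<Longrightarrow> (cscale c u, cscale c p) \<in> G"
  unfolding cscale_def by (intro G_add G_scaleR G_J)
lemma G_zero: "(0, 0) \<in> G"
  using subspace_0[OF subspace_G] by (simp add: zero_prod_def)
lemma G_sum: "(\<And>i. i \<in> A \<Longrightarrow> (u i, p i) \<in> G) \<Longrightarrow> (sum u A, sum p A) \<in> G"
  by (induction A rule: infinite_finite_induct) (auto intro: G_add G_zero)

text \<open>The eigenvalue equation is imposed weakly, against all vectors of the form domain; \<open>p i\<close> is the
  image of \<open>e i\<close> in the form space.\<close>

definition eigen_system :: "real \<Rightarrow> nat \<Rightarrow> (nat \<Rightarrow> 'a) \<Rightarrow> (nat \<Rightarrow> 'b) \<Rightarrow> (nat \<Rightarrow> real) \<Rightarrow> bool" where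
  "eigen_system c m e p \<mu> \<longleftrightarrow>
     (\<forall>i<m. (e i, p i) \<in> G \<and> \<mu> i < c \<and>
        (\<forall>v r. (v, r) \<in> G \<longrightarrow> cinner (p i) r = of_real (\<mu> i) * cinner (e i) v)) \<and>
     (\<forall>i<m. \<forall>j<m. cinner (e i) (e j) = (if i = j then 1 else 0))"

definition orth_G :: "nat \<Rightarrow> (nat \<Rightarrow> 'a) \<Rightarrow> ('a \<times> 'b) set" where
  "orth_G m e = {w \<in> G. \<forall>i<m. cinner (fst w) (e i) = 0}"

lemma orth_G_iff: "(u, p) \<in> orth_G m e \<longleftrightarrow> (u, p) \<in> G \<and> (\<forall>i<m. cinner u (e i) = 0)"
  by (simp add: orth_G_def)

lemma subspace_orth_G: "subspace (orth_G m e)"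
  unfolding subspace_def orth_G_def
  using subspace_G[unfolded subspace_def]
  by (auto simp: cinner_add_left cinner_scaleR_left)

lemma closed_orth_G: "closed (orth_G m e)"
proof -
  have "orth_G m e = G \<inter> (\<Inter>i\<in>{..<m}. {w. fst w \<bullet> e i = 0} \<inter> {w. fst w \<bullet> J (e i) = 0})"
    by (auto simp: orth_G_def cinner_zero_iff)
  also have "closed \<dots>"
    by (intro closed_Int closed_G closed_INT ballI closed_Collect_eq continuous_intros)
  finally show ?thesis .
qed

lemma orth_G_J: "(u, p) \<in> orth_G m e \<Longrightarrow> (J u, J p) \<in> orth_G m e"
  using cinner_cscale_left[of \<i> u] by (auto simp: orth_G_iff G_J cscale_def)

text \<open>The weak eigenvalue equation makes the images of orthogonal eigenvectors orthogonal to each other and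
  to the image of the complement, so one splitting diagonalises the norm and the form.\<close>

lemma eigen_system_decomp:
  assumes es: "eigen_system c m e p \<mu>" and ur: "(u, r) \<in> G"
  defines "a \<equiv> (\<lambda>i. cinner u (e i))"
  defines "u' \<equiv> u - (\<Sum>i<m. cscale (a i) (e i))" and "r' \<equiv> r - (\<Sum>i<m. cscale (a i) (p i))"
  shows "(u', r') \<in> orth_G m e"
    and "(norm u)\<^sup>2 = (\<Sum>i<m. (cmod (a i))\<^sup>2) + (norm u')\<^sup>2"
    and "(norm r)\<^sup>2 = (\<Sum>i<m. (cmod (a i))\<^sup>2 * \<mu> i) + (norm r')\<^sup>2"
    and "\<And>i. i < m \<Longrightarrow> cinner (p i) r' = 0"
proof -
  have e: "cinner (e i) (e j) = (if i = j then 1 else 0)" if "i < m" "j < m" for i j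
    using es that by (simp add: eigen_system_def)
  have p: "cinner (p i) (p j) = (if i = j then of_real (\<mu> i) else 0)" if "i < m" "j < m" for i j
    
  proof -
    have "cinner (p i) (p j) = of_real (\<mu> i) * cinner (e i) (e j)"
      using es that unfolding eigen_system_def by blast
    then show ?thesis by (simp add: e that)
  qed
  have "cinner (\<Sum>i<m. cscale (a i) (e i)) (e j) = a j" if "j < m" for j
  proof -
    have "cinner (\<Sum>i<m. cscale (a i) (e i)) (e j) = (\<Sum>i<m. if i = j then a j else 0)"
      unfolding cinner_sum_left by (intro sum.cong refl) (auto simp: cinner_cscale_left e that)
    then show ?thesis using that by simp
  qed
  then have u'e: "cinner u' (e j) = 0" if "j < m" for j
    using that by (simp add: u'_def cinner_diff_left a_def)
  have G': "(u', r') \<in> G" unfolding u'_def r'_def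
    by (intro G_diff ur G_sum G_cscale) (use es in \<open>auto simp: eigen_system_def\<close>)
  then show "(u', r') \<in> orth_G m e" using u'e by (simp add: orth_G_iff)
  show pr: "cinner (p i) r' = 0" if "i < m" for i
    using es G' u'e[OF that] that cinner_commute[of "e i" u'] by (simp add: eigen_system_def)
  have "u = (\<Sum>i<m. cscale (a i) (e i)) + u'" "r = (\<Sum>i<m. cscale (a i) (p i)) + r'"
    by (simp_all add: u'_def r'_def)
  moreover have "(norm ((\<Sum>i<m. cscale (a i) (e i)) + u'))\<^sup>2 = (\<Sum>i<m. (cmod (a i))\<^sup>2 * 1) + (norm u')\<^sup>2"
    by (rule Pythagoras_system) (auto simp: e u'e)
  moreover have "(norm ((\<Sum>i<m. cscale (a i) (p i)) + r'))\<^sup>2 = (\<Sum>i<m. (cmod (a i))\<^sup>2 * \<mu> i) + (norm r')\<^sup>2"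
    by (rule Pythagoras_system) (use p pr cinner_commute[of r'] in auto)
  ultimately show "(norm u)\<^sup>2 = (\<Sum>i<m. (cmod (a i))\<^sup>2) + (norm u')\<^sup>2"
    and "(norm r)\<^sup>2 = (\<Sum>i<m. (cmod (a i))\<^sup>2 * \<mu> i) + (norm r')\<^sup>2" by (auto simp del: of_real_add)
qed

text \<open>Both sides vanish against the eigenvectors of the system, and testing with \<open>J v\<close> in place of \<open>v\<close>
  recovers the imaginary parts.\<close>

lemma eigen_system_test_complement:
  assumes es: "eigen_system c m e p \<mu>" and uq: "(u, q) \<in> orth_G m e" and f: "\<And>i. i < m \<Longrightarrow> cinner f (e i) = 0"
    and test: "\<And>v r. (v, r) \<in> orth_G m e \<Longrightarrow> q \<bullet> r = f \<bullet> v" and vr: "(v, r) \<in> G"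
  shows "cinner q r = cinner f v"
proof -
  have *: "cinner q r = cinner f v" if "(v, r) \<in> orth_G m e" for v r
    using test[OF that] test[OF orth_G_J[OF that]] by (simp add: complex_eq_iff Im_cinner)
  define v' where "v' = v - (\<Sum>i<m. cscale (cinner v (e i)) (e i))"
  define r' where "r' = r - (\<Sum>i<m. cscale (cinner v (e i)) (p i))"
  have "(v', r') \<in> orth_G m e" unfolding v'_def r'_def by (rule eigen_system_decomp(1)[OF es vr])
  then have "cinner q r' = cinner f v'" by (rule *)
  moreover have "cinner q (p i) = 0" if "i < m" for i
    using es uq that cinner_commute[of q "p i"] cinner_commute[of "e i" u]
    by (auto simp: eigen_system_def orth_G_iff)
  ultimately show ?thesis
    by (simp add: v'_def r'_def cinner_diff_right cinner_sum_right cinner_cscale_right f)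
qed

end

text \<open>The form dominates \<open>c0\<close> times the squared norm up to a finite-rank term. This is an elementary way to say
  that the essential spectrum starts at \<open>c0\<close> or above.\<close>

locale finite_rank_form = form_graph +
  fixes c0 C :: real and S :: "'a set"
  assumes finite_S: "finite S" and C_nonneg: "0 \<le> C"
    and finite_rank_bound: "(u, p) \<in> G \<Longrightarrow> c0 * (norm u)\<^sup>2 \<le> (norm p)\<^sup>2 + C * (\<Sum>g\<in>S. (u \<bullet> g)\<^sup>2)"
begin

text \<open>Let \<open>\<mu> < c0\<close> be the infimum of the form on unit vectors of \<open>M\<close>. For the difference \<open>d\<close> of two almost
  minimisers, the parallelogram law bounds the form at \<open>d\<close> from above by almost \<open>\<mu> \<parallel>d\<parallel>\<^sup>2\<close>, while it is at
  least \<open>c0 \<parallel>d\<parallel>\<^sup>2\<close> minus the finite-rank term. That term tends to \<open>0\<close> along a subsequence, which is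
  therefore Cauchy in norm, and no weak limit is needed.\<close>

lemma minimiser_exists:
  assumes M: "subspace M" "closed M" "M \<subseteq> G" and t: "t \<le> c0"
    and ex: "(u0, p0) \<in> M" "(norm p0)\<^sup>2 < t * (norm u0)\<^sup>2"
  shows "\<exists>u p. (u, p) \<in> M \<and> norm u = 1 \<and> (norm p)\<^sup>2 < t \<and> (\<forall>v r. (v, r) \<in> M \<longrightarrow> p \<bullet> r = (norm p)\<^sup>2 * (u \<bullet> v))"
proof -
  define D where "D = {(norm p)\<^sup>2 | u p. (u, p) \<in> M \<and> norm u = 1}"
  define \<mu> where "\<mu> = Inf D"
  have normalise: "(norm p)\<^sup>2 / (norm u)\<^sup>2 \<in> D" if "(u, p) \<in> M" "u \<noteq> 0" for u p
  proof -
    have "((1 / norm u) *\<^sub>R u, (1 / norm u) *\<^sub>R p) \<in> M"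
      using subspace_scale[OF M(1) that(1), of "1 / norm u"] by simp
    moreover have "(norm ((1 / norm u) *\<^sub>R p))\<^sup>2 = (norm p)\<^sup>2 / (norm u)\<^sup>2" by (simp add: power_divide)
    ultimately show ?thesis unfolding D_def using that(2) by force
  qed
  have bdd: "bdd_below D" by (rule bdd_belowI[of _ 0]) (auto simp: D_def)
  have u0: "u0 \<noteq> 0" using ex(2) by auto
  have ne: "D \<noteq> {}" using normalise[OF ex(1) u0] by blast
  have \<mu>0: "0 \<le> \<mu>" unfolding \<mu>_def by (rule cInf_greatest[OF ne]) (auto simp: D_def)
  have "\<mu> \<le> (norm p0)\<^sup>2 / (norm u0)\<^sup>2" unfolding \<mu>_def by (rule cInf_lower[OF normalise[OF ex(1) u0] bdd])
  also have "\<dots> < t" using ex(2) u0 by (simp add: divide_less_eq)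
  finally have \<mu>t: "\<mu> < t" .
  have low: "\<mu> * (norm u)\<^sup>2 \<le> (norm p)\<^sup>2" if "(u, p) \<in> M" for u p
  proof (cases "u = 0")
    case False
    have "\<mu> \<le> (norm p)\<^sup>2 / (norm u)\<^sup>2" unfolding \<mu>_def by (rule cInf_lower[OF normalise[OF that False] bdd])
    then show ?thesis using False by (simp add: le_divide_eq)
  qed simp
  have "\<exists>u p. (u, p) \<in> M \<and> norm u = 1 \<and> (norm p)\<^sup>2 < \<mu> + 1 / real (Suc n)" for n
    using cInf_lessD[OF ne, of "\<mu> + 1 / real (Suc n)"] by (auto simp: D_def \<mu>_def)
  then obtain U P where UP: "\<And>n. (U n, P n) \<in> M" "\<And>n. norm (U n) = 1" "\<And>n. (norm (P n))\<^sup>2 < \<mu> + 1 / real (Suc n)"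
    by metis
  obtain s where s: "strict_mono s" "\<And>g. g \<in> S \<Longrightarrow> convergent (\<lambda>n. U (s n) \<bullet> g)"
    using weakly_convergent_subsequence[OF finite_S, of U 1] UP(2) by auto
  have small: "(norm (P (s n)))\<^sup>2 < \<mu> + 1 / real (Suc n)" for n
  proof -
    have "1 / real (Suc (s n)) \<le> 1 / real (Suc n)"
      using strict_mono_imp_increasing[OF s(1), of n] by (intro divide_left_mono) auto
    then show ?thesis using UP(3)[of "s n"] by linarith
  qed
  define E where "E = (\<lambda>(i, j). 2 / real (Suc i) + 2 / real (Suc j)
     + C * (\<Sum>g\<in>S. (U (s i) \<bullet> g - U (s j) \<bullet> g)\<^sup>2))"
  have E0: "(E \<longlongrightarrow> 0) (sequentially \<times>\<^sub>F sequentially)"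
  proof -
    obtain l where l: "\<And>g. g \<in> S \<Longrightarrow> (\<lambda>n. U (s n) \<bullet> g) \<longlonglongrightarrow> l g"
      using s(2) unfolding convergent_def by metis
    have *: "((\<lambda>w. f (fst w)) \<longlongrightarrow> L) (sequentially \<times>\<^sub>F sequentially)"
        "((\<lambda>w. f (snd w)) \<longlongrightarrow> L) (sequentially \<times>\<^sub>F sequentially)" if "f \<longlonglongrightarrow> L" for f :: "nat \<Rightarrow> real" and L
      using filterlim_compose[OF that filterlim_fst] filterlim_compose[OF that filterlim_snd] by auto
    have z: "(\<lambda>n. 2 / real (Suc n)) \<longlonglongrightarrow> 0"
      using tendsto_mult[OF tendsto_const LIMSEQ_inverse_real_of_nat, of 2] by (simp add: field_simps)
    have "((\<lambda>w. 2 / real (Suc (fst w)) + 2 / real (Suc (snd w))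
       + C * (\<Sum>g\<in>S. (U (s (fst w)) \<bullet> g - U (s (snd w)) \<bullet> g)\<^sup>2)) \<longlongrightarrow> 0 + 0 + C * (\<Sum>g\<in>S. (l g - l g)\<^sup>2))
        (sequentially \<times>\<^sub>F sequentially)"
      by (intro tendsto_intros *(1)[OF z] *(2)[OF z] *(1)[OF l] *(2)[OF l])
    then show ?thesis by (simp add: E_def case_prod_unfold)
  qed
  \<comment> \<open>the parallelogram law turns almost-minimality into a bound for differences\<close>
  have diff: "(norm (P (s i) - P (s j)))\<^sup>2 \<le> 2 / real (Suc i) + 2 / real (Suc j) + \<mu> * (norm (U (s i) - U (s j)))\<^sup>2" for i j
  proof -
    have "(U (s i) + U (s j), P (s i) + P (s j)) \<in> M"
      using subspace_add[OF M(1) UP(1)[of "s i"] UP(1)[of "s j"]] by simp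
    then have "\<mu> * (norm (U (s i) + U (s j)))\<^sup>2 \<le> (norm (P (s i) + P (s j)))\<^sup>2" by (rule low)
    moreover have "(norm (P (s i) + P (s j)))\<^sup>2 + (norm (P (s i) - P (s j)))\<^sup>2 = 2 * (norm (P (s i)))\<^sup>2 + 2 * (norm (P (s j)))\<^sup>2"
      unfolding power2_norm_eq_inner by (simp add: algebra_simps)
    moreover have "(norm (U (s i) + U (s j)))\<^sup>2 = 4 - (norm (U (s i) - U (s j)))\<^sup>2"
    proof -
      have "(norm (U (s i) + U (s j)))\<^sup>2 + (norm (U (s i) - U (s j)))\<^sup>2 = 2 * (norm (U (s i)))\<^sup>2 + 2 * (norm (U (s j)))\<^sup>2"
        unfolding power2_norm_eq_inner by (simp add: algebra_simps)
      then show ?thesis by (simp add: UP(2))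
    qed
    ultimately show ?thesis using small[of i] small[of j] by (simp add: algebra_simps)
  qed
  define A where "A = (1 + \<mu>) / (c0 - \<mu>) + 1"
  have A: "A > 0" using \<mu>0 \<mu>t t by (simp add: A_def add_nonneg_pos)
  have EC: "(norm ((U (s i), P (s i)) - (U (s j), P (s j))))\<^sup>2 \<le> A * E (i, j)" for i j
  proof -
    let ?u = "U (s i) - U (s j)" and ?p = "P (s i) - P (s j)"
    have "(?u, ?p) \<in> G" using subspace_diff[OF M(1) UP(1)[of "s i"] UP(1)[of "s j"]] M(3) by auto
    then have "c0 * (norm ?u)\<^sup>2 \<le> (norm ?p)\<^sup>2 + C * (\<Sum>g\<in>S. (?u \<bullet> g)\<^sup>2)" by (rule finite_rank_bound)
    then have "(c0 - \<mu>) * (norm ?u)\<^sup>2 \<le> E (i, j)"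
      using diff[of i j] by (simp add: E_def algebra_simps)
    then have u: "(norm ?u)\<^sup>2 \<le> E (i, j) / (c0 - \<mu>)" using \<mu>t t by (simp add: field_simps)
    have "0 \<le> C * (\<Sum>g\<in>S. (?u \<bullet> g)\<^sup>2)" using C_nonneg by (intro mult_nonneg_nonneg sum_nonneg) auto
    then have "(norm ?p)\<^sup>2 \<le> E (i, j) + \<mu> * (norm ?u)\<^sup>2"
      using diff[of i j] by (simp add: E_def inner_diff_left)
    then have "(norm ?u)\<^sup>2 + (norm ?p)\<^sup>2 \<le> E (i, j) + (1 + \<mu>) * (norm ?u)\<^sup>2" by (simp add: algebra_simps)
    also have "\<dots> \<le> E (i, j) + (1 + \<mu>) * (E (i, j) / (c0 - \<mu>))"
      using u \<mu>0 by (intro add_left_mono mult_left_mono) auto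
    finally show ?thesis by (simp add: norm_prod_def A_def algebra_simps)
  qed
  have "Cauchy (\<lambda>n. (U (s n), P (s n)))"
  proof (rule CauchyI)
    fix \<epsilon> :: real assume "\<epsilon> > 0"
    then have "\<forall>\<^sub>F w in sequentially \<times>\<^sub>F sequentially. E w < \<epsilon>\<^sup>2 / A"
      using order_tendstoD(2)[OF E0] A by simp
    then obtain N where N: "\<And>i j. i \<ge> N \<Longrightarrow> j \<ge> N \<Longrightarrow> E (i, j) < \<epsilon>\<^sup>2 / A"
      unfolding eventually_prod_sequentially by auto
    have "norm ((U (s i), P (s i)) - (U (s j), P (s j))) < \<epsilon>" if "i \<ge> N" "j \<ge> N" for i j
    proof -
      have "(norm ((U (s i), P (s i)) - (U (s j), P (s j))))\<^sup>2 < \<epsilon>\<^sup>2"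
        using EC[of i j] N[OF that] A by (simp add: field_simps)
      then show ?thesis using \<open>\<epsilon> > 0\<close> power_less_imp_less_base by fastforce
    qed
    then show "\<exists>N. \<forall>i\<ge>N. \<forall>j\<ge>N. norm ((U (s i), P (s i)) - (U (s j), P (s j))) < \<epsilon>" by blast
  qed
  then obtain w where w: "(\<lambda>n. (U (s n), P (s n))) \<longlonglongrightarrow> w" using Cauchy_convergent_iff convergent_def by blast
  obtain u p where up: "w = (u, p)" by (cases w)
  have wM: "(u, p) \<in> M" using closed_sequentially[OF M(2) _ w] UP(1) up by blast
  have limU: "(\<lambda>n. U (s n)) \<longlonglongrightarrow> u" and limP: "(\<lambda>n. P (s n)) \<longlonglongrightarrow> p"
    using tendsto_fst[OF w] tendsto_snd[OF w] by (auto simp: up)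
  have nu: "norm u = 1"
    using tendsto_norm[OF limU] UP(2) by (simp add: LIMSEQ_const_iff)
  have "(norm p)\<^sup>2 \<le> \<mu>"
  proof (rule LIMSEQ_le)
    show "(\<lambda>n. (norm (P (s n)))\<^sup>2) \<longlonglongrightarrow> (norm p)\<^sup>2" by (intro tendsto_intros limP)
    show "(\<lambda>n. \<mu> + 1 / real (Suc n)) \<longlonglongrightarrow> \<mu>"
      using tendsto_add[OF tendsto_const LIMSEQ_inverse_real_of_nat, of \<mu>] by (simp add: field_simps)
  qed (use small less_imp_le in blast)
  then have p\<mu>: "(norm p)\<^sup>2 = \<mu>" using low[OF wM] nu by simp
  have "p \<bullet> r = \<mu> * (u \<bullet> v)" if vr: "(v, r) \<in> M" for v r
  proof -
    have "0 \<le> x * (2 * (p \<bullet> r - \<mu> * (u \<bullet> v))) + x\<^sup>2 * ((norm r)\<^sup>2 - \<mu> * (norm v)\<^sup>2)" for x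
    proof -
      have "(u + x *\<^sub>R v, p + x *\<^sub>R r) \<in> M"
        using subspace_add[OF M(1) wM subspace_scale[OF M(1) vr, of x]] by simp
      from low[OF this] have "\<mu> * ((norm u)\<^sup>2 + 2 * x * (u \<bullet> v) + x\<^sup>2 * (norm v)\<^sup>2)
          \<le> (norm p)\<^sup>2 + 2 * x * (p \<bullet> r) + x\<^sup>2 * (norm r)\<^sup>2"
        unfolding power2_norm_eq_inner by (simp add: algebra_simps inner_commute power2_eq_square)
      then show ?thesis using p\<mu> nu by (simp add: algebra_simps)
    qed
    from quadratic_nonneg_imp_linear_zero[OF this] show ?thesis by simp
  qed
  then show ?thesis using wM nu p\<mu> \<mu>t by blast
qed

text \<open>By Bessel's inequality the finite-rank terms of all members of the system add up to at most a
  constant, whereas each member needs at least \<open>c0 - c\<close> of it.\<close>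

lemma eigen_system_size_bound:
  assumes es: "eigen_system c m e p \<mu>"
  shows "real m * (c0 - c) \<le> C * (\<Sum>g\<in>S. (norm g)\<^sup>2)"
proof -
  have e: "cinner (e i) (e j) = (if i = j then 1 else 0)" if "i < m" "j < m" for i j
    using es that by (simp add: eigen_system_def)
  have 1: "c0 - c \<le> C * (\<Sum>g\<in>S. (e i \<bullet> g)\<^sup>2)" if "i < m" for i
  proof -
    have G: "(e i, p i) \<in> G" and \<mu>: "\<mu> i < c" and n: "e i \<bullet> e i = 1"
      using es that e[OF that that] Re_cinner[of "e i" "e i"] by (auto simp: eigen_system_def)
    have "cinner (p i) (p i) = of_real (\<mu> i) * cinner (e i) (e i)" using es that by (auto simp: eigen_system_def)
    then have "(norm (p i))\<^sup>2 = \<mu> i" using n by (simp add: complex_eq_iff power2_norm_eq_inner)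
    then show ?thesis using finite_rank_bound[OF G] n \<mu> by (simp add: power2_norm_eq_inner)
  qed
  have "real m * (c0 - c) = (\<Sum>i<m. c0 - c)" by simp
  also have "\<dots> \<le> (\<Sum>i<m. C * (\<Sum>g\<in>S. (e i \<bullet> g)\<^sup>2))" by (intro sum_mono 1) auto
  also have "\<dots> = C * (\<Sum>g\<in>S. \<Sum>i<m. (e i \<bullet> g)\<^sup>2)"
    by (simp add: sum_distrib_left[symmetric] sum.swap[of _ S])
  also have "\<dots> \<le> C * (\<Sum>g\<in>S. (norm g)\<^sup>2)"
    by (intro mult_left_mono sum_mono Bessel_real C_nonneg e)
  finally show ?thesis .
qed

text \<open>A minimiser of the form on the orthogonal complement of the system is a further eigenvector.\<close>

lemma eigen_system_extend:
  assumes es: "eigen_system c m e p \<mu>" and c: "c \<le> c0"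
    and ex: "(u0, r0) \<in> orth_G m e" "(norm r0)\<^sup>2 < c * (norm u0)\<^sup>2"
  shows "\<exists>e p \<mu>. eigen_system c (Suc m) e p \<mu>"
proof -
  have "orth_G m e \<subseteq> G" by (auto simp: orth_G_def)
  from minimiser_exists[OF subspace_orth_G closed_orth_G this c ex]
  obtain u q where uq: "(u, q) \<in> orth_G m e" "norm u = 1" "(norm q)\<^sup>2 < c"
    and min: "\<And>v r. (v, r) \<in> orth_G m e \<Longrightarrow> q \<bullet> r = (norm q)\<^sup>2 * (u \<bullet> v)" by blast
  define l where "l = (norm q)\<^sup>2"
  have eig: "cinner q r = of_real l * cinner u v" if "(v, r) \<in> G" for v r
  proof -
    have "cinner q r = cinner (l *\<^sub>R u) v"
      by (rule eigen_system_test_complement[OF es uq(1) _ _ that])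
        (use uq(1) min in \<open>auto simp: cinner_scaleR_left orth_G_iff l_def\<close>)
    then show ?thesis by (simp add: cinner_scaleR_left)
  qed
  have orth: "cinner u (e i) = 0" "cinner (e i) u = 0" if "i < m" for i
    using uq(1) that cinner_commute[of "e i" u] by (auto simp: orth_G_iff)
  have "eigen_system c (Suc m) (e(m := u)) (p(m := q)) (\<mu>(m := l))"
    using es eig uq orth unfolding eigen_system_def
    by (auto simp: less_Suc_eq orth_G_iff l_def cinner_self)
  then show ?thesis by blast
qed

text \<open>A system of maximal size exists, because sizes are bounded, and it cannot be extended.\<close>

theorem complete_eigen_system_exists:
  assumes c: "c < c0"
  obtains m e p \<mu> where "eigen_system c m e p \<mu>" "\<And>i j. i \<le> j \<Longrightarrow> j < m \<Longrightarrow> \<mu> i \<le> \<mu> j"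
    "\<And>u r. (u, r) \<in> orth_G m e \<Longrightarrow> c * (norm u)\<^sup>2 \<le> (norm r)\<^sup>2"
proof -
  define Q where "Q m \<longleftrightarrow> (\<exists>e p \<mu>. eigen_system c m e p \<mu>)" for m
  define b where "b = nat \<lceil>C * (\<Sum>g\<in>S. (norm g)\<^sup>2) / (c0 - c)\<rceil>"
  have "m \<le> b" if Qm: "Q m" for m
  proof -
    from Qm[unfolded Q_def] obtain e p \<mu> where "eigen_system c m e p \<mu>" by blast
    from eigen_system_size_bound[OF this] have "real m \<le> C * (\<Sum>g\<in>S. (norm g)\<^sup>2) / (c0 - c)"
      using c by (simp add: field_simps)
    then show ?thesis unfolding b_def by linarith
  qed
  moreover have "Q 0" by (simp add: Q_def eigen_system_def)
  ultimately obtain m where m: "Q m" "\<And>n. Q n \<Longrightarrow> n \<le> m"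
    using Nat.ex_has_greatest_nat[of Q 0 b] by blast
  from m(1)[unfolded Q_def] obtain e p \<mu> where es: "eigen_system c m e p \<mu>" by blast
  define xs where "xs = sort_key \<mu> [0..<m]"
  define \<sigma> where "\<sigma> i = xs ! i" for i
  have xs: "distinct xs" "set xs = {..<m}" "length xs = m" "sorted (map \<mu> xs)"
    by (auto simp: xs_def atLeast0LessThan)
  have \<sigma>: "\<sigma> i < m" if "i < m" for i using nth_mem[of i xs] xs that by (auto simp: \<sigma>_def)
  have inj: "\<sigma> i = \<sigma> j \<longleftrightarrow> i = j" if "i < m" "j < m" for i j
    using xs that by (simp add: \<sigma>_def nth_eq_iff_index_eq)
  have surj: "\<exists>j<m. i = \<sigma> j" if "i < m" for i
    using xs that by (metis \<sigma>_def in_set_conv_nth lessThan_iff)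
  show ?thesis
  proof (rule that[of m "e \<circ> \<sigma>" "p \<circ> \<sigma>" "\<mu> \<circ> \<sigma>"])
    show "eigen_system c m (e \<circ> \<sigma>) (p \<circ> \<sigma>) (\<mu> \<circ> \<sigma>)"
      using es \<sigma> inj unfolding eigen_system_def by auto
    show "(\<mu> \<circ> \<sigma>) i \<le> (\<mu> \<circ> \<sigma>) j" if "i \<le> j" "j < m" for i j
      using sorted_nth_mono[OF xs(4) that(1)] that xs(3) by (simp add: \<sigma>_def)
    show "c * (norm u)\<^sup>2 \<le> (norm r)\<^sup>2" if ur: "(u, r) \<in> orth_G m (e \<circ> \<sigma>)" for u r
    proof (rule ccontr)
      assume *: "\<not> ?thesis"
      have "(u, r) \<in> orth_G m e" using ur surj by (auto simp: orth_G_iff) 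
      from eigen_system_extend[OF es _ this] * c have "Q (Suc m)" by (auto simp: Q_def)
      then show False using m(2) by fastforce
    qed
  qed
qed

end

locale complete_eigen_system = form_graph +
  fixes c :: real and m :: nat and e :: "nat \<Rightarrow> 'a" and p :: "nat \<Rightarrow> 'b" and \<mu> :: "nat \<Rightarrow> real"
  assumes system: "eigen_system c m e p \<mu>"
    and mono_\<mu>: "i \<le> j \<Longrightarrow> j < m \<Longrightarrow> \<mu> i \<le> \<mu> j"
    and complement: "(u, r) \<in> orth_G m e \<Longrightarrow> c * (norm u)\<^sup>2 \<le> (norm r)\<^sup>2"
    and c_nonneg: "0 \<le> c"
begin

lemma ep_G: "i < m \<Longrightarrow> (e i, p i) \<in> G" 
  using system unfolding eigen_system_def by blast
lemma \<mu>_less: "i < m \<Longrightarrow> \<mu> i < c"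
  using system unfolding eigen_system_def by blast
lemma eigen: "i < m \<Longrightarrow> (v, r) \<in> G \<Longrightarrow> cinner (p i) r = of_real (\<mu> i) * cinner (e i) v"
  using system unfolding eigen_system_def by blast
lemma orthonormal: "i < m \<Longrightarrow> j < m \<Longrightarrow> cinner (e i) (e j) = (if i = j then 1 else 0)"
  using system unfolding eigen_system_def by blast

lemma norm_e: assumes "i < m" shows "norm (e i) = 1"
proof -
  have "complex_of_real ((norm (e i))\<^sup>2) = 1"
    unfolding cinner_self[symmetric] using orthonormal[OF assms assms] by simp
  then have "(norm (e i))\<^sup>2 = 1" by (metis of_real_eq_1_iff)
  then show ?thesis using norm_ge_zero[of "e i"] unfolding power2_eq_1_iff by linarith
qed

lemma \<mu>_eq: assumes "i < m" shows "(norm (p i))\<^sup>2 = \<mu> i"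
proof -
  have "complex_of_real ((norm (p i))\<^sup>2) = of_real (\<mu> i * (norm (e i))\<^sup>2)"
    using eigen[OF assms ep_G[OF assms]] unfolding cinner_self of_real_mult .
  then have "(norm (p i))\<^sup>2 = \<mu> i * (norm (e i))\<^sup>2" by (metis of_real_eq_iff)
  then show ?thesis by (simp add: norm_e[OF assms])
qed

lemma \<mu>_nonneg: "i < m \<Longrightarrow> 0 \<le> \<mu> i"
  using zero_le_power2[of "norm (p i)"] by (simp add: \<mu>_eq)

text \<open>The second estimate keeps the \<open>k\<close>-th coefficient apart. It shows that a vector which is almost
  orthogonal to the lower eigenvectors and whose energy is close to \<open>\<mu> k\<close> is almost a multiple of \<open>e k\<close>,
  provided there is a gap above \<open>\<mu> k\<close>.\<close>

lemma form_lower_bound: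
  assumes ur: "(u, r) \<in> G"
  shows "k < m \<Longrightarrow> (\<And>i. i < k \<Longrightarrow> cinner u (e i) = 0) \<Longrightarrow> \<mu> k * (norm u)\<^sup>2 \<le> (norm r)\<^sup>2"
    and "Suc k < m \<Longrightarrow> \<mu> k * (cmod (cinner u (e k)))\<^sup>2
          + \<mu> (Suc k) * ((norm u)\<^sup>2 - (\<Sum>i\<le>k. (cmod (cinner u (e i)))\<^sup>2)) \<le> (norm r)\<^sup>2"
proof -
  define a where "a i = (cmod (cinner u (e i)))\<^sup>2" for i
  note dec = eigen_system_decomp[OF system ur]
  define u' where "u' = u - (\<Sum>i<m. cscale (cinner u (e i)) (e i))"
  define r' where "r' = r - (\<Sum>i<m. cscale (cinner u (e i)) (p i))"
  note u' = dec(1-3)[folded u'_def r'_def a_def]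
  have low: "l * (norm u')\<^sup>2 \<le> (norm r')\<^sup>2" if "l \<le> c" for l
    using complement[OF u'(1)] mult_right_mono[OF that, of "(norm u')\<^sup>2"] by simp
  have a0: "0 \<le> a i" for i by (simp add: a_def)
  show "\<mu> k * (norm u)\<^sup>2 \<le> (norm r)\<^sup>2" if "k < m" "\<And>i. i < k \<Longrightarrow> cinner u (e i) = 0"
  proof -
    have "(\<Sum>i<m. \<mu> k * a i) \<le> (\<Sum>i<m. a i * \<mu> i)"
    proof (rule sum_mono)
      fix i assume "i \<in> {..<m}"
      then show "\<mu> k * a i \<le> a i * \<mu> i"
      proof (cases "i < k")
        case True then show ?thesis using that(2) by (simp add: a_def)
      next
        case False then show ?thesis using mono_\<mu>[of k i] \<open>i \<in> {..<m}\<close> a0[of i] mult_right_mono[of "\<mu> k" "\<mu> i" "a i"] by (simp add: mult.commute)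
      qed
    qed
    then show ?thesis using low[of "\<mu> k"] \<mu>_less[OF that(1)] by (simp add: u' algebra_simps sum_distrib_left)
  qed
  show "\<mu> k * (cmod (cinner u (e k)))\<^sup>2 + \<mu> (Suc k) * ((norm u)\<^sup>2 - (\<Sum>i\<le>k. (cmod (cinner u (e i)))\<^sup>2)) \<le> (norm r)\<^sup>2"
    if "Suc k < m"
  proof -
    have split: "(\<Sum>i<m. f i) = (\<Sum>i\<le>k. f i) + (\<Sum>i=Suc k..<m. f i)" for f :: "nat \<Rightarrow> real"
    proof -
      have "{..<m} = {..k} \<union> {Suc k..<m}" using that by auto
      moreover have "sum f ({..k} \<union> {Suc k..<m}) = sum f {..k} + sum f {Suc k..<m}"
        by (rule sum.union_disjoint) auto
      ultimately show ?thesis by simp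
    qed
    have "\<mu> k * a k \<le> (\<Sum>i\<le>k. a i * \<mu> i)"
    proof -
      have "(\<Sum>i\<in>{k}. a i * \<mu> i) \<le> (\<Sum>i\<le>k. a i * \<mu> i)"
        using that by (intro sum_mono2) (auto intro!: mult_nonneg_nonneg a0 \<mu>_nonneg)
      then show ?thesis by (simp add: mult.commute)
    qed
    moreover have "(\<Sum>i=Suc k..<m. \<mu> (Suc k) * a i) \<le> (\<Sum>i=Suc k..<m. a i * \<mu> i)"
      by (intro sum_mono) (use mono_\<mu> a0 in \<open>auto simp: mult.commute[of "\<mu> _"] intro!: mult_left_mono\<close>)
    ultimately show ?thesis
      using low[of "\<mu> (Suc k)"] \<mu>_less[OF that]
      unfolding a_def[symmetric] u' split by (simp add: algebra_simps sum_distrib_left)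
  qed
qed

text \<open>Some vector of the trial space is orthogonal to the first \<open>k\<close> eigenvectors. If the system had no more
  than these, the form would be at least \<open>c\<close> there.\<close>

lemma minmax_upper_bound:
  assumes f: "\<And>i. i \<le> k \<Longrightarrow> (f i, q i) \<in> G" and s: "s < c"
    and bound: "\<And>a. (\<exists>i\<le>k. a i \<noteq> 0) \<Longrightarrow> (\<Sum>i\<le>k. cscale (a i) (f i)) \<noteq> 0 \<and>
       (norm (\<Sum>i\<le>k. cscale (a i) (q i)))\<^sup>2 \<le> s * (norm (\<Sum>i\<le>k. cscale (a i) (f i)))\<^sup>2"
  shows "k < m" "\<mu> k \<le> s"
proof -
  define n where "n = min k m"
  have "n < Suc k" by (simp add: n_def)
  from homogeneous_system_solvable[OF this, of "\<lambda>i j. cinner (f i) (e j)"]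
  obtain a where a: "\<exists>i<Suc k. a i \<noteq> 0" "\<forall>j<n. (\<Sum>i<Suc k. a i * cinner (f i) (e j)) = 0" by blast
  define u where "u = (\<Sum>i\<le>k. cscale (a i) (f i))"
  define r where "r = (\<Sum>i\<le>k. cscale (a i) (q i))"
  have ur: "(u, r) \<in> G" unfolding u_def r_def by (intro G_sum G_cscale f) auto
  have orth: "cinner u (e j) = 0" if "j < n" for j
    using a(2) that by (simp add: u_def cinner_sum_left cinner_cscale_left lessThan_Suc_atMost)
  have "\<exists>i\<le>k. a i \<noteq> 0" using a(1) by (auto simp: less_Suc_eq_le)
  from bound[OF this] have u0: "u \<noteq> 0" and le: "(norm r)\<^sup>2 \<le> s * (norm u)\<^sup>2" by (auto simp: u_def r_def)
  show k: "k < m"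
  proof (rule ccontr)
    assume "\<not> k < m"
    then have "(u, r) \<in> orth_G m e" using ur orth by (auto simp: orth_G_iff n_def)
    from complement[OF this] le have "c * (norm u)\<^sup>2 \<le> s * (norm u)\<^sup>2" by simp
    then show False using u0 s by simp
  qed
  have "\<mu> k * (norm u)\<^sup>2 \<le> (norm r)\<^sup>2" by (rule form_lower_bound(1)[OF ur k]) (use orth k in \<open>auto simp: n_def\<close>)
  then have "\<mu> k * (norm u)\<^sup>2 \<le> s * (norm u)\<^sup>2" using le by simp
  then show "\<mu> k \<le> s" using u0 by simp
qed

lemma span_upper_bound:
  fixes a :: "nat \<Rightarrow> complex"
  assumes k: "k < m"
  defines "u \<equiv> (\<Sum>i\<le>k. cscale (a i) (e i))" and "r \<equiv> (\<Sum>i\<le>k. cscale (a i) (p i))"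
  shows "(u, r) \<in> G" "(norm u)\<^sup>2 = (\<Sum>i\<le>k. (cmod (a i))\<^sup>2)" "(norm r)\<^sup>2 \<le> \<mu> k * (norm u)\<^sup>2"
proof -
  show "(u, r) \<in> G" unfolding u_def r_def by (intro G_sum G_cscale ep_G) (use k in auto)
  have "(norm ((\<Sum>i<Suc k. cscale (a i) (e i)) + 0))\<^sup>2 = (\<Sum>i<Suc k. (cmod (a i))\<^sup>2 * 1) + (norm (0::'a))\<^sup>2"
    by (rule Pythagoras_system) (use k orthonormal in auto)
  then show u: "(norm u)\<^sup>2 = (\<Sum>i\<le>k. (cmod (a i))\<^sup>2)" by (simp add: u_def lessThan_Suc_atMost)
  have "(norm ((\<Sum>i<Suc k. cscale (a i) (p i)) + 0))\<^sup>2 = (\<Sum>i<Suc k. (cmod (a i))\<^sup>2 * \<mu> i) + (norm (0::'b))\<^sup>2"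
  proof (rule Pythagoras_system)
    fix i j assume "i < Suc k" "j < Suc k"
    then show "cinner (p i) (p j) = (if i = j then of_real (\<mu> i) else 0)"
      using k eigen[OF _ ep_G, of i j] orthonormal[of i j] by simp
  qed simp
  then have "(norm r)\<^sup>2 = (\<Sum>i\<le>k. (cmod (a i))\<^sup>2 * \<mu> i)" by (simp add: r_def lessThan_Suc_atMost)
  also have "\<dots> \<le> (\<Sum>i\<le>k. (cmod (a i))\<^sup>2 * \<mu> k)" by (intro sum_mono mult_left_mono mono_\<mu>) (use k in auto)
  finally show "(norm r)\<^sup>2 \<le> \<mu> k * (norm u)\<^sup>2" by (simp add: u sum_distrib_left mult.commute)
qed

text \<open>The weak form of \<open>(T - z) u = f\<close> for the operator \<open>T\<close> associated with the form.\<close>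

definition solves :: "complex \<Rightarrow> 'a \<Rightarrow> 'a \<Rightarrow> bool" where
  "solves z u f \<longleftrightarrow> (\<exists>q. (u, q) \<in> G \<and> (\<forall>v r. (v, r) \<in> G \<longrightarrow> cinner q r - z * cinner u v = cinner f v))"

lemma solvesI: "(u, q) \<in> G \<Longrightarrow> (\<And>v r. (v, r) \<in> G \<Longrightarrow> cinner q r - z * cinner u v = cinner f v) \<Longrightarrow> solves z u f"
  unfolding solves_def by blast

lemma solves_add:
  assumes "solves z u f" "solves z u' f'" shows "solves z (u + u') (f + f')"
proof -
  obtain q where q': "(u, q) \<in> G \<and> (\<forall>v r. (v, r) \<in> G \<longrightarrow> cinner q r - z * cinner u v = cinner f v)"
    using assms(1) unfolding solves_def ..
  note q = q'[THEN conjunct1] q'[THEN conjunct2, rule_format]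
  obtain q' where q1': "(u', q') \<in> G \<and> (\<forall>v r. (v, r) \<in> G \<longrightarrow> cinner q' r - z * cinner u' v = cinner f' v)"
    using assms(2) unfolding solves_def ..
  note q' = q1'[THEN conjunct1] q1'[THEN conjunct2, rule_format]
  show ?thesis
  proof (rule solvesI[OF G_add[OF q(1) q'(1)]])
    fix v r assume "(v, r) \<in> G"
    from q(2)[OF this] q'(2)[OF this]
    show "cinner (q + q') r - z * cinner (u + u') v = cinner (f + f') v"
      by (simp add: cinner_add_left algebra_simps)
  qed
qed

lemma solves_cscale: assumes "solves z u f" shows "solves z (cscale a u) (cscale a f)"
proof -
  obtain q where q': "(u, q) \<in> G \<and> (\<forall>v r. (v, r) \<in> G \<longrightarrow> cinner q r - z * cinner u v = cinner f v)"
    using assms unfolding solves_def ..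
  note q = q'[THEN conjunct1] q'[THEN conjunct2, rule_format]
  show ?thesis
    by (rule solvesI[OF G_cscale[OF q(1)]]) (simp add: q(2)[symmetric] cinner_cscale_left algebra_simps)
qed

lemma solves_zero: "solves z 0 0"
  by (rule solvesI[OF G_zero]) simp

lemma solves_sum: "(\<And>i. i \<in> A \<Longrightarrow> solves z (u i) (f i)) \<Longrightarrow> solves z (sum u A) (sum f A)"
  by (induction A rule: infinite_finite_induct) (auto intro: solves_add solves_zero)

lemma solves_eigen:
  assumes "i < m" "z \<noteq> of_real (\<mu> i)"
  shows "solves z (cscale (1 / (of_real (\<mu> i) - z)) (e i)) (e i)"
proof (rule solvesI[OF G_cscale[OF ep_G[OF assms(1)]]])
  fix v r assume "(v, r) \<in> G"
  have "of_real (\<mu> i) - z \<noteq> 0" using assms(2) by auto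
  then show "cinner (cscale (1 / (of_real (\<mu> i) - z)) (p i)) r
      - z * cinner (cscale (1 / (of_real (\<mu> i) - z)) (e i)) v = cinner (e i) v"
    by (simp add: cinner_cscale_left eigen[OF assms(1) \<open>(v, r) \<in> G\<close>] diff_divide_distrib[symmetric]
        left_diff_distrib[symmetric])
qed

text \<open>On the complement of the system the form minus \<open>z\<close> is coercive, so the Lax--Milgram theorem applies.
  The solution solves the equation on the whole form domain because \<open>f\<close> lies in the complement.\<close>

lemma solvable_on_complement:
  assumes z: "Re z < c" and f: "\<And>i. i < m \<Longrightarrow> cinner f (e i) = 0"
  shows "\<exists>u. solves z u f"
proof -
  define \<alpha> where "\<alpha> = min 1 ((c - Re z) / (1 + c))"
  have \<alpha>: "0 < \<alpha>" "\<alpha> \<le> 1" "\<alpha> * (1 + c) \<le> c - Re z"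
  proof -
    have "\<alpha> * (1 + c) \<le> (c - Re z) / (1 + c) * (1 + c)"
      unfolding \<alpha>_def using c_nonneg by (intro mult_right_mono) auto
    then show "\<alpha> * (1 + c) \<le> c - Re z" using c_nonneg by simp
  qed (use z c_nonneg in \<open>auto simp: \<alpha>_def\<close>)
  define B where "B w = (- cscale z (fst w), snd w)" for w :: "'a \<times> 'b"
  have "bounded_linear B"
  proof (rule bounded_linear_intro)
    show "B (x + y) = B x + B y" for x y by (auto simp: B_def cscale_def J_add algebra_simps)
    show "B (s *\<^sub>R x) = s *\<^sub>R B x" for s x by (auto simp: B_def cscale_def J_scaleR algebra_simps)
    fix x
    show "norm (B x) \<le> norm x * (cmod z + 1)"
    proof -
      have "norm (B x) \<le> norm (- cscale z (fst x)) + norm (snd x)"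
        unfolding B_def by (rule norm_Pair_le)
      also have "\<dots> \<le> cmod z * norm x + norm x"
        using norm_fst_le[of "fst x" "snd x"] norm_snd_le[of "snd x" "fst x"]
        by (intro add_mono) (auto simp: norm_cscale intro!: mult_left_mono)
      finally show ?thesis by (simp add: algebra_simps)
    qed
  qed
  moreover have "B w \<bullet> w \<ge> \<alpha> * (norm w)\<^sup>2" if "w \<in> orth_G m e" for w
  proof -
    obtain u r where w: "w = (u, r)" by (cases w)
    have "B w \<bullet> w = (norm r)\<^sup>2 - Re z * (norm u)\<^sup>2"
      by (simp add: w B_def cscale_def inner_diff_left inner_add_left inner_J_left power2_norm_eq_inner)
    moreover have "c * (norm u)\<^sup>2 * (1 - \<alpha>) \<le> (norm r)\<^sup>2 * (1 - \<alpha>)"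
      using complement that \<alpha>(2) unfolding w by (intro mult_right_mono) auto
    moreover have "\<alpha> * (1 + c) * (norm u)\<^sup>2 \<le> (c - Re z) * (norm u)\<^sup>2"
      by (intro mult_right_mono \<alpha>) auto
    ultimately show ?thesis by (simp add: w norm_prod_def algebra_simps)
  qed
  ultimately obtain w where w: "w \<in> orth_G m e" "\<And>x. x \<in> orth_G m e \<Longrightarrow> B w \<bullet> x = (f, 0) \<bullet> x"
    using Lax_Milgram[OF subspace_orth_G closed_orth_G _ \<alpha>(1)] by metis
  obtain u q where uq: "w = (u, q)" by (cases w)
  have G: "(u, q) \<in> orth_G m e" using w(1) uq by simp
  have "cinner q r = cinner (f + cscale z u) v" if "(v, r) \<in> G" for v r
  proof (rule eigen_system_test_complement[OF system G _ _ that])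
    show "cinner (f + cscale z u) (e i) = 0" if "i < m" for i
      using G f that by (simp add: cinner_add_left cinner_cscale_left orth_G_iff)
    show "q \<bullet> r = (f + cscale z u) \<bullet> v" if "(v, r) \<in> orth_G m e" for v r
      using w(2)[OF that] by (simp add: uq B_def inner_add_left)
  qed
  then have "solves z u f" unfolding solves_def using G
    by (intro exI[of _ q]) (auto simp: orth_G_iff cinner_add_left cinner_cscale_left)
  then show ?thesis by blast
qed

lemma solvable:
  assumes z: "Re z < c" "\<And>i. i < m \<Longrightarrow> z \<noteq> of_real (\<mu> i)"
  shows "\<exists>u. solves z u f"
proof -
  define a where "a i = cinner f (e i)" for i
  define f' where "f' = f - (\<Sum>i<m. cscale (a i) (e i))"
  have "cinner f' (e j) = 0" if "j < m" for j
  proof -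
    have "cinner (\<Sum>i<m. cscale (a i) (e i)) (e j) = (\<Sum>i<m. if i = j then a j else 0)"
      unfolding cinner_sum_left by (intro sum.cong refl) (auto simp: cinner_cscale_left orthonormal that)
    then show ?thesis using that by (simp add: f'_def cinner_diff_left a_def)
  qed
  from solvable_on_complement[OF z(1) this] obtain u where u: "solves z u f'" by blast
  have "solves z ((\<Sum>i<m. cscale (a i) (cscale (1 / (of_real (\<mu> i) - z)) (e i))) + u) ((\<Sum>i<m. cscale (a i) (e i)) + f')"
    by (intro solves_add solves_sum solves_cscale solves_eigen u) (use z(2) in auto)
  then show ?thesis by (auto simp: f'_def)
qed

lemma solves_coefficient:
  assumes uf: "solves z u f" and "i < m"
  shows "cinner f (e i) = (of_real (\<mu> i) - z) * cinner u (e i)"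
proof -
  obtain q where q': "(u, q) \<in> G \<and> (\<forall>v r. (v, r) \<in> G \<longrightarrow> cinner q r - z * cinner u v = cinner f v)"
    using uf unfolding solves_def ..
  note q = q'[THEN conjunct1] q'[THEN conjunct2, rule_format]
  have "cinner q (p i) = of_real (\<mu> i) * cinner u (e i)"
    using eigen[OF assms(2) q(1)] cinner_commute[of q "p i"] cinner_commute[of u "e i"] by simp
  then show ?thesis using q(2)[OF ep_G[OF assms(2)]] by (simp add: algebra_simps)
qed

text \<open>This is the real part of the equation tested with the component \<open>u'\<close> of \<open>u\<close> in the complement.\<close>

lemma solves_complement_bound:
  assumes uf: "solves z u f"
  defines "u' \<equiv> u - (\<Sum>i<m. cscale (cinner u (e i)) (e i))"
  shows "(c - Re z) * (norm u')\<^sup>2 \<le> f \<bullet> u'"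
proof -
  obtain q where q': "(u, q) \<in> G \<and> (\<forall>v r. (v, r) \<in> G \<longrightarrow> cinner q r - z * cinner u v = cinner f v)"
    using uf unfolding solves_def ..
  note q = q'[THEN conjunct1] q'[THEN conjunct2, rule_format]
  define q' where "q' = q - (\<Sum>i<m. cscale (cinner u (e i)) (p i))"
  note dec = eigen_system_decomp[OF system q(1), folded u'_def q'_def]
  have G': "(u', q') \<in> G" and o: "\<And>i. i < m \<Longrightarrow> cinner u' (e i) = 0" using dec(1) by (auto simp: orth_G_iff)
  have o': "\<And>i. i < m \<Longrightarrow> cinner (e i) u' = 0" 
  proof -
    show "cinner (e i) u' = 0" if "i < m" for i using o[OF that] cinner_commute[of "e i" u'] by simp
  qed
  have "cinner u u' = cinner ((\<Sum>i<m. cscale (cinner u (e i)) (e i)) + u') u'" by (simp add: u'_def)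
  also have "\<dots> = (\<Sum>i<m. cinner u (e i) * cinner (e i) u') + cinner u' u'"
    by (simp add: cinner_add_left cinner_sum_left cinner_cscale_left)
  finally have 1: "cinner u u' = of_real ((norm u')\<^sup>2)" by (simp add: o' cinner_self)
  have "cinner q q' = cinner ((\<Sum>i<m. cscale (cinner u (e i)) (p i)) + q') q'" by (simp add: q'_def)
  also have "\<dots> = (\<Sum>i<m. cinner u (e i) * cinner (p i) q') + cinner q' q'"
    by (simp add: cinner_add_left cinner_sum_left cinner_cscale_left)
  finally have 2: "cinner q q' = of_real ((norm q')\<^sup>2)" by (simp add: dec(4) cinner_self)
  have "of_real ((norm q')\<^sup>2) - z * of_real ((norm u')\<^sup>2) = cinner f u'"
    using q(2)[OF G'] unfolding 1 2 .
  then have "Re (of_real ((norm q')\<^sup>2) - z * of_real ((norm u')\<^sup>2)) = Re (cinner f u')" by (rule arg_cong)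
  then have "(norm q')\<^sup>2 - Re z * (norm u')\<^sup>2 = f \<bullet> u'" by (simp del: of_real_power)
  then show ?thesis using complement[OF dec(1)] by (simp add: algebra_simps)
qed

text \<open>The coefficients of \<open>u\<close> along the system are those of \<open>f\<close> divided by \<open>\<mu> i - z\<close>; coercivity controls the
  remaining component.\<close>

lemma resolvent_bound:
  assumes z: "Re z < c" "\<And>i. i < m \<Longrightarrow> z \<noteq> of_real (\<mu> i)"
  shows "\<exists>K. \<forall>u f. solves z u f \<longrightarrow> norm u \<le> K * norm f"
proof (intro exI allI impI)
  fix u f assume uf: "solves z u f"
  define u' where "u' = u - (\<Sum>i<m. cscale (cinner u (e i)) (e i))"
  have "norm u' \<le> 1 / (c - Re z) * norm f"
  proof (cases "u' = 0")
    case False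
    have "(c - Re z) * (norm u' * norm u') \<le> norm f * norm u'"
      using solves_complement_bound[OF uf] norm_cauchy_schwarz[of f u']
      unfolding u'_def power2_eq_square by linarith
    then have "(c - Re z) * norm u' \<le> norm f" using False by simp
    then show ?thesis using z(1) by (simp add: field_simps)
  qed (use z(1) in simp)
  moreover have "norm (cscale (cinner u (e i)) (e i)) \<le> 1 / cmod (of_real (\<mu> i) - z) * norm f" if "i < m" for i
  proof -
    have "cmod (of_real (\<mu> i) - z) > 0" using z(2)[OF that] by auto
    moreover have "cmod (of_real (\<mu> i) - z) * cmod (cinner u (e i)) \<le> norm f"
      using cmod_cinner_le[of f "e i"] norm_e[OF that]
      unfolding solves_coefficient[OF uf that] by (simp add: norm_mult)
    ultimately show ?thesis using norm_e[OF that] by (simp add: norm_cscale field_simps)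
  qed
  then have "norm (\<Sum>i<m. cscale (cinner u (e i)) (e i)) \<le> (\<Sum>i<m. 1 / cmod (of_real (\<mu> i) - z)) * norm f"
    unfolding sum_distrib_right by (intro order_trans[OF norm_sum] sum_mono) auto
  moreover have "norm u \<le> norm (\<Sum>i<m. cscale (cinner u (e i)) (e i)) + norm u'"
    using norm_triangle_ineq[of "\<Sum>i<m. cscale (cinner u (e i)) (e i)" u'] by (simp add: u'_def)
  ultimately show "norm u \<le> ((\<Sum>i<m. 1 / cmod (of_real (\<mu> i) - z)) + 1 / (c - Re z)) * norm f"
    by (simp add: algebra_simps)
qed

lemma eigenvector_expansion:
  assumes u: "solves z u 0" and z: "Re z < c"
  shows "u = (\<Sum>i | i < m \<and> of_real (\<mu> i) = z. cscale (cinner u (e i)) (e i))"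
proof -
  define u' where "u' = u - (\<Sum>i<m. cscale (cinner u (e i)) (e i))"
  have "(c - Re z) * (norm u')\<^sup>2 \<le> 0" using solves_complement_bound[OF u] by (simp add: u'_def)
  then have "u' = 0" using z by (simp add: mult_le_0_iff)
  then have "u = (\<Sum>i<m. cscale (cinner u (e i)) (e i))" by (simp add: u'_def)
  also have "\<dots> = (\<Sum>i | i < m \<and> of_real (\<mu> i) = z. cscale (cinner u (e i)) (e i))"
  proof (rule sum.mono_neutral_right)
    show "\<forall>i\<in>{..<m} - {i. i < m \<and> of_real (\<mu> i) = z}. cscale (cinner u (e i)) (e i) = 0"
    proof
      fix i assume "i \<in> {..<m} - {i. i < m \<and> of_real (\<mu> i) = z}"
      then have "cinner u (e i) = 0" using solves_coefficient[OF u, of i] by auto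
      then show "cscale (cinner u (e i)) (e i) = 0" by (simp add: cscale_def del: Re_cinner)
    qed
  qed auto
  finally show ?thesis .
qed

lemma solves_e: "i < m \<Longrightarrow> solves (of_real (\<mu> i)) (e i) 0"
  by (rule solvesI[OF ep_G]) (auto simp: eigen)

end

section \<open>The Hilbert space of square integrable functions\<close>

lemma L2_measurable [measurable_dest]: "u \<in> L2 \<Longrightarrow> u \<in> borel_measurable borel"
  by (simp add: L2_def)

lemma L2_sq_integrable: "u \<in> L2 \<Longrightarrow> integrable lborel (\<lambda>x. (cmod (u x))\<^sup>2)"
  by (simp add: L2_def)

lemma L2_dominated:
  assumes [measurable]: "u \<in> borel_measurable borel" and v: "integrable lborel v"
    and le: "\<And>x. (cmod (u x))\<^sup>2 \<le> v x"
  shows "u \<in> L2"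
proof -
  have "integrable lborel (\<lambda>x. (cmod (u x))\<^sup>2)"
    by (rule Bochner_Integration.integrable_bound[OF v]) (auto intro!: AE_I2 order_trans[OF le])
  then show ?thesis by (simp add: L2_def)
qed

lemma L2_zero: "(\<lambda>_. 0) \<in> L2"
  by (rule L2_dominated[where v="\<lambda>_. 0"]) auto

lemma cmod_add_sq_le: "(cmod (a + b))\<^sup>2 \<le> 2 * (cmod a)\<^sup>2 + 2 * (cmod b)\<^sup>2"
proof -
  have "(cmod (a + b))\<^sup>2 \<le> (cmod a + cmod b)\<^sup>2" by (intro power_mono norm_triangle_ineq) auto
  also have "\<dots> \<le> 2 * (cmod a)\<^sup>2 + 2 * (cmod b)\<^sup>2"
    using zero_le_power2[of "cmod a - cmod b"] by (simp add: power2_eq_square algebra_simps)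
  finally show ?thesis .
qed

lemma L2_add:
  assumes "u \<in> L2" "v \<in> L2"
  shows "(\<lambda>x. u x + v x) \<in> L2"
proof (rule L2_dominated[where v="\<lambda>x. 2 * (cmod (u x))\<^sup>2 + 2 * (cmod (v x))\<^sup>2"])
  show "integrable lborel (\<lambda>x. 2 * (cmod (u x))\<^sup>2 + 2 * (cmod (v x))\<^sup>2)"
    using assms by (auto simp: L2_sq_integrable)
  show "(\<lambda>x. u x + v x) \<in> borel_measurable borel"
    using L2_measurable[OF assms(1)] L2_measurable[OF assms(2)] by measurable
qed (rule cmod_add_sq_le)

lemma L2_bounded_mult:
  assumes "u \<in> L2" and [measurable]: "w \<in> borel_measurable borel" and "\<And>x. cmod (w x) \<le> B"
  shows "(\<lambda>x. w x * u x) \<in> L2"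
proof (rule L2_dominated[where v="\<lambda>x. B\<^sup>2 * (cmod (u x))\<^sup>2"])
  show "integrable lborel (\<lambda>x. B\<^sup>2 * (cmod (u x))\<^sup>2)"
    using assms by (auto simp: L2_sq_integrable)
  show "(\<lambda>x. w x * u x) \<in> borel_measurable borel"
    using L2_measurable[OF assms(1)] by measurable
  show "(cmod (w x * u x))\<^sup>2 \<le> B\<^sup>2 * (cmod (u x))\<^sup>2" for x
    unfolding norm_mult power_mult_distrib by (intro mult_right_mono power_mono assms) auto
qed

lemma L2_scale: "u \<in> L2 \<Longrightarrow> (\<lambda>x. c * u x) \<in> L2"
  by (rule L2_bounded_mult[where B="cmod c"]) auto

lemma L2_diff: "u \<in> L2 \<Longrightarrow> v \<in> L2 \<Longrightarrow> (\<lambda>x. u x - v x) \<in> L2"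
  using L2_add[of u "\<lambda>x. -1 * v x"] L2_scale[of v "-1"] by simp

lemma L2_minus: "u \<in> L2 \<Longrightarrow> (\<lambda>x. - u x) \<in> L2"
  using L2_scale[of u "-1"] by simp

lemma L2_sum: "(\<And>i. i \<in> A \<Longrightarrow> u i \<in> L2) \<Longrightarrow> (\<lambda>x. \<Sum>i\<in>A. u i x) \<in> L2"
  by (induction A rule: infinite_finite_induct) (auto intro: L2_zero L2_add)

lemma L2_indicator: "u \<in> L2 \<Longrightarrow> A \<in> sets borel \<Longrightarrow> (\<lambda>x. indicator A x * u x) \<in> L2"
  by (rule L2_bounded_mult[where B=1]) (auto split: split_indicator)

lemma L2_cmod_mult_integrable:
  assumes "u \<in> L2" "v \<in> L2"
  shows "integrable lborel (\<lambda>x. cmod (u x) * cmod (v x))"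
proof (rule Bochner_Integration.integrable_bound)
  show "integrable lborel (\<lambda>x. (cmod (u x))\<^sup>2 + (cmod (v x))\<^sup>2)"
    using assms by (auto simp: L2_sq_integrable)
  show "(\<lambda>x. cmod (u x) * cmod (v x)) \<in> borel_measurable lborel"
    using L2_measurable[OF assms(1)] L2_measurable[OF assms(2)] by measurable
  have "a * b \<le> a\<^sup>2 + b\<^sup>2" if "0 \<le> a" "0 \<le> b" for a b :: real
    using zero_le_power2[of "a - b"] mult_nonneg_nonneg[OF that] by (simp add: power2_diff)
  then show "AE x in lborel. norm (cmod (u x) * cmod (v x)) \<le> norm ((cmod (u x))\<^sup>2 + (cmod (v x))\<^sup>2)"
    by (auto intro!: AE_I2)
qed

lemma L2_mult_integrable:
  assumes "u \<in> L2" "v \<in> L2"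
  shows "integrable lborel (\<lambda>x. u x * v x)"
proof (rule Bochner_Integration.integrable_bound[OF L2_cmod_mult_integrable[OF assms]])
  show "(\<lambda>x. u x * v x) \<in> borel_measurable lborel"
    using L2_measurable[OF assms(1)] L2_measurable[OF assms(2)] by measurable
qed (auto simp: norm_mult intro!: AE_I2)

lemma L2_cnj: assumes "u \<in> L2" shows "(\<lambda>x. cnj (u x)) \<in> L2"
proof (rule L2_dominated[where v="\<lambda>x. (cmod (u x))\<^sup>2"])
  show "(\<lambda>x. cnj (u x)) \<in> borel_measurable borel"
    using L2_measurable[OF assms] borel_measurable_continuous_on[of cnj u] by (auto intro: continuous_intros)
qed (use assms in \<open>auto simp: L2_sq_integrable\<close>)

lemma L2_inner_integrable: "u \<in> L2 \<Longrightarrow> v \<in> L2 \<Longrightarrow> integrable lborel (\<lambda>x. u x * cnj (v x))"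
  by (intro L2_mult_integrable L2_cnj)

lemma L2_inner_cong_AE:
  assumes "u \<in> L2" "u' \<in> L2" "v \<in> L2" "v' \<in> L2"
    and "AE x in lborel. u x = u' x" "AE x in lborel. v x = v' x"
  shows "L2_inner u v = L2_inner u' v'"
  unfolding L2_inner_def
proof (rule integral_cong_AE)
  show "AE x in lborel. u x * cnj (v x) = u' x * cnj (v' x)"
    using assms(5,6) by eventually_elim simp
qed (rule borel_measurable_integrable, rule L2_inner_integrable, fact, fact)+

text \<open>Passing to classes of functions that agree almost everywhere turns the seminorm into a norm, so that
  the square integrable functions become an instance of the type classes for Hilbert spaces.\<close>

quotient_type l2 = "real \<Rightarrow> complex" / partial: "\<lambda>u v. u \<in> L2 \<and> v \<in> L2 \<and> (AE x in lborel. u x = v x)"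
  morphisms rep_l2 to_l2
proof (rule part_equivpI)
  show "\<exists>u. u \<in> L2 \<and> u \<in> L2 \<and> (AE x in lborel. u x = u x)" using L2_zero by auto
  show "symp (\<lambda>u v. u \<in> L2 \<and> v \<in> L2 \<and> (AE x in lborel. u x = v x))"
  proof (rule sympI, elim conjE, intro conjI)
    fix u v :: "real \<Rightarrow> complex" assume "AE x in lborel. u x = v x"
    then show "AE x in lborel. v x = u x" by eventually_elim simp
  qed
  show "transp (\<lambda>u v. u \<in> L2 \<and> v \<in> L2 \<and> (AE x in lborel. u x = v x))"
  proof (rule transpI, elim conjE, intro conjI)
    fix u v w :: "real \<Rightarrow> complex" assume "AE x in lborel. u x = v x" "AE x in lborel. v x = w x"
    then show "AE x in lborel. u x = w x" by eventually_elim simp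
  qed
qed

lemma to_l2_eq_iff: "u \<in> L2 \<Longrightarrow> v \<in> L2 \<Longrightarrow> to_l2 u = to_l2 v \<longleftrightarrow> (AE x in lborel. u x = v x)"
  using Quotient3_rel[OF Quotient3_l2, of u v] by auto

lemma to_l2_cases: obtains u where "u \<in> L2" "x = to_l2 u"
proof (rule that)
  show "rep_l2 x \<in> L2" using Quotient3_rep_reflp[OF Quotient3_l2, of x] by simp
  show "x = to_l2 (rep_l2 x)" by (rule Quotient3_abs_rep[OF Quotient3_l2, symmetric])
qed

instantiation l2 :: real_vector
begin
lift_definition zero_l2 :: l2 is "\<lambda>_. 0" by (simp add: L2_zero)
lift_definition plus_l2 :: "l2 \<Rightarrow> l2 \<Rightarrow> l2" is "\<lambda>u v x. u x + v x"
  by (auto intro: L2_add)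
lift_definition uminus_l2 :: "l2 \<Rightarrow> l2" is "\<lambda>u x. - u x"
  by (auto intro: L2_minus)
lift_definition minus_l2 :: "l2 \<Rightarrow> l2 \<Rightarrow> l2" is "\<lambda>u v x. u x - v x"
  by (auto intro: L2_diff)
lift_definition scaleR_l2 :: "real \<Rightarrow> l2 \<Rightarrow> l2" is "\<lambda>r u x. of_real r * u x"
  by (auto intro: L2_scale)
instance
proof
  fix a b c :: l2 and r s :: real
  note [simp] = L2_add L2_diff L2_scale L2_minus L2_zero
  show "a + b + c = a + (b + c)" by transfer (simp add: add.assoc)
  show "a + b = b + a" by transfer (simp add: add.commute)
  show "0 + a = a" by transfer simp
  show "- a + a = 0" by transfer simp
  show "a - b = a + - b" by transfer simp
  show "r *\<^sub>R (a + b) = r *\<^sub>R a + r *\<^sub>R b" by transfer (simp add: distrib_left)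
  show "(r + s) *\<^sub>R a = r *\<^sub>R a + s *\<^sub>R a" by transfer (simp add: distrib_right)
  show "r *\<^sub>R s *\<^sub>R a = (r * s) *\<^sub>R a" by transfer (simp add: mult.assoc)
  show "1 *\<^sub>R a = a" by transfer simp
qed
end

lemma L2_inner_add_left: "u \<in> L2 \<Longrightarrow> v \<in> L2 \<Longrightarrow> w \<in> L2 \<Longrightarrow> L2_inner (\<lambda>x. u x + v x) w = L2_inner u w + L2_inner v w"
  by (simp add: L2_inner_def distrib_right L2_inner_integrable)

lemma L2_inner_scale_left: "L2_inner (\<lambda>x. c * u x) w = c * L2_inner u w"
  by (simp add: L2_inner_def mult.assoc)

lemma L2_inner_commute: "L2_inner u v = cnj (L2_inner v u)"
proof -
  have "cnj (L2_inner v u) = (LINT x|lborel. cnj (v x * cnj (u x)))"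
    unfolding L2_inner_def by (rule Bochner_Integration.integral_cnj[symmetric])
  then show ?thesis by (simp add: L2_inner_def mult.commute)
qed

lemma L2_inner_scale_right: "L2_inner u (\<lambda>x. c * v x) = cnj c * L2_inner u v"
  using L2_inner_commute[of u "\<lambda>x. c * v x"] L2_inner_commute[of u v] by (simp add: L2_inner_scale_left)

lemma L2_inner_self: "L2_inner u u = of_real (LINT x|lborel. (cmod (u x))\<^sup>2)"
  unfolding L2_inner_def
  by (subst complex_norm_square[symmetric]) (simp add: integral_complex_of_real[symmetric] del: integral_complex_of_real)

instantiation l2 :: real_inner
begin
lift_definition inner_l2 :: "l2 \<Rightarrow> l2 \<Rightarrow> real" is "\<lambda>u v. Re (L2_inner u v)"
  using L2_inner_cong_AE by metis
definition norm_l2 :: "l2 \<Rightarrow> real" where "norm_l2 x = sqrt (x \<bullet> x)"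
definition sgn_l2 :: "l2 \<Rightarrow> l2" where "sgn_l2 x = x /\<^sub>R norm x"
definition dist_l2 :: "l2 \<Rightarrow> l2 \<Rightarrow> real" where "dist_l2 x y = norm (x - y)"
definition uniformity_l2 :: "(l2 \<times> l2) filter" where
  "uniformity_l2 = (INF e\<in>{0<..}. principal {(x, y). dist x y < e})"
definition open_l2 :: "l2 set \<Rightarrow> bool" where
  "open_l2 U \<longleftrightarrow> (\<forall>x\<in>U. \<forall>\<^sub>F (x', y) in uniformity. x' = x \<longrightarrow> y \<in> U)"
instance
proof
  fix x y z :: l2 and r :: real
  show "x \<bullet> y = y \<bullet> x" by transfer (metis L2_inner_commute cnj.sel(1))
  show "(x + y) \<bullet> z = x \<bullet> z + y \<bullet> z" by transfer (simp add: L2_inner_add_left)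
  show "r *\<^sub>R x \<bullet> y = r * (x \<bullet> y)" by transfer (simp add: L2_inner_scale_left)
  show "0 \<le> x \<bullet> x" by transfer (simp add: L2_inner_self)
  show "(x \<bullet> x = 0) = (x = 0)"
    by transfer (auto simp: L2_inner_self L2_zero integral_nonneg_eq_0_iff_AE L2_sq_integrable)
qed (auto simp: norm_l2_def sgn_l2_def dist_l2_def uniformity_l2_def open_l2_def)
end

lemma to_l2_zero: "0 = to_l2 (\<lambda>_. 0)" by (simp add: zero_l2_def)
lemma to_l2_add: "u \<in> L2 \<Longrightarrow> v \<in> L2 \<Longrightarrow> to_l2 u + to_l2 v = to_l2 (\<lambda>x. u x + v x)"
  by (simp add: plus_l2.abs_eq eq_onp_def)
lemma to_l2_diff: "u \<in> L2 \<Longrightarrow> v \<in> L2 \<Longrightarrow> to_l2 u - to_l2 v = to_l2 (\<lambda>x. u x - v x)"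
  by (simp add: minus_l2.abs_eq eq_onp_def)
lemma to_l2_scaleR: "u \<in> L2 \<Longrightarrow> r *\<^sub>R to_l2 u = to_l2 (\<lambda>x. of_real r * u x)"
  by (simp add: scaleR_l2.abs_eq eq_onp_def)
lemma to_l2_inner: "u \<in> L2 \<Longrightarrow> v \<in> L2 \<Longrightarrow> to_l2 u \<bullet> to_l2 v = Re (L2_inner u v)"
  by (simp add: inner_l2.abs_eq eq_onp_def)
lemma norm_to_l2: "u \<in> L2 \<Longrightarrow> norm (to_l2 u) = L2_norm u"
  by (simp add: norm_eq_sqrt_inner to_l2_inner L2_inner_self L2_norm_def)

lemma L2_nn_integral: "u \<in> L2 \<Longrightarrow> (\<integral>\<^sup>+x. ennreal ((cmod (u x))\<^sup>2) \<partial>lborel) = ennreal ((L2_norm u)\<^sup>2)"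
  by (subst nn_integral_eq_integral) (auto simp: L2_sq_integrable L2_norm_def)

lemma L2_nn_integral_bound:
  assumes [measurable]: "u \<in> borel_measurable borel"
    and le: "(\<integral>\<^sup>+x. ennreal ((cmod (u x))\<^sup>2) \<partial>lborel) \<le> ennreal (B\<^sup>2)" and "0 \<le> B"
  shows "u \<in> L2" "L2_norm u \<le> B"
proof -
  have "integrable lborel (\<lambda>x. (cmod (u x))\<^sup>2)"
    by (rule integrableI_bounded) (use le in \<open>auto simp: le_less_trans\<close>)
  then show *: "u \<in> L2" by (simp add: L2_def)
  have "(L2_norm u)\<^sup>2 \<le> B\<^sup>2" using le L2_nn_integral[OF *] by simp
  then show "L2_norm u \<le> B" using \<open>0 \<le> B\<close> by (rule power2_le_imp_le)
qed

text \<open>The geometric weights make it possible to deduce convergence almost everywhere from bounds on the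
  squared norms of the increments alone, by monotone convergence.\<close>

lemma summable_of_weighted_squares:
  fixes d :: "nat \<Rightarrow> complex"
  assumes "(\<Sum>k. ennreal (2 ^ k * (cmod (d k))\<^sup>2)) < \<infinity>"
  shows "summable d"
proof -
  have "summable (\<lambda>k. 2 ^ k * (cmod (d k))\<^sup>2)"
    by (rule summable_suminf_not_top) (use assms in auto)
  then have "Bseq (\<lambda>k. 2 ^ k * (cmod (d k))\<^sup>2)"
    by (intro convergent_imp_Bseq convergentI) (rule summable_LIMSEQ_zero)
  then obtain K where K': "K > 0" "\<forall>k. norm (2 ^ k * (cmod (d k))\<^sup>2) \<le> K" by (rule BseqE)
  have K: "K > 0" "2 ^ k * (cmod (d k))\<^sup>2 \<le> K" for k
    using K'(1) spec[OF K'(2), of k] by auto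
  have le: "cmod (d k) \<le> sqrt K * (1 / sqrt 2) ^ k" for k
  proof (rule power2_le_imp_le)
    have "((1 / sqrt 2) ^ k)\<^sup>2 = (1 / 2) ^ k"
      by (simp add: power2_eq_square power_mult_distrib[symmetric])
    then show "(cmod (d k))\<^sup>2 \<le> (sqrt K * (1 / sqrt 2) ^ k)\<^sup>2"
      using K(2)[of k] K(1) by (simp add: power_mult_distrib power_divide field_simps)
  qed (use K(1) in auto)
  have "summable (\<lambda>k. sqrt K * (1 / sqrt 2) ^ k)"
    by (rule summable_mult, rule summable_geometric) (auto simp: real_less_rsqrt)
  then show ?thesis by (rule summable_comparison_test'[where N=0]) (rule le)
qed

text \<open>The Riesz--Fischer theorem. A subsequence whose increments decay geometrically converges almost
  everywhere, and by Fatou's lemma its pointwise limit is a limit in norm.\<close>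

instance l2 :: complete_space
proof
  fix X :: "nat \<Rightarrow> l2" assume X: "Cauchy X"
  have "\<forall>n. \<exists>u. u \<in> L2 \<and> X n = to_l2 u" using to_l2_cases by metis
  then obtain f where f: "\<And>n. f n \<in> L2" "\<And>n. X n = to_l2 (f n)" by metis
  have dist_f: "norm (X m - X n) = L2_norm (\<lambda>x. f m x - f n x)" for m n
    by (simp add: f to_l2_diff norm_to_l2 L2_diff)
  have "\<exists>N. \<forall>m\<ge>N. \<forall>n\<ge>N. norm (X m - X n) < (1/2) ^ k" for k
    using CauchyD[OF X, of "(1/2) ^ k"] by simp
  then obtain N where N: "\<And>k m n. m \<ge> N k \<Longrightarrow> n \<ge> N k \<Longrightarrow> norm (X m - X n) < (1/2) ^ k" by metis
  define r where "r k = (\<Sum>i\<le>k. N i)" for k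
  have r: "r k \<ge> N k" "r (Suc k) \<ge> r k" for k
    using member_le_sum[of k "{..k}" N] by (auto simp: r_def)
  have r': "j \<ge> k \<Longrightarrow> r j \<ge> N k" for j k
    using r(1)[of k] lift_Suc_mono_le[of r k j] r(2) by (meson order_trans)
  note [measurable] = L2_measurable[OF f(1)]
  define F where "F x = lim (\<lambda>k. f (r k) x)" for x
  have [measurable]: "F \<in> borel_measurable borel" unfolding F_def by measurable
  have conv: "AE x in lborel. (\<lambda>k. f (r k) x) \<longlonglongrightarrow> F x"
  proof -
    define d where "d k x = f (r (Suc k)) x - f (r k) x" for k x
    have d: "d k \<in> L2" for k unfolding d_def by (intro L2_diff f)
    note [measurable] = L2_measurable[OF d]
    have "L2_norm (d k) \<le> (1/2) ^ k" for k
      using N[of k "r (Suc k)" "r k"] r(1)[of k] r(2)[of k] unfolding dist_f d_def by simp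
    then have dk: "(L2_norm (d k))\<^sup>2 \<le> ((1/2) ^ k)\<^sup>2" for k by (intro power_mono) (auto simp: L2_norm_def)
    have "(\<integral>\<^sup>+x. (\<Sum>k. ennreal (2 ^ k * (cmod (d k x))\<^sup>2)) \<partial>lborel)
        = (\<Sum>k. \<integral>\<^sup>+x. ennreal (2 ^ k * (cmod (d k x))\<^sup>2) \<partial>lborel)"
      by (rule nn_integral_suminf) measurable
    also have "\<dots> = (\<Sum>k. ennreal (2 ^ k * (L2_norm (d k))\<^sup>2))"
      by (simp add: ennreal_mult nn_integral_cmult L2_nn_integral[OF d])
    also have "\<dots> \<le> (\<Sum>k. ennreal ((1/2) ^ k))"
    proof (intro suminf_le summableI ennreal_leI)
      fix k
      have "2 ^ k * (L2_norm (d k))\<^sup>2 \<le> 2 ^ k * ((1/2) ^ k)\<^sup>2" by (intro mult_left_mono dk) auto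
      also have "\<dots> = (1/2) ^ k" by (simp add: power2_eq_square power_divide)
      finally show "2 ^ k * (L2_norm (d k))\<^sup>2 \<le> (1/2) ^ k" .
    qed
    also have "\<dots> < \<infinity>"
      by (subst suminf_ennreal2) (auto intro!: summable_geometric)
    finally have "AE x in lborel. (\<Sum>k. ennreal (2 ^ k * (cmod (d k x))\<^sup>2)) \<noteq> \<infinity>"
      by (intro nn_integral_noteq_infinite) auto
    then show ?thesis
    proof eventually_elim
      fix x assume "(\<Sum>k. ennreal (2 ^ k * (cmod (d k x))\<^sup>2)) \<noteq> \<infinity>"
      then have "summable (\<lambda>k. d k x)" by (intro summable_of_weighted_squares) (simp add: less_top)
      then have "convergent (\<lambda>k. f (r k) x - f (r 0) x)"
        using sum_lessThan_telescope[of "\<lambda>k. f (r k) x"] by (simp add: summable_iff_convergent d_def)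
      from convergent_add[OF this convergent_const[of "f (r 0) x"]]
      have "convergent (\<lambda>k. f (r k) x)" by simp
      then show "(\<lambda>k. f (r k) x) \<longlonglongrightarrow> F x" by (simp add: F_def convergent_LIMSEQ_iff)
    qed
  qed
  have near: "(\<lambda>x. f n x - F x) \<in> L2 \<and> L2_norm (\<lambda>x. f n x - F x) \<le> (1/2) ^ k" if "n \<ge> N k" for n k
  proof -
    have "(\<integral>\<^sup>+x. ennreal ((cmod (f n x - F x))\<^sup>2) \<partial>lborel)
        = (\<integral>\<^sup>+x. liminf (\<lambda>j. ennreal ((cmod (f n x - f (r j) x))\<^sup>2)) \<partial>lborel)"
    proof (rule nn_integral_cong_AE)
      show "AE x in lborel. ennreal ((cmod (f n x - F x))\<^sup>2) = liminf (\<lambda>j. ennreal ((cmod (f n x - f (r j) x))\<^sup>2))"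
        using conv
      proof eventually_elim
        fix x assume x: "(\<lambda>k. f (r k) x) \<longlonglongrightarrow> F x"
        have "(\<lambda>j. ennreal ((cmod (f n x - f (r j) x))\<^sup>2)) \<longlonglongrightarrow> ennreal ((cmod (f n x - F x))\<^sup>2)"
          by (intro tendsto_ennrealI tendsto_intros x)
        then show "ennreal ((cmod (f n x - F x))\<^sup>2) = liminf (\<lambda>j. ennreal ((cmod (f n x - f (r j) x))\<^sup>2))"
          by (metis lim_imp_Liminf sequentially_bot)
      qed
    qed
    also have "\<dots> \<le> liminf (\<lambda>j. \<integral>\<^sup>+x. ennreal ((cmod (f n x - f (r j) x))\<^sup>2) \<partial>lborel)"
      by (rule nn_integral_liminf) measurable
    also have "\<dots> \<le> ennreal (((1/2) ^ k)\<^sup>2)"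
    proof (rule Liminf_le)
      have "(\<integral>\<^sup>+x. ennreal ((cmod (f n x - f (r j) x))\<^sup>2) \<partial>lborel) \<le> ennreal (((1/2) ^ k)\<^sup>2)" if "j \<ge> k" for j
        unfolding L2_nn_integral[OF L2_diff[OF f(1) f(1)]]
        using N[OF \<open>n \<ge> N k\<close> r'[OF that]] unfolding dist_f
        by (intro ennreal_leI power_mono) (auto simp: L2_norm_def)
      then show "\<forall>\<^sub>F j in sequentially. (\<integral>\<^sup>+x. ennreal ((cmod (f n x - f (r j) x))\<^sup>2) \<partial>lborel) \<le> ennreal (((1/2) ^ k)\<^sup>2)"
        using eventually_sequentially by blast
    qed simp
    finally show ?thesis using L2_nn_integral_bound[of "\<lambda>x. f n x - F x" "(1/2) ^ k"] by simp
  qed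
  have "(\<lambda>x. f (N 0) x - (f (N 0) x - F x)) \<in> L2" by (intro L2_diff f conjunct1[OF near[of 0]]) auto
  then have FL2: "F \<in> L2" by simp
  have "X \<longlonglongrightarrow> to_l2 F"
  proof (rule LIMSEQ_I)
    fix e :: real assume "e > 0"
    then obtain k where k: "(1/2) ^ k < e" using real_arch_pow_inv[of e "1/2"] by auto
    have "norm (X n - to_l2 F) < e" if "n \<ge> N k" for n
      using near[OF that] k by (simp add: f to_l2_diff FL2 norm_to_l2)
    then show "\<exists>no. \<forall>n\<ge>no. norm (X n - to_l2 F) < e" by blast
  qed
  then show "convergent X" by (auto simp: convergent_def)
qed

instantiation l2 :: complex_hilbert
begin
lift_definition J_l2 :: "l2 \<Rightarrow> l2" is "\<lambda>u x. \<i> * u x"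
  by (auto intro: L2_scale)
instance
proof
  fix x y :: l2 and r :: real
  note [simp] = L2_add L2_diff L2_scale L2_minus L2_zero
  show "J (x + y) = J x + J y" by transfer (simp add: distrib_left)
  show "J (r *\<^sub>R x) = r *\<^sub>R J x" by transfer (simp add: mult.left_commute)
  show "J (J x) = - x" by transfer (simp add: mult.assoc[symmetric])
  show "J x \<bullet> J y = x \<bullet> y" by transfer (simp add: L2_inner_scale_left L2_inner_scale_right)
qed
end

lemma to_l2_J: "u \<in> L2 \<Longrightarrow> J (to_l2 u) = to_l2 (\<lambda>x. \<i> * u x)"
  by (simp add: J_l2.abs_eq eq_onp_def)

lemma to_l2_cscale: "u \<in> L2 \<Longrightarrow> cscale c (to_l2 u) = to_l2 (\<lambda>x. c * u x)"
  by (simp add: cscale_def to_l2_scaleR to_l2_J L2_scale to_l2_add distrib_right[symmetric] mult.assoc[symmetric])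
    (metis complex_eq mult.commute)

lemma to_l2_cinner: "u \<in> L2 \<Longrightarrow> v \<in> L2 \<Longrightarrow> cinner (to_l2 u) (to_l2 v) = L2_inner u v"
proof -
  assume uv: "u \<in> L2" "v \<in> L2"
  have "L2_inner u (\<lambda>x. \<i> * v x) = - \<i> * L2_inner u v"
    by (simp add: L2_inner_scale_right)
  then show ?thesis using uv
    by (intro complex_eqI) (simp_all add: Im_cinner to_l2_J to_l2_inner L2_scale)
qed

lemma to_l2_sum:
  assumes "\<And>i. i \<in> A \<Longrightarrow> u i \<in> L2"
  shows "(\<Sum>i\<in>A. to_l2 (u i)) = to_l2 (\<lambda>x. \<Sum>i\<in>A. u i x)"
  using assms by (induction A rule: infinite_finite_induct) (auto simp: to_l2_zero to_l2_add L2_sum)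

section \<open>Weak derivatives on the line\<close>

definition locally_integrable :: "(real \<Rightarrow> complex) \<Rightarrow> bool" where
  "locally_integrable g \<longleftrightarrow> (\<forall>x y. set_integrable lborel {x..y} g)"

text \<open>\<open>U\<close> is locally absolutely continuous with density \<open>g\<close>. The integrated form avoids derivatives that
  exist only almost everywhere.\<close>

definition is_primitive :: "(real \<Rightarrow> complex) \<Rightarrow> (real \<Rightarrow> complex) \<Rightarrow> bool" where
  "is_primitive U g \<longleftrightarrow> locally_integrable g \<and>
     (\<forall>x y. x \<le> y \<longrightarrow> U y - U x = (LINT t:{x..y}|lborel. g t))"

lemma locally_integrableD: "locally_integrable g \<Longrightarrow> set_integrable lborel {x..y} g"
  by (simp add: locally_integrable_def)

lemma primitive_integrable: "is_primitive U g \<Longrightarrow> set_integrable lborel {x..y} g"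
  by (simp add: is_primitive_def locally_integrable_def)

lemma primitive_diff: "is_primitive U g \<Longrightarrow> x \<le> y \<Longrightarrow> U y - U x = (LINT t:{x..y}|lborel. g t)"
  by (simp add: is_primitive_def)

lemma indicator_L2: "(\<lambda>t. indicator {x..y::real} t) \<in> L2"
proof (rule L2_dominated)
  show "integrable lborel (\<lambda>t. indicator {x..y::real} t :: real)"
    by (rule integrable_real_indicator) (auto simp: emeasure_lborel_Icc_eq)
qed (auto split: split_indicator)

lemma L2_locally_integrable: "g \<in> L2 \<Longrightarrow> locally_integrable g"
  unfolding locally_integrable_def set_integrable_def
proof (intro allI)
  fix x y assume "g \<in> L2"
  from L2_mult_integrable[OF indicator_L2 this, of x y]
  show "integrable lborel (\<lambda>t. indicat_real {x..y} t *\<^sub>R g t)"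
    by (rule Bochner_Integration.integrable_cong[THEN iffD1, rotated 2]) (auto split: split_indicator)
qed

lemma set_integrable_mult_continuous:
  fixes g W :: "real \<Rightarrow> complex"
  assumes g: "set_integrable lborel {x..y} g" and W: "continuous_on {x..y} W"
  shows "set_integrable lborel {x..y} (\<lambda>t. g t * W t)"
proof -
  obtain M where M: "\<And>t. t \<in> {x..y} \<Longrightarrow> cmod (W t) \<le> M"
    using compact_imp_bounded[OF compact_continuous_image[OF W compact_Icc]] unfolding bounded_iff by blast
  have [measurable]: "(\<lambda>t. indicat_real {x..y} t *\<^sub>R W t) \<in> borel_measurable borel"
    by (rule borel_measurable_continuous_on_indicator) (use W in auto)
  have [measurable]: "(\<lambda>t. indicat_real {x..y} t *\<^sub>R g t) \<in> borel_measurable borel"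
    using borel_measurable_integrable[OF g[unfolded set_integrable_def]] by simp
  have eq: "(\<lambda>t. indicat_real {x..y} t *\<^sub>R (g t * W t)) = (\<lambda>t. (indicat_real {x..y} t *\<^sub>R g t) * (indicat_real {x..y} t *\<^sub>R W t))"
    by (auto split: split_indicator)
  show ?thesis unfolding set_integrable_def
  proof (rule Bochner_Integration.integrable_bound)
    show "integrable lborel (\<lambda>t. M *\<^sub>R (indicat_real {x..y} t *\<^sub>R g t))"
      using g unfolding set_integrable_def by (rule integrable_scaleR_right)
    show "(\<lambda>t. indicat_real {x..y} t *\<^sub>R (g t * W t)) \<in> borel_measurable lborel"
      unfolding eq by measurable
    show "AE t in lborel. norm (indicat_real {x..y} t *\<^sub>R (g t * W t)) \<le> norm (M *\<^sub>R (indicat_real {x..y} t *\<^sub>R g t))"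
    proof (rule AE_I2)
      fix t
      show "norm (indicat_real {x..y} t *\<^sub>R (g t * W t)) \<le> norm (M *\<^sub>R (indicat_real {x..y} t *\<^sub>R g t))"
      proof (cases "t \<in> {x..y}")
        case True
        have "cmod (g t) * cmod (W t) \<le> cmod (g t) * \<bar>M\<bar>"
          using M[OF True] by (intro mult_left_mono) auto
        then show ?thesis using True by (simp add: norm_mult mult.commute)
      qed simp
    qed
  qed
qed

lemma exists_primitive:
  assumes g: "locally_integrable g"
  shows "\<exists>U. is_primitive U g"
proof -
  define U where "U x = (if 0 \<le> x then integral {0..x} g else - integral {x..0} g)" for x :: real
  have io: "g integrable_on {x..y}" for x y :: real
    using set_borel_integral_eq_integral(1)[OF locally_integrableD[OF g]] .
  have "U y - U x = integral {x..y} g" if "x \<le> y" for x y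
    using that Henstock_Kurzweil_Integration.integral_combine[of 0 x y g, OF _ _ io] Henstock_Kurzweil_Integration.integral_combine[of x 0 y g, OF _ _ io]
      Henstock_Kurzweil_Integration.integral_combine[of x y 0 g, OF _ _ io]
    by (auto simp: U_def algebra_simps)
  then have "is_primitive U g"
    using g by (auto simp: is_primitive_def set_borel_integral_eq_integral(2)[OF locally_integrableD[OF g]])
  then show ?thesis by blast
qed

lemma primitive_continuous:
  assumes U: "is_primitive U g"
  shows "continuous_on A U"
proof -
  have "isCont U x" for x
  proof -
    have io: "g integrable_on {x-1..x+1}"
      using set_borel_integral_eq_integral(1)[OF primitive_integrable[OF U]] .
    have "continuous_on {x-1..x+1} (\<lambda>t. U (x-1) + integral {x-1..t} g)"
      by (intro continuous_intros indefinite_integral_continuous_1 io)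
    moreover have "U (x-1) + integral {x-1..t} g = U t" if "t \<in> {x-1..x+1}" for t
      using primitive_diff[OF U, of "x-1" t] that
        set_borel_integral_eq_integral(2)[OF primitive_integrable[OF U], of "x-1" t]
      by (simp add: algebra_simps)
    ultimately have "continuous_on {x-1..x+1} U" by (rule continuous_on_eq)
    then show ?thesis by (rule continuous_on_interior) simp
  qed
  then show ?thesis by (intro continuous_at_imp_continuous_on) auto
qed

lemma primitive_measurable: "is_primitive U g \<Longrightarrow> U \<in> borel_measurable borel"
  by (intro borel_measurable_continuous_onI primitive_continuous)

lemma primitive_add: "is_primitive U g \<Longrightarrow> is_primitive W k \<Longrightarrow> is_primitive (\<lambda>x. U x + W x) (\<lambda>x. g x + k x)"
  unfolding is_primitive_def locally_integrable_def
  by (auto simp: set_integral_add algebra_simps)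

lemma primitive_scale: "is_primitive U g \<Longrightarrow> is_primitive (\<lambda>x. c * U x) (\<lambda>x. c * g x)"
  unfolding is_primitive_def locally_integrable_def
  by (auto simp: set_integrable_mult_right right_diff_distrib[symmetric])

lemma primitive_sum:
  assumes "finite A" "\<And>i. i \<in> A \<Longrightarrow> is_primitive (U i) (g i)"
  shows "is_primitive (\<lambda>x. \<Sum>i\<in>A. c i * U i x) (\<lambda>x. \<Sum>i\<in>A. c i * g i x)"
  using assms
proof (induction A)
  case empty
  show ?case
    by (auto simp: is_primitive_def locally_integrable_def set_integrable_def set_lebesgue_integral_def)
qed (simp add: primitive_add primitive_scale)

lemma continuous_locally_integrable: "continuous_on UNIV U \<Longrightarrow> locally_integrable U"
  unfolding locally_integrable_def
  by (auto intro!: borel_integrable_atLeastAtMost' elim: continuous_on_subset)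

lemma primitive_of_vector_derivative:
  assumes d: "\<And>x. (U has_vector_derivative g x) (at x)" and g: "continuous_on UNIV g"
  shows "is_primitive U g"
  unfolding is_primitive_def
proof (intro conjI allI impI)
  show loc: "locally_integrable g" using g by (rule continuous_locally_integrable)
  fix x y :: real assume "x \<le> y"
  have "(g has_integral (U y - U x)) {x..y}"
    by (rule fundamental_theorem_of_calculus[OF \<open>x \<le> y\<close>]) (use d has_vector_derivative_at_within in blast)
  then show "U y - U x = (LINT t:{x..y}|lborel. g t)"
    using set_borel_integral_eq_integral(2)[OF locally_integrableD[OF loc]] by (simp add: integral_unique)
qed

text \<open>Integration by parts for two integrable densities is Fubini's theorem on the square, cut
  along its diagonal.\<close>

lemma integral_triangles:
  fixes f g :: "real \<Rightarrow> complex"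
  assumes f: "integrable lborel f" and g: "integrable lborel g"
  shows "(\<integral>t. f t * (\<integral>s. (if s \<le> t then g s else 0) \<partial>lborel) \<partial>lborel)
       + (\<integral>s. (\<integral>t. (if t \<le> s then f t else 0) \<partial>lborel) * g s \<partial>lborel)
       = (\<integral>t. f t \<partial>lborel) * (\<integral>s. g s \<partial>lborel)"
    and "integrable lborel (\<lambda>t. f t * (\<integral>s. (if s \<le> t then g s else 0) \<partial>lborel))"
    and "integrable lborel (\<lambda>s. (\<integral>t. (if t \<le> s then f t else 0) \<partial>lborel) * g s)"
proof -
  have [measurable]: "f \<in> borel_measurable borel" "g \<in> borel_measurable borel"
    using borel_measurable_integrable[OF f] borel_measurable_integrable[OF g] by auto
  have prod: "integrable (lborel \<Otimes>\<^sub>M lborel) (\<lambda>(s, t). g s * f t)"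
  proof (rule lborel_pair.Fubini_integrable)
    show "(\<lambda>(s, t). g s * f t) \<in> borel_measurable (lborel \<Otimes>\<^sub>M lborel)" by measurable
    show "integrable lborel (\<lambda>s. \<integral>t. norm (case (s, t) of (s, t) \<Rightarrow> g s * f t) \<partial>lborel)"
      using f g by (simp add: norm_mult)
    show "AE s in lborel. integrable lborel (\<lambda>t. case (s, t) of (s, t) \<Rightarrow> g s * f t)"
      using f by simp
  qed
  have H: "integrable (lborel \<Otimes>\<^sub>M lborel) (\<lambda>(s, t). if s \<le> t then g s * f t else 0)"
    by (rule Bochner_Integration.integrable_bound[OF prod]) auto
  have K: "integrable (lborel \<Otimes>\<^sub>M lborel) (\<lambda>(s, t). if t \<le> s then g s * f t else 0)"
    by (rule Bochner_Integration.integrable_bound[OF prod]) auto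
  have fH: "f t * (\<integral>s. (if s \<le> t then g s else 0) \<partial>lborel) = (\<integral>s. (if s \<le> t then g s * f t else 0) \<partial>lborel)" for t
    by (rule trans[OF integral_mult_right_zero[symmetric]]) (rule Bochner_Integration.integral_cong, auto)
  have gK: "(\<integral>t. (if t \<le> s then f t else 0) \<partial>lborel) * g s = (\<integral>t. (if t \<le> s then g s * f t else 0) \<partial>lborel)" for s
    by (rule trans[OF integral_mult_left_zero[symmetric]]) (rule Bochner_Integration.integral_cong, auto)
  show "integrable lborel (\<lambda>t. f t * (\<integral>s. (if s \<le> t then g s else 0) \<partial>lborel))"
    unfolding fH by (rule lborel_pair.integrable_snd[OF H])
  show "integrable lborel (\<lambda>s. (\<integral>t. (if t \<le> s then f t else 0) \<partial>lborel) * g s)"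
    unfolding gK by (rule lborel_pair.integrable_fst[OF K])
  have "(\<integral>t. f t * (\<integral>s. (if s \<le> t then g s else 0) \<partial>lborel) \<partial>lborel)
       + (\<integral>s. (\<integral>t. (if t \<le> s then f t else 0) \<partial>lborel) * g s \<partial>lborel)
     = integral\<^sup>L (lborel \<Otimes>\<^sub>M lborel) (\<lambda>(s, t). if s \<le> t then g s * f t else 0)
       + integral\<^sup>L (lborel \<Otimes>\<^sub>M lborel) (\<lambda>(s, t). if t \<le> s then g s * f t else 0)"
    unfolding fH gK lborel_pair.integral_snd[OF H] lborel_pair.integral_fst[OF K] ..
  also have "\<dots> = integral\<^sup>L (lborel \<Otimes>\<^sub>M lborel)
      (\<lambda>w. (case w of (s, t) \<Rightarrow> if s \<le> t then g s * f t else 0) + (case w of (s, t) \<Rightarrow> if t \<le> s then g s * f t else 0))"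
    by (rule Bochner_Integration.integral_add[symmetric, OF H K])
  also have "\<dots> = (\<integral>t. (\<integral>s. (if s \<le> t then g s * f t else 0) + (if t \<le> s then g s * f t else 0) \<partial>lborel) \<partial>lborel)"
    using lborel_pair.integral_snd[of "\<lambda>s t. (if s \<le> t then g s * f t else 0) + (if t \<le> s then g s * f t else 0)"]
      Bochner_Integration.integrable_add[OF H K] by (simp add: case_prod_unfold)
  also have "\<dots> = (\<integral>t. (\<integral>s. g s * f t \<partial>lborel) \<partial>lborel)"
  proof (rule Bochner_Integration.integral_cong[OF refl])
    fix t
    show "(\<integral>s. (if s \<le> t then g s * f t else 0) + (if t \<le> s then g s * f t else 0) \<partial>lborel) = (\<integral>s. g s * f t \<partial>lborel)"
      by (rule integral_discrete_difference[where X="{t}"]) auto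
  qed
  also have "\<dots> = (\<integral>t. f t \<partial>lborel) * (\<integral>s. g s \<partial>lborel)" by (simp add: mult.commute)
  finally show "(\<integral>t. f t * (\<integral>s. (if s \<le> t then g s else 0) \<partial>lborel) \<partial>lborel)
       + (\<integral>s. (\<integral>t. (if t \<le> s then f t else 0) \<partial>lborel) * g s \<partial>lborel)
       = (\<integral>t. f t \<partial>lborel) * (\<integral>s. g s \<partial>lborel)" .
qed

lemma primitive_mult:
  assumes U: "is_primitive U g" and W: "is_primitive W k"
  shows "is_primitive (\<lambda>x. U x * W x) (\<lambda>x. g x * W x + U x * k x)"
  unfolding is_primitive_def
proof (intro conjI allI impI)
  have int1: "set_integrable lborel {x..y} (\<lambda>t. g t * W t)" for x y
    by (intro set_integrable_mult_continuous primitive_integrable[OF U] primitive_continuous[OF W])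
  have int2: "set_integrable lborel {x..y} (\<lambda>t. U t * k t)" for x y
    using set_integrable_mult_continuous[OF primitive_integrable[OF W] primitive_continuous[OF U]]
    by (simp add: mult.commute)
  show "locally_integrable (\<lambda>x. g x * W x + U x * k x)"
    unfolding locally_integrable_def by (intro allI set_integral_add int1 int2)
  fix x y :: real assume xy: "x \<le> y"
  define f where "f t = indicat_real {x..y} t *\<^sub>R g t" for t
  define h where "h t = indicat_real {x..y} t *\<^sub>R k t" for t
  have fi: "integrable lborel f" and hi: "integrable lborel h"
    using primitive_integrable[OF U] primitive_integrable[OF W] unfolding f_def h_def set_integrable_def by auto
  have f: "(\<integral>t. f t \<partial>lborel) = U y - U x" and h: "(\<integral>t. h t \<partial>lborel) = W y - W x"
    using primitive_diff[OF U xy] primitive_diff[OF W xy] by (auto simp: f_def h_def set_lebesgue_integral_def)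
  have part: "(\<integral>s. (if s \<le> t then f s else 0) \<partial>lborel) = U t - U x"
     "(\<integral>s. (if s \<le> t then h s else 0) \<partial>lborel) = W t - W x" if "t \<in> {x..y}" for t
    using primitive_diff[OF U, of x t] primitive_diff[OF W, of x t] that
    unfolding set_lebesgue_integral_def f_def h_def
    by (auto intro!: Bochner_Integration.integral_cong split: split_indicator)
  have 1: "f t * (\<integral>s. (if s \<le> t then h s else 0) \<partial>lborel) = indicat_real {x..y} t *\<^sub>R (g t * W t) - W x * f t" for t
    by (cases "t \<in> {x..y}") (auto simp: part f_def algebra_simps)
  have 2: "(\<integral>s. (if s \<le> t then f s else 0) \<partial>lborel) * h t = indicat_real {x..y} t *\<^sub>R (U t * k t) - U x * h t" for t
    by (cases "t \<in> {x..y}") (auto simp: part h_def algebra_simps)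
  have "(LINT t:{x..y}|lborel. g t * W t) - W x * (U y - U x) + ((LINT t:{x..y}|lborel. U t * k t) - U x * (W y - W x))
     = (U y - U x) * (W y - W x)"
    using integral_triangles(1)[OF fi hi] int1[of x y] int2[of x y] fi hi
    unfolding 1 2 f h set_lebesgue_integral_def set_integrable_def by (simp add: f h)
  then show "U y * W y - U x * W x = (LINT t:{x..y}|lborel. g t * W t + U t * k t)"
    unfolding set_integral_add(2)[OF int1 int2] by (simp add: algebra_simps)
qed

subsection \<open>Test functions\<close>

definition smooth :: "(real \<Rightarrow> real) \<Rightarrow> bool" where
  "smooth f \<longleftrightarrow> (\<forall>n x. (deriv ^^ n) f differentiable (at x))"

lemma test_function_iff: "test_function \<phi> \<longleftrightarrow> smooth \<phi> \<and> bounded {x. \<phi> x \<noteq> 0}"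
  by (simp add: test_function_def smooth_def)

text \<open>Iterated derivatives of a member of \<open>F\<close> never leave \<open>F\<close>.\<close>

lemma smooth_coinduct:
  assumes f: "f \<in> F" and step: "\<And>g. g \<in> F \<Longrightarrow> \<exists>g'\<in>F. \<forall>x. (g has_real_derivative g' x) (at x)"
  shows "smooth f"
proof -
  have "(deriv ^^ n) f \<in> F" for n
  proof (induction n)
    case (Suc n)
    from step[OF Suc] obtain g' where g': "g' \<in> F" "\<And>x. ((deriv ^^ n) f has_real_derivative g' x) (at x)" by blast
    have "deriv ((deriv ^^ n) f) = g'" by (intro ext DERIV_imp_deriv g'(2))
    then show ?case using g'(1) by simp
  qed (use f in simp)
  then show ?thesis unfolding smooth_def using step real_differentiable_def by blast
qed

lemma smooth_DERIV: "smooth f \<Longrightarrow> (f has_real_derivative deriv f x) (at x)"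
proof -
  assume "smooth f"
  then have "f differentiable (at x)" unfolding smooth_def by (metis funpow_0)
  then show ?thesis by (metis DERIV_imp_deriv real_differentiable_def)
qed

lemma smooth_deriv: "smooth f \<Longrightarrow> smooth (deriv f)"
  unfolding smooth_def by (metis funpow_Suc_right o_apply)

lemma smooth_continuous: "smooth f \<Longrightarrow> continuous_on A f"
  by (intro continuous_at_imp_continuous_on ballI) (rule DERIV_isCont[OF smooth_DERIV])

lemma smooth_add: assumes "smooth f" "smooth g" shows "smooth (\<lambda>x. f x + g x)"
proof (rule smooth_coinduct[where F="{\<lambda>x. a x + b x | a b. smooth a \<and> smooth b}"])
  fix g assume "g \<in> {\<lambda>x. a x + b x | a b. smooth a \<and> smooth b}"
  then obtain a b where ab: "g = (\<lambda>x. a x + b x)" "smooth a" "smooth b" by blast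
  show "\<exists>g'\<in>{\<lambda>x. a x + b x | a b. smooth a \<and> smooth b}. \<forall>x. (g has_real_derivative g' x) (at x)"
    by (rule bexI[of _ "\<lambda>x. deriv a x + deriv b x"])
      (use ab smooth_deriv in \<open>auto intro!: DERIV_add smooth_DERIV\<close>)
qed (use assms in blast)

lemma smooth_affine: assumes "smooth f" shows "smooth (\<lambda>x. c * f (m * x + d))"
proof (rule smooth_coinduct[where F="{\<lambda>x. c * a (m * x + d) | c a. smooth a}"])
  fix g assume "g \<in> {\<lambda>x. c * a (m * x + d) | c a. smooth a}"
  then obtain c a where a: "g = (\<lambda>x. c * a (m * x + d))" "smooth a" by blast
  have D: "(g has_real_derivative (c * m) * deriv a (m * x + d)) (at x)" for x
  proof -
    have "((\<lambda>x. m * x + d) has_real_derivative m) (at x)" by (auto intro!: derivative_eq_intros)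
    from DERIV_chain2[OF smooth_DERIV[OF a(2)] this]
    have "((\<lambda>x. a (m * x + d)) has_real_derivative deriv a (m * x + d) * m) (at x)" .
    from DERIV_cmult[OF this, of c] show ?thesis by (simp add: a(1) mult_ac)
  qed
  have mem: "(\<lambda>x. (c * m) * deriv a (m * x + d)) \<in> {\<lambda>x. c * a (m * x + d) | c a. smooth a}"
    using smooth_deriv[OF a(2)] by blast
  show "\<exists>g'\<in>{\<lambda>x. c * a (m * x + d) | c a. smooth a}. \<forall>x. (g has_real_derivative g' x) (at x)"
    by (rule bexI[OF _ mem]) (rule allI, rule D)
qed (use assms in blast)

text \<open>By the Leibniz rule this class is closed under differentiation, which the products alone are not.\<close>

inductive_set product_sums :: "(real \<Rightarrow> real) set" where
  prod: "smooth f \<Longrightarrow> smooth g \<Longrightarrow> (\<lambda>x. f x * g x) \<in> product_sums"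
| add: "f \<in> product_sums \<Longrightarrow> g \<in> product_sums \<Longrightarrow> (\<lambda>x. f x + g x) \<in> product_sums"

lemma smooth_mult: assumes "smooth f" "smooth g" shows "smooth (\<lambda>x. f x * g x)"
proof (rule smooth_coinduct[where F=product_sums])
  show "\<exists>h'\<in>product_sums. \<forall>x. (h has_real_derivative h' x) (at x)" if "h \<in> product_sums" for h
    using that
  proof induction
    case (prod f g)
    have mem: "(\<lambda>x. deriv f x * g x + f x * deriv g x) \<in> product_sums"
      by (intro product_sums.intros prod smooth_deriv)
    have D: "((\<lambda>x. f x * g x) has_real_derivative deriv f x * g x + f x * deriv g x) (at x)" for x
      using DERIV_mult[OF smooth_DERIV[OF prod(1)] smooth_DERIV[OF prod(2)], of x] by (simp add: mult.commute add.commute)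
    show ?case by (rule bexI[OF _ mem]) (rule allI, rule D)
  next
    case (add f g)
    then obtain f' g' where "f' \<in> product_sums" "g' \<in> product_sums"
      "\<And>x. (f has_real_derivative f' x) (at x)" "\<And>x. (g has_real_derivative g' x) (at x)" by blast
    then show ?case by (intro bexI[of _ "\<lambda>x. f' x + g' x"]) (auto intro!: DERIV_add product_sums.add)
  qed
qed (use assms in \<open>auto intro: product_sums.prod\<close>)

text \<open>For \<open>p = 1\<close> this is the classical smooth function that vanishes on the left half-line; its derivatives
  have the same form with other polynomials.\<close>

definition exp_inverse :: "real poly \<Rightarrow> real \<Rightarrow> real" where
  "exp_inverse p x = (if 0 < x then poly p (1 / x) * exp (- (1 / x)) else 0)"

lemma poly_times_exp_tendsto_0: "((\<lambda>y::real. poly p y * exp (- y)) \<longlongrightarrow> 0) at_top"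
proof -
  have "((\<lambda>y. \<Sum>i\<le>degree p. coeff p i * (y ^ i / exp y)) \<longlongrightarrow> (\<Sum>i\<le>degree p. coeff p i * 0)) at_top"
    by (intro tendsto_sum tendsto_mult tendsto_const tendsto_power_div_exp_0)
  moreover have "(\<Sum>i\<le>degree p. coeff p i * (y ^ i / exp y)) = poly p y * exp (- y)" for y
    unfolding poly_altdef exp_minus sum_distrib_right by (simp add: divide_inverse mult.assoc)
  ultimately show ?thesis by simp
qed

lemma exp_inverse_tendsto_0: "((\<lambda>x. exp_inverse p x) \<longlongrightarrow> 0) (at 0)"
proof -
  have "((\<lambda>x. exp_inverse p x) \<longlongrightarrow> 0) (at_right 0)"
  proof (rule Lim_transform_eventually)
    show "((\<lambda>x. poly p (inverse x) * exp (- inverse x)) \<longlongrightarrow> 0) (at_right (0::real))"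
      by (rule filterlim_compose[OF poly_times_exp_tendsto_0 filterlim_inverse_at_top_right])
    show "\<forall>\<^sub>F x in at_right 0. poly p (inverse x) * exp (- inverse x) = exp_inverse p x"
      using eventually_at_right_less[of 0] by eventually_elim (simp add: exp_inverse_def inverse_eq_divide)
  qed
  moreover have "((\<lambda>x. exp_inverse p x) \<longlongrightarrow> 0) (at_left 0)"
    by (rule tendsto_eventually) (auto simp: exp_inverse_def eventually_at_filter)
  ultimately show ?thesis by (simp add: filterlim_at_split)
qed

lemma exp_inverse_DERIV:
  "(exp_inverse p has_real_derivative exp_inverse ([:0, 0, 1:] * (p - pderiv p)) x) (at x)"
proof -
  consider "x > 0" | "x < 0" | "x = 0" by linarith
  then show ?thesis
  proof cases
    case 1
    have "((\<lambda>x. poly p (1 / x) * exp (- (1 / x))) has_real_derivative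
        exp_inverse ([:0, 0, 1:] * (p - pderiv p)) x) (at x)"
      using 1 by (auto intro!: derivative_eq_intros simp: exp_inverse_def field_simps power2_eq_square)
    then show ?thesis
      by (rule has_field_derivative_transform_within_open[of _ _ _ "{0<..}"]) (use 1 in \<open>auto simp: exp_inverse_def\<close>)
  next
    case 2
    have "((\<lambda>x. 0) has_real_derivative exp_inverse ([:0, 0, 1:] * (p - pderiv p)) x) (at x)"
      using 2 by (simp add: exp_inverse_def)
    then show ?thesis
      by (rule has_field_derivative_transform_within_open[of _ _ _ "{..<0}"]) (use 2 in \<open>auto simp: exp_inverse_def\<close>)
  next
    case 3
    have "((\<lambda>y. (exp_inverse p y - exp_inverse p 0) / (y - 0)) \<longlongrightarrow> 0) (at 0)"
    proof (rule Lim_transform_eventually[OF exp_inverse_tendsto_0[of "[:0, 1:] * p"]])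
      show "\<forall>\<^sub>F y in at 0. exp_inverse ([:0, 1:] * p) y = (exp_inverse p y - exp_inverse p 0) / (y - 0)"
        by (auto simp: eventually_at_filter exp_inverse_def)
    qed
    then show ?thesis by (simp add: 3 has_field_derivative_iff exp_inverse_def)
  qed
qed

lemma smooth_exp_inverse: "smooth (exp_inverse p)"
  by (rule smooth_coinduct[where F="range exp_inverse"]) (use exp_inverse_DERIV in blast)+

text \<open>A smooth function supported on \<open>[p, q]\<close> which tends to the indicator of the open interval as \<open>n\<close>
  grows, so that no normalising constant is needed.\<close>

definition bump :: "real \<Rightarrow> real \<Rightarrow> nat \<Rightarrow> real \<Rightarrow> real" where
  "bump p q n x = exp_inverse 1 (real (Suc n) * (x - p)) * exp_inverse 1 (real (Suc n) * (q - x))"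

lemma bump_zero: "x \<notin> {p<..<q} \<Longrightarrow> bump p q n x = 0"
  by (auto simp: bump_def exp_inverse_def zero_less_mult_iff)

lemma bump_pos: "x \<in> {p<..<q} \<Longrightarrow> 0 < bump p q n x"
  by (auto simp: bump_def exp_inverse_def zero_less_mult_iff)

lemma bump_bounds: "0 \<le> bump p q n x" "bump p q n x \<le> 1"
  by (auto simp: bump_def exp_inverse_def intro!: mult_le_one)

lemma test_function_bump: "test_function (bump p q n)"
proof -
  have *: "bump p q n = (\<lambda>x. (1 * exp_inverse 1 (real (Suc n) * x + - (real (Suc n) * p))) *
      (1 * exp_inverse 1 (- real (Suc n) * x + real (Suc n) * q)))"
    by (rule ext) (simp add: bump_def algebra_simps)
  have "smooth (bump p q n)" unfolding * by (intro smooth_mult smooth_affine smooth_exp_inverse)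
  moreover have "{x. bump p q n x \<noteq> 0} \<subseteq> {p<..<q}" using bump_zero by blast
  then have "bounded {x. bump p q n x \<noteq> 0}" by (rule bounded_subset[rotated]) (rule bounded_Ioo)
  ultimately show ?thesis by (simp add: test_function_iff)
qed

lemma bump_tendsto: "(\<lambda>n. bump p q n x) \<longlonglongrightarrow> indicator {p<..<q} x"
proof (cases "x \<in> {p<..<q}")
  case True
  have *: "(\<lambda>n. exp (- (1 / (real (Suc n) * a)))) \<longlonglongrightarrow> 1" if "a > 0" for a
  proof -
    have "(\<lambda>n. exp (- ((1 / a) * inverse (real (Suc n))))) \<longlonglongrightarrow> exp (- ((1 / a) * 0))"
      by (intro tendsto_intros LIMSEQ_inverse_real_of_nat)
    then show ?thesis by (simp add: inverse_eq_divide mult.commute)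
  qed
  have "(\<lambda>n. exp (- (1 / (real (Suc n) * (x - p)))) * exp (- (1 / (real (Suc n) * (q - x))))) \<longlonglongrightarrow> 1 * 1"
    by (intro tendsto_mult *) (use True in auto)
  moreover have "exp (- (1 / (real (Suc n) * (x - p)))) * exp (- (1 / (real (Suc n) * (q - x)))) = bump p q n x" for n
    using True by (simp add: bump_def exp_inverse_def zero_less_mult_iff del: of_nat_Suc)
  ultimately show ?thesis using True by simp
qed (simp add: bump_zero)

lemma test_function_support:
  assumes "test_function \<phi>"
  obtains R where "R > 0" "\<And>x. \<bar>x\<bar> \<ge> R \<Longrightarrow> \<phi> x = 0" "\<And>x. \<bar>x\<bar> \<ge> R \<Longrightarrow> deriv \<phi> x = 0"
proof -
  obtain B where B: "\<And>x. \<phi> x \<noteq> 0 \<Longrightarrow> \<bar>x\<bar> \<le> B"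
    using assms by (auto simp: test_function_iff bounded_iff)
  have z: "\<phi> x = 0" if "\<bar>x\<bar> > \<bar>B\<bar>" for x using B[of x] that by force
  show ?thesis
  proof (rule that[of "\<bar>B\<bar> + 1"])
    show "deriv \<phi> x = 0" if "\<bar>x\<bar> \<ge> \<bar>B\<bar> + 1" for x
    proof (rule DERIV_imp_deriv)
      have "((\<lambda>_. 0) has_real_derivative 0) (at x)" by simp
      then show "(\<phi> has_real_derivative 0) (at x)"
        by (rule has_field_derivative_transform_within_open[of _ _ _ "{y. \<bar>y\<bar> > \<bar>B\<bar>}"])
          (use that z in \<open>auto intro!: open_Collect_less continuous_intros\<close>)
    qed
  qed (use z in auto)
qed

lemma set_integral_eq_integral:
  fixes f :: "real \<Rightarrow> complex"
  assumes "\<And>x. x \<notin> A \<Longrightarrow> f x = 0"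
  shows "(LINT x:A|lborel. f x) = (LINT x|lborel. f x)" "set_integrable lborel A f \<longleftrightarrow> integrable lborel f"
proof -
  have *: "(\<lambda>x. indicat_real A x *\<^sub>R f x) = f" using assms by (auto split: split_indicator)
  show "(LINT x:A|lborel. f x) = (LINT x|lborel. f x)" "set_integrable lborel A f \<longleftrightarrow> integrable lborel f"
    unfolding set_lebesgue_integral_def set_integrable_def * by auto
qed

lemma integrable_mult_test:
  assumes g: "locally_integrable g" and \<phi>: "continuous_on UNIV \<phi>" "\<And>x. \<bar>x\<bar> \<ge> R \<Longrightarrow> \<phi> x = (0::real)"
  shows "integrable lborel (\<lambda>x. g x * of_real (\<phi> x))"
proof -
  have "set_integrable lborel {-R..R} (\<lambda>x. g x * complex_of_real (\<phi> x))"
    by (intro set_integrable_mult_continuous locally_integrableD[OF g] continuous_on_of_real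
        continuous_on_subset[OF \<phi>(1)]) auto
  then show ?thesis by (subst set_integral_eq_integral(2)[symmetric]) (use \<phi>(2) in \<open>auto simp: abs_le_iff\<close>)
qed

lemma integrable_mult_test_function:
  assumes "locally_integrable g" "test_function \<phi>"
  shows "integrable lborel (\<lambda>x. g x * of_real (\<phi> x))" "integrable lborel (\<lambda>x. g x * of_real (deriv \<phi> x))"
proof -
  obtain R where R: "\<And>x. \<bar>x\<bar> \<ge> R \<Longrightarrow> \<phi> x = 0" "\<And>x. \<bar>x\<bar> \<ge> R \<Longrightarrow> deriv \<phi> x = 0"
    using test_function_support[OF assms(2)] by metis
  have s: "smooth \<phi>" using assms(2) by (simp add: test_function_iff)
  show "integrable lborel (\<lambda>x. g x * of_real (\<phi> x))"
    by (rule integrable_mult_test[OF assms(1) smooth_continuous[OF s] R(1)])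
  show "integrable lborel (\<lambda>x. g x * of_real (deriv \<phi> x))"
    by (rule integrable_mult_test[OF assms(1) smooth_continuous[OF smooth_deriv[OF s]] R(2)])
qed

lemma primitive_has_weak_deriv:
  assumes U: "is_primitive U g"
  shows "has_weak_deriv U g"
  unfolding has_weak_deriv_def
proof (intro allI impI)
  fix \<phi> assume \<phi>: "test_function \<phi>"
  then obtain R where R: "R > 0" "\<And>x. \<bar>x\<bar> \<ge> R \<Longrightarrow> \<phi> x = 0" "\<And>x. \<bar>x\<bar> \<ge> R \<Longrightarrow> deriv \<phi> x = 0"
    using test_function_support by metis
  have s: "smooth \<phi>" using \<phi> by (simp add: test_function_iff)
  have p\<phi>: "is_primitive (\<lambda>x. of_real (\<phi> x)) (\<lambda>x. of_real (deriv \<phi> x))"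
  proof (rule primitive_of_vector_derivative)
    show "((\<lambda>x. complex_of_real (\<phi> x)) has_vector_derivative complex_of_real (deriv \<phi> x)) (at x)" for x
      by (rule has_vector_derivative_of_real) (use smooth_DERIV[OF s] in \<open>simp add: has_real_derivative_iff_has_vector_derivative\<close>)
    show "continuous_on UNIV (\<lambda>x. complex_of_real (deriv \<phi> x))"
      by (intro continuous_on_of_real smooth_continuous smooth_deriv s)
  qed
  have loc: "locally_integrable g" "locally_integrable U"
    using U continuous_locally_integrable[OF primitive_continuous[OF U]] by (auto simp: is_primitive_def)
  have "0 = U R * of_real (\<phi> R) - U (-R) * of_real (\<phi> (-R))" using R by simp
  also have "\<dots> = (LINT x:{-R..R}|lborel. g x * of_real (\<phi> x) + U x * of_real (deriv \<phi> x))"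
    using R(1) by (intro primitive_diff[OF primitive_mult[OF U p\<phi>]]) simp
  also have "\<dots> = (LINT x|lborel. g x * of_real (\<phi> x) + U x * of_real (deriv \<phi> x))"
    by (rule set_integral_eq_integral(1)) (use R in \<open>auto simp: abs_le_iff\<close>)
  also have "\<dots> = (LINT x|lborel. g x * of_real (\<phi> x)) + (LINT x|lborel. U x * of_real (deriv \<phi> x))"
    by (intro Bochner_Integration.integral_add integrable_mult_test_function loc \<phi>)
  finally show "(LINT x|lborel. U x * of_real (deriv \<phi> x)) = - (LINT x|lborel. g x * of_real (\<phi> x))"
    by (simp add: add_eq_0_iff)
qed

lemma locally_integrable_measurable:
  assumes "locally_integrable v" shows "v \<in> borel_measurable borel"
proof -
  have m: "(\<lambda>x. indicat_real {-real n..real n} x *\<^sub>R v x) \<in> borel_measurable borel" for n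
    using borel_measurable_integrable[OF locally_integrableD[OF assms, of "-real n" "real n", unfolded set_integrable_def]] by simp
  have "(\<lambda>n. indicat_real {-real n..real n} x *\<^sub>R v x) \<longlonglongrightarrow> v x" for x
  proof (rule tendsto_eventually)
    obtain N :: nat where "\<bar>x\<bar> \<le> real N" using real_arch_simple by blast
    have "indicat_real {-real n..real n} x *\<^sub>R v x = v x" if "n \<ge> N" for n
    proof -
      have "real N \<le> real n" using that by simp
      then have "x \<in> {-real n..real n}" using \<open>\<bar>x\<bar> \<le> real N\<close> by (auto simp: abs_le_iff)
      then show ?thesis by simp
    qed
    then show "\<forall>\<^sub>F n in sequentially. indicat_real {-real n..real n} x *\<^sub>R v x = v x"
      using eventually_sequentially by blast
  qed
  then show ?thesis by (intro borel_measurable_LIMSEQ_metric[OF m]) auto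
qed

lemma zero_integrals_imp_AE_zero:
  assumes v: "locally_integrable v" and z: "\<And>p q. p < q \<Longrightarrow> (LINT x:{p..q}|lborel. v x) = 0"
  shows "AE x in lborel. v x = 0"
proof -
  have "AE x in lborel. indicat_real {-real (Suc n)..real (Suc n)} x *\<^sub>R v x = 0" for n
  proof -
    define R where "R = real (Suc n)"
    define f where "f = (\<lambda>x. indicat_real {-R..R} x *\<^sub>R v x)"
    have R: "R > 0" by (simp add: R_def)
    have f: "integrable lborel f" using locally_integrableD[OF v, of "-R" R] by (simp add: f_def set_integrable_def)
    have fA: "set_integrable lborel A f" if "A \<in> sets borel" for A
      unfolding set_integrable_def by (rule integrable_mult_indicator) (use f that in auto)
    have "(LINT x:A|lborel. f x) = 0" if "A \<in> sets borel" for A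
      using that
    proof (induction rule: borel_set_induct)
      case empty
      show ?case by (simp add: set_lebesgue_integral_def)
    next
      case (interval a b)
      have eq: "(LINT x:{a..b}|lborel. f x) = (LINT x:{max a (-R)..min b R}|lborel. v x)"
        unfolding set_lebesgue_integral_def f_def
        by (intro Bochner_Integration.integral_cong) (auto split: split_indicator)
      consider "max a (-R) < min b R" | "max a (-R) = min b R" | "max a (-R) > min b R" by linarith
      then show ?case
      proof cases
        case 2
        have "(LINT x:{c..c}|lborel. v x) = 0" for c
          unfolding set_lebesgue_integral_def
          by (rule trans[OF integral_discrete_difference[where X="{c}" and g="\<lambda>_. 0"]]) (auto split: split_indicator)
        then show ?thesis unfolding eq 2 by simp
      next
        case 3
        then show ?thesis unfolding eq by (simp add: set_lebesgue_integral_def)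
      qed (simp add: eq z)
    next
      case (compl A)
      have "(LINT x:A \<union> -A|lborel. f x) = (LINT x:A|lborel. f x) + (LINT x:-A|lborel. f x)"
        by (rule set_integral_Un) (use compl fA in auto)
      moreover have "(LINT x:A \<union> -A|lborel. f x) = (LINT x:{-R..R}|lborel. v x)"
        unfolding set_lebesgue_integral_def f_def by simp
      ultimately show ?case using compl z[of "-R" R] R by simp
    next
      case (union A)
      have "(LINT x:(\<Union>i. A i)|lborel. f x) = (\<Sum>i. (LINT x:(A i)|lborel. f x))"
        by (rule lebesgue_integral_countable_add) (use union fA in \<open>auto simp: disjoint_family_on_def\<close>)
      then show ?case using union by simp
    qed
    then have "AE x in lborel. f x = 0" by (intro sigma_finite_measure.density_zero[OF sigma_finite_lborel f]) auto
    then show ?thesis by (simp add: f_def R_def)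
  qed
  then have "AE x in lborel. \<forall>n. indicat_real {-real (Suc n)..real (Suc n)} x *\<^sub>R v x = 0"
    by (subst AE_all_countable) blast
  then show ?thesis
  proof eventually_elim
    fix x assume *: "\<forall>n. indicat_real {-real (Suc n)..real (Suc n)} x *\<^sub>R v x = 0"
    obtain n :: nat where "\<bar>x\<bar> \<le> real n" using real_arch_simple by blast
    then have "x \<in> {-real (Suc n)..real (Suc n)}" by auto
    then show "v x = 0" using spec[OF *, of n] by simp
  qed
qed

text \<open>Since the bumps approximate indicators of intervals, the integrals of \<open>v\<close> over all intervals vanish.\<close>

lemma test_orthogonal_imp_AE_zero:
  assumes v: "locally_integrable v"
    and z: "\<And>\<phi>. test_function \<phi> \<Longrightarrow> (LINT x|lborel. v x * of_real (\<phi> x)) = 0"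
  shows "AE x in lborel. v x = 0"
proof (rule zero_integrals_imp_AE_zero[OF v])
  fix p q :: real assume "p < q"
  note [measurable] = locally_integrable_measurable[OF v]
  have [measurable]: "bump p q n \<in> borel_measurable borel" for n
    using test_function_bump[of p q n] by (auto simp: test_function_iff intro!: borel_measurable_continuous_onI smooth_continuous)
  have "(\<lambda>n. LINT x|lborel. v x * of_real (bump p q n x)) \<longlonglongrightarrow> (LINT x|lborel. v x * of_real (indicator {p<..<q} x))"
  proof (rule integral_dominated_convergence[where w="\<lambda>x. indicat_real {p..q} x * cmod (v x)"])
    have "integrable lborel (\<lambda>x. norm (indicat_real {p..q} x *\<^sub>R v x))"
      using locally_integrableD[OF v, of p q] unfolding set_integrable_def by (rule integrable_norm)
    then show "integrable lborel (\<lambda>x. indicat_real {p..q} x * cmod (v x))" by simp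
    show "AE x in lborel. (\<lambda>n. v x * of_real (bump p q n x)) \<longlonglongrightarrow> v x * of_real (indicator {p<..<q} x)"
      by (intro AE_I2 tendsto_intros bump_tendsto)
    show "AE x in lborel. norm (v x * of_real (bump p q n x)) \<le> indicat_real {p..q} x * cmod (v x)" for n
    proof (rule AE_I2)
      fix x
      show "norm (v x * of_real (bump p q n x)) \<le> indicat_real {p..q} x * cmod (v x)"
      proof (cases "x \<in> {p<..<q}")
        case True
        then show ?thesis using bump_bounds[of p q n x] by (simp add: norm_mult mult_left_le)
      qed (simp add: bump_zero)
    qed
  qed measurable
  then have "(LINT x|lborel. v x * of_real (indicator {p<..<q} x)) = 0"
    by (simp add: z[OF test_function_bump] LIMSEQ_const_iff)
  moreover have "(LINT x:{p..q}|lborel. v x) = (LINT x|lborel. v x * of_real (indicator {p<..<q} x))"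
    unfolding set_lebesgue_integral_def
    by (rule integral_discrete_difference[where X="{p, q}"]) (auto split: split_indicator)
  ultimately show "(LINT x:{p..q}|lborel. v x) = 0" by simp
qed

text \<open>The vanishing mean is what makes an antiderivative compactly supported.\<close>

lemma test_function_antiderivative:
  assumes \<theta>: "smooth \<theta>" "\<And>x. \<bar>x\<bar> \<ge> R \<Longrightarrow> \<theta> x = 0" and z: "(LINT x|lborel. complex_of_real (\<theta> x)) = 0" and R: "R > 0"
  shows "\<exists>\<phi>. test_function \<phi> \<and> deriv \<phi> = \<theta>"
proof -
  have "isCont \<theta> x" for x by (rule DERIV_isCont[OF smooth_DERIV[OF \<theta>(1)]])
  then obtain F where F: "\<And>x. (F has_vector_derivative \<theta> x) (at x)"
    using einterval_antiderivative[of "-\<infinity>" \<infinity> \<theta>] by auto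
  define \<phi> where "\<phi> x = F x - F (-R)" for x
  have D: "(\<phi> has_real_derivative \<theta> x) (at x)" for x
    using F[of x] unfolding \<phi>_def has_real_derivative_iff_has_vector_derivative[symmetric]
    by (auto intro!: derivative_eq_intros)
  have d: "deriv \<phi> = \<theta>" by (intro ext DERIV_imp_deriv D)
  have "is_primitive (\<lambda>x. complex_of_real (\<phi> x)) (\<lambda>x. complex_of_real (\<theta> x))"
    by (rule primitive_of_vector_derivative)
      (use D \<theta>(1) in \<open>auto simp: has_real_derivative_iff_has_vector_derivative
          intro!: has_vector_derivative_of_real continuous_on_of_real smooth_continuous\<close>)
  from primitive_diff[OF this] have diff: "complex_of_real (\<phi> y) - complex_of_real (\<phi> x) = (LINT t:{x..y}|lborel. complex_of_real (\<theta> t))"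
    if "x \<le> y" for x y using that .
  have zero: "\<phi> x = 0" if "\<bar>x\<bar> \<ge> R" for x
  proof (cases "x \<le> -R")
    case True
    have "(LINT t:{x..-R}|lborel. complex_of_real (\<theta> t)) = (LINT t:{x..-R}|lborel. 0)"
      unfolding set_lebesgue_integral_def
      by (intro Bochner_Integration.integral_cong) (use \<theta>(2) in \<open>auto split: split_indicator\<close>)
    then show ?thesis using diff[OF True] by (simp add: \<phi>_def)
  next
    case False
    then have x: "x \<ge> R" using that by linarith
    have "(LINT t:{-R..x}|lborel. complex_of_real (\<theta> t)) = 0"
      using z by (subst set_integral_eq_integral(1)) (use \<theta>(2) x in \<open>auto simp: abs_le_iff\<close>)
    then show ?thesis using diff[of "-R" x] x R by (simp add: \<phi>_def)
  qed
  have "smooth \<phi>"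
  proof (rule smooth_coinduct[where F="insert \<phi> {f. smooth f}"])
    fix g assume "g \<in> insert \<phi> {f. smooth f}"
    then consider "g = \<phi>" | "smooth g" by blast
    then show "\<exists>g'\<in>insert \<phi> {f. smooth f}. \<forall>x. (g has_real_derivative g' x) (at x)"
    proof cases
      case 1
      show ?thesis by (rule bexI[where x=\<theta>]) (use D \<theta>(1) 1 in auto)
    next
      case 2
      show ?thesis by (rule bexI[where x="deriv g"]) (use smooth_DERIV[OF 2] smooth_deriv[OF 2] in auto)
    qed
  qed simp
  moreover have "bounded {x. \<phi> x \<noteq> 0}"
    by (rule bounded_subset[of "{-R..R}"]) (use zero in force)+
  ultimately show ?thesis using d by (auto simp: test_function_iff)
qed

text \<open>The lemma of du Bois-Reymond. Every test function becomes the derivative of a test function after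
  subtraction of a multiple of one fixed bump \<open>\<psi>0\<close>, and that multiple is proportional to its mean.\<close>

lemma weak_deriv_zero_imp_constant:
  assumes w: "locally_integrable w"
    and z: "\<And>\<phi>. test_function \<phi> \<Longrightarrow> (LINT x|lborel. w x * of_real (deriv \<phi> x)) = 0"
  shows "\<exists>c. AE x in lborel. w x = c"
proof -
  define \<psi>0 where "\<psi>0 = bump (-1) 1 0"
  define I where "I f = (LINT x|lborel. complex_of_real (f x))" for f :: "real \<Rightarrow> real"
  have t0: "test_function \<psi>0" by (simp add: \<psi>0_def test_function_bump)
  have one: "locally_integrable (\<lambda>_. c)" for c by (intro continuous_locally_integrable continuous_intros)
  have intI: "integrable lborel (\<lambda>x. complex_of_real (f x))" if "test_function f" for f
    using integrable_mult_test_function(1)[OF one[of 1] that] by simp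
  have I0: "I \<psi>0 \<noteq> 0"
  proof
    assume "I \<psi>0 = 0"
    then have "(LINT x|lborel. \<psi>0 x) = 0" by (simp add: I_def)
    moreover have "integrable lborel \<psi>0" using integrable_Re[OF intI[OF t0]] by simp
    from integral_nonneg_eq_0_iff_AE[OF this]
    have "(LINT x|lborel. \<psi>0 x) = 0 \<longleftrightarrow> (AE x in lborel. \<psi>0 x = 0)"
      by (simp add: \<psi>0_def bump_bounds)
    ultimately have "AE x in lborel. \<psi>0 x = 0" by simp
    then have "AE x in lborel. x \<notin> {-1<..<1::real}"
      by eventually_elim (use bump_pos[of _ "-1" 1 0] in \<open>force simp: \<psi>0_def\<close>)
    then have "emeasure lborel {-1<..<1::real} = 0"
      by (subst (asm) AE_iff_measurable[where N="{-1<..<1::real}"]) auto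
    then show False by simp
  qed
  define c where "c = (LINT x|lborel. w x * of_real (\<psi>0 x)) / I \<psi>0"
  have "AE x in lborel. w x - c = 0"
  proof (rule test_orthogonal_imp_AE_zero)
    show "locally_integrable (\<lambda>x. w x - c)"
      using w one[of c] by (auto simp: locally_integrable_def intro: set_integral_diff(1))
    fix \<psi> assume \<psi>: "test_function \<psi>"
    obtain R1 where R1: "R1 > 0" "\<And>x. \<bar>x\<bar> \<ge> R1 \<Longrightarrow> \<psi> x = 0" using test_function_support[OF \<psi>] by metis
    obtain R2 where R2: "R2 > 0" "\<And>x. \<bar>x\<bar> \<ge> R2 \<Longrightarrow> \<psi>0 x = 0" using test_function_support[OF t0] by metis
    define k where "k = Re (I \<psi>) / Re (I \<psi>0)"
    define \<theta> where "\<theta> x = \<psi> x + (- k) * \<psi>0 (1 * x + 0)" for x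
    have "Im (I f) = 0" for f by (simp add: I_def)
    then have k: "complex_of_real k = I \<psi> / I \<psi>0" using I0 by (simp add: k_def complex_eq_iff Re_divide Im_divide power2_eq_square)
    have Ichi: "(LINT x|lborel. complex_of_real (\<theta> x)) = I \<psi> - of_real k * I \<psi>0"
    proof -
      have eq: "(\<lambda>x. complex_of_real (\<theta> x)) = (\<lambda>x. of_real (\<psi> x) - of_real k * of_real (\<psi>0 x))"
        by (simp add: \<theta>_def fun_eq_iff)
      show ?thesis unfolding eq I_def integral_mult_right_zero[symmetric]
        by (intro Bochner_Integration.integral_diff integrable_mult_right intI \<psi> t0)
    qed
    have "\<exists>\<phi>. test_function \<phi> \<and> deriv \<phi> = \<theta>"
    proof (rule test_function_antiderivative[where R="max R1 R2"])
      show "smooth \<theta>" unfolding \<theta>_def using \<psi> t0 by (intro smooth_add smooth_affine) (auto simp: test_function_iff)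
      show "(LINT x|lborel. complex_of_real (\<theta> x)) = 0" using Ichi k I0 by simp
    qed (use R1 R2 in \<open>auto simp: \<theta>_def\<close>)
    then have "0 = (LINT x|lborel. w x * of_real (\<theta> x))" using z by metis
    also have "\<dots> = (LINT x|lborel. w x * of_real (\<psi> x)) - of_real k * (LINT x|lborel. w x * of_real (\<psi>0 x))"
      using integrable_mult_test_function(1)[OF w \<psi>] integrable_mult_test_function(1)[OF w t0]
      by (simp add: \<theta>_def algebra_simps)
    also have "of_real k * (LINT x|lborel. w x * of_real (\<psi>0 x)) = c * I \<psi>"
      using I0 by (simp add: k c_def)
    finally have "(LINT x|lborel. w x * of_real (\<psi> x)) = c * I \<psi>" by simp
    then show "(LINT x|lborel. (w x - c) * of_real (\<psi> x)) = 0"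
      using Bochner_Integration.integral_diff[OF integrable_mult_test_function(1)[OF w \<psi>]
          integrable_mult_right[OF intI[OF \<psi>], of c]]
      by (simp only: left_diff_distrib I_def integral_mult_right_zero diff_self)
  qed
  then show ?thesis by auto
qed

text \<open>Elements of \<open>H1\<close> thus have absolutely continuous representatives, for which point values make sense.\<close>

lemma weak_deriv_primitive:
  assumes u: "locally_integrable u" and g: "locally_integrable g" and ug: "has_weak_deriv u g"
  shows "\<exists>U. is_primitive U g \<and> (AE x in lborel. u x = U x)"
proof -
  obtain U where U: "is_primitive U g" using exists_primitive[OF g] by blast
  have locU: "locally_integrable U" by (intro continuous_locally_integrable primitive_continuous[OF U])
  have "\<exists>c. AE x in lborel. u x - U x = c"
  proof (rule weak_deriv_zero_imp_constant)
    show "locally_integrable (\<lambda>x. u x - U x)"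
      using u locU by (auto simp: locally_integrable_def intro: set_integral_diff(1))
    fix \<phi> assume \<phi>: "test_function \<phi>"
    have "(LINT x|lborel. (u x - U x) * of_real (deriv \<phi> x))
        = (LINT x|lborel. u x * of_real (deriv \<phi> x)) - (LINT x|lborel. U x * of_real (deriv \<phi> x))"
      unfolding left_diff_distrib
      by (intro Bochner_Integration.integral_diff integrable_mult_test_function u locU \<phi>)
    also have "\<dots> = 0"
      using ug primitive_has_weak_deriv[OF U] \<phi> by (simp add: has_weak_deriv_def)
    finally show "(LINT x|lborel. (u x - U x) * of_real (deriv \<phi> x)) = 0" .
  qed
  then obtain c where c: "AE x in lborel. u x - U x = c" by blast
  have "is_primitive (\<lambda>x. U x + c) g" using U by (simp add: is_primitive_def)
  moreover have "AE x in lborel. u x = U x + c" using c by eventually_elim (simp add: algebra_simps)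
  ultimately show ?thesis by blast
qed

lemma weak_deriv_unique:
  assumes "locally_integrable g1" "locally_integrable g2" "has_weak_deriv u g1" "has_weak_deriv u g2"
  shows "AE x in lborel. g1 x = g2 x"
proof -
  have "AE x in lborel. g1 x - g2 x = 0"
  proof (rule test_orthogonal_imp_AE_zero)
    show "locally_integrable (\<lambda>x. g1 x - g2 x)"
      using assms by (auto simp: locally_integrable_def intro: set_integral_diff(1))
    fix \<phi> assume \<phi>: "test_function \<phi>"
    have "(LINT x|lborel. (g1 x - g2 x) * of_real (\<phi> x))
        = (LINT x|lborel. g1 x * of_real (\<phi> x)) - (LINT x|lborel. g2 x * of_real (\<phi> x))"
      unfolding left_diff_distrib
      by (intro Bochner_Integration.integral_diff integrable_mult_test_function assms \<phi>)
    also have "\<dots> = 0"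
    proof -
      have "- (LINT x|lborel. g1 x * of_real (\<phi> x)) = - (LINT x|lborel. g2 x * of_real (\<phi> x))"
        using assms(3,4) \<phi> unfolding has_weak_deriv_def by metis
      then show ?thesis by simp
    qed
    finally show "(LINT x|lborel. (g1 x - g2 x) * of_real (\<phi> x)) = 0" .
  qed
  then show ?thesis by eventually_elim simp
qed

section \<open>The form of the operator\<close>

lemma L2_AE_eq:
  assumes "u \<in> L2" and [measurable]: "v \<in> borel_measurable borel" and "AE x in lborel. v x = u x"
  shows "v \<in> L2"
proof -
  note [measurable] = L2_measurable[OF assms(1)]
  have "integrable lborel (\<lambda>x. (cmod (v x))\<^sup>2) \<longleftrightarrow> integrable lborel (\<lambda>x. (cmod (u x))\<^sup>2)"
  proof (rule integrable_cong_AE)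
    show "AE x in lborel. (cmod (v x))\<^sup>2 = (cmod (u x))\<^sup>2" using assms(3) by eventually_elim simp
  qed measurable
  then show ?thesis using L2_sq_integrable[OF assms(1)] by (simp add: L2_def)
qed

lemma compact_support_L2:
  assumes "continuous_on UNIV f" "\<And>x. \<bar>x\<bar> \<ge> R \<Longrightarrow> f x = (0::real)"
  shows "(\<lambda>x. complex_of_real (f x)) \<in> L2"
proof (rule L2_dominated)
  have "integrable lborel (\<lambda>x. complex_of_real ((f x)\<^sup>2) * of_real 1)"
    by (rule integrable_mult_test[where R=R and \<phi>="\<lambda>x. (f x)\<^sup>2" and g="\<lambda>_. 1", simplified mult_1_left, THEN integrable_mult_left])
      (use assms in \<open>auto intro!: continuous_locally_integrable continuous_intros\<close>)
  from integrable_Re[OF this] show "integrable lborel (\<lambda>x. (f x)\<^sup>2)" by simp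
  show "(\<lambda>x. complex_of_real (f x)) \<in> borel_measurable borel"
    by (intro borel_measurable_continuous_onI continuous_on_of_real assms)
qed simp

lemma cinner_real_test:
  assumes "u \<in> L2" "(\<lambda>x. complex_of_real (f x)) \<in> L2"
  shows "cinner (to_l2 u) (to_l2 (\<lambda>x. complex_of_real (f x))) = (LINT x|lborel. u x * of_real (f x))"
  using assms by (simp add: to_l2_cinner L2_inner_def)

locale schroedinger_setting =
  fixes h :: real and V :: "real \<Rightarrow> real"
  assumes h: "h > 0" and V_continuous: "continuous_on UNIV V" and V_nonneg: "0 \<le> V x"
begin

abbreviation sV :: "real \<Rightarrow> complex" where "sV x \<equiv> complex_of_real (sqrt (V x))"

lemma V_measurable [measurable]: "V \<in> borel_measurable borel"
  by (intro borel_measurable_continuous_onI V_continuous)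

lemma sqrt_mult_measurable: "u \<in> borel_measurable borel \<Longrightarrow> sqrt_potential_mult V u \<in> borel_measurable borel"
  unfolding sqrt_potential_mult_def by measurable

text \<open>The pairs of \<open>u\<close> and \<open>(h u', V\<^sup>1\<^sup>/\<^sup>2 u)\<close>. Both components are described by identities against test
  functions, because each of these is a continuous linear condition and the graph is then visibly a
  closed subspace.\<close>

definition graph :: "(l2 \<times> l2 \<times> l2) set" where
  "graph = {(a, b, c). \<forall>\<phi>. test_function \<phi> \<longrightarrow>
     cinner a (to_l2 (\<lambda>x. of_real (h * deriv \<phi> x))) + cinner b (to_l2 (\<lambda>x. of_real (\<phi> x))) = 0 \<and>
     cinner c (to_l2 (\<lambda>x. of_real (\<phi> x))) - cinner a (to_l2 (\<lambda>x. of_real (sqrt (V x) * \<phi> x))) = 0}"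

lemma test_L2:
  assumes \<phi>: "test_function \<phi>"
  shows "(\<lambda>x. complex_of_real (h * deriv \<phi> x)) \<in> L2" "(\<lambda>x. complex_of_real (\<phi> x)) \<in> L2"
    "(\<lambda>x. complex_of_real (sqrt (V x) * \<phi> x)) \<in> L2"
proof -
  obtain R where R: "\<And>x. \<bar>x\<bar> \<ge> R \<Longrightarrow> \<phi> x = 0" "\<And>x. \<bar>x\<bar> \<ge> R \<Longrightarrow> deriv \<phi> x = 0"
    using test_function_support[OF \<phi>] by metis
  have s: "smooth \<phi>" using \<phi> by (simp add: test_function_iff)
  note c = smooth_continuous[OF s] smooth_continuous[OF smooth_deriv[OF s]]
  show "(\<lambda>x. complex_of_real (h * deriv \<phi> x)) \<in> L2"
    by (rule compact_support_L2[where R=R]) (use R c in \<open>auto intro!: continuous_intros\<close>)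
  show "(\<lambda>x. complex_of_real (\<phi> x)) \<in> L2"
    by (rule compact_support_L2[where R=R]) (use R c in auto)
  show "(\<lambda>x. complex_of_real (sqrt (V x) * \<phi> x)) \<in> L2"
    by (rule compact_support_L2[where R=R]) (use R c V_continuous in \<open>auto intro!: continuous_intros\<close>)
qed

sublocale form_graph graph
proof
  show "subspace graph"
    by (rule subspaceI) (auto simp: graph_def zero_prod_def cinner_add_left cinner_scaleR_left
        distrib_left[symmetric] right_diff_distrib[symmetric] add_eq_0_iff algebra_simps)
  show "J w \<in> graph" if "w \<in> graph" for w
  proof -
    obtain a b c where w: "w = (a, b, c)" by (cases w)
    have J: "cinner (J a) y = \<i> * cinner a y" for a y :: l2 using cinner_cscale_left[of \<i> a y] by (simp add: cscale_def)
    show ?thesis using that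
      by (auto simp: w graph_def J_Pair J distrib_left[symmetric] right_diff_distrib[symmetric])
  qed
  have closed0: "closed {w. cinner (f w) y + cinner (g w) z = 0}"
    if "continuous_on UNIV f" "continuous_on UNIV g" for f g :: "l2 \<times> l2 \<times> l2 \<Rightarrow> l2" and y z
  proof -
    have "{w. cinner (f w) y + cinner (g w) z = 0} =
        {w. f w \<bullet> y + g w \<bullet> z = 0} \<inter> {w. f w \<bullet> J y + g w \<bullet> J z = 0}"
      by (auto simp: complex_eq_iff Im_cinner)
    also have "closed \<dots>" by (intro closed_Int closed_Collect_eq continuous_intros that)
    finally show ?thesis .
  qed
  have "graph = (\<Inter>\<phi>\<in>{\<phi>. test_function \<phi>}.
      {w. cinner (fst w) (to_l2 (\<lambda>x. of_real (h * deriv \<phi> x))) + cinner (fst (snd w)) (to_l2 (\<lambda>x. of_real (\<phi> x))) = 0} \<inter>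
      {w. cinner (snd (snd w)) (to_l2 (\<lambda>x. of_real (\<phi> x))) + cinner (fst w) (- to_l2 (\<lambda>x. of_real (sqrt (V x) * \<phi> x))) = 0})"
    by (auto simp: graph_def cinner_minus_right)
  also have "closed \<dots>" by (intro closed_INT closed_Int ballI closed0 continuous_intros)
  finally show "closed graph" .
qed

lemma graph_iff:
  assumes u: "u \<in> L2" and b: "b \<in> L2" and w: "w \<in> L2"
  shows "(to_l2 u, to_l2 b, to_l2 w) \<in> graph \<longleftrightarrow>
    has_weak_deriv u (\<lambda>x. b x / of_real h) \<and> (AE x in lborel. w x = sqrt_potential_mult V u x)"
proof -
  have 1: "cinner (to_l2 u) (to_l2 (\<lambda>x. of_real (h * deriv \<phi> x))) + cinner (to_l2 b) (to_l2 (\<lambda>x. of_real (\<phi> x))) = 0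
     \<longleftrightarrow> (LINT x|lborel. u x * of_real (deriv \<phi> x)) = - (LINT x|lborel. b x / of_real h * of_real (\<phi> x))"
    if \<phi>: "test_function \<phi>" for \<phi>
  proof -
    have "cinner (to_l2 u) (to_l2 (\<lambda>x. of_real (h * deriv \<phi> x))) = of_real h * (LINT x|lborel. u x * of_real (deriv \<phi> x))"
      by (simp only: cinner_real_test[OF u test_L2(1)[OF \<phi>]])
        (simp only: of_real_mult mult.left_commute[of _ "of_real h"] integral_mult_right_zero)
    moreover have "cinner (to_l2 b) (to_l2 (\<lambda>x. of_real (\<phi> x))) = of_real h * (LINT x|lborel. b x / of_real h * of_real (\<phi> x))"
      using h by (simp only: cinner_real_test[OF b test_L2(2)[OF \<phi>]] integral_mult_right_zero[symmetric]) simp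
    ultimately have "cinner (to_l2 u) (to_l2 (\<lambda>x. of_real (h * deriv \<phi> x))) + cinner (to_l2 b) (to_l2 (\<lambda>x. of_real (\<phi> x)))
       = of_real h * ((LINT x|lborel. u x * of_real (deriv \<phi> x)) + (LINT x|lborel. b x / of_real h * of_real (\<phi> x)))"
      by (simp only: distrib_left)
    then show ?thesis using h by (simp only: mult_eq_0_iff of_real_eq_0_iff eq_neg_iff_add_eq_0) simp
  qed
  have locw: "locally_integrable (\<lambda>x. w x - sqrt_potential_mult V u x)"
  proof -
    have "locally_integrable (\<lambda>x. u x * sV x)"
      unfolding locally_integrable_def
      by (intro allI set_integrable_mult_continuous locally_integrableD L2_locally_integrable u
          continuous_on_of_real continuous_on_real_sqrt continuous_on_subset[OF V_continuous]) auto
    then show ?thesis using L2_locally_integrable[OF w]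
      by (auto simp: locally_integrable_def sqrt_potential_mult_def mult.commute intro: set_integral_diff(1))
  qed
  have 2: "cinner (to_l2 w) (to_l2 (\<lambda>x. of_real (\<phi> x))) - cinner (to_l2 u) (to_l2 (\<lambda>x. of_real (sqrt (V x) * \<phi> x)))
     = (LINT x|lborel. (w x - sqrt_potential_mult V u x) * of_real (\<phi> x))" if \<phi>: "test_function \<phi>" for \<phi>
  proof -
    have "integrable lborel (\<lambda>x. w x * of_real (\<phi> x))"
      by (rule integrable_mult_test_function(1)[OF L2_locally_integrable[OF w] \<phi>])
    moreover have "integrable lborel (\<lambda>x. u x * of_real (sqrt (V x) * \<phi> x))"
      using L2_mult_integrable[OF u test_L2(3)[OF \<phi>]] .
    ultimately have "(LINT x|lborel. w x * of_real (\<phi> x)) - (LINT x|lborel. u x * of_real (sqrt (V x) * \<phi> x))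
       = (LINT x|lborel. w x * of_real (\<phi> x) - u x * of_real (sqrt (V x) * \<phi> x))"
      by (rule Bochner_Integration.integral_diff[symmetric])
    also have "\<dots> = (LINT x|lborel. (w x - sqrt_potential_mult V u x) * of_real (\<phi> x))"
      by (rule Bochner_Integration.integral_cong) (auto simp: sqrt_potential_mult_def algebra_simps)
    finally show ?thesis using cinner_real_test[OF w test_L2(2)[OF \<phi>]] cinner_real_test[OF u test_L2(3)[OF \<phi>]] by simp
  qed
  have 3: "(\<forall>\<phi>. test_function \<phi> \<longrightarrow> (LINT x|lborel. (w x - sqrt_potential_mult V u x) * of_real (\<phi> x)) = 0)
     \<longleftrightarrow> (AE x in lborel. w x = sqrt_potential_mult V u x)" (is "?L \<longleftrightarrow> ?R")
  proof
    assume ?L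
    then have "AE x in lborel. w x - sqrt_potential_mult V u x = 0" by (intro test_orthogonal_imp_AE_zero locw) auto
    then show ?R by eventually_elim simp
  next
    assume ?R
    show ?L
    proof (intro allI impI)
      fix \<phi>
      have "AE x in lborel. (w x - sqrt_potential_mult V u x) * of_real (\<phi> x) = 0"
        using \<open>?R\<close> by eventually_elim simp
      then show "(LINT x|lborel. (w x - sqrt_potential_mult V u x) * of_real (\<phi> x)) = 0" by (rule integral_eq_zero_AE)
    qed
  qed
  show ?thesis
    unfolding 3[symmetric] has_weak_deriv_def graph_def mem_Collect_eq case_prod_conv
      all_conj_distrib[symmetric] imp_conjR[symmetric]
    by (intro all_cong1 imp_cong refl) (simp only: 1 2)
qed

lemma graph_of_primitive:
  assumes "is_primitive U g" "U \<in> L2" "g \<in> L2" "sqrt_potential_mult V U \<in> L2"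
  shows "(to_l2 U, to_l2 (\<lambda>x. of_real h * g x), to_l2 (sqrt_potential_mult V U)) \<in> graph"
  using assms h by (simp add: graph_iff L2_scale primitive_has_weak_deriv)

text \<open>Every class in the form domain is represented by an absolutely continuous function.\<close>

lemma graph_cases:
  assumes "(a, q) \<in> graph"
  obtains U g where "is_primitive U g" "U \<in> L2" "g \<in> L2" "sqrt_potential_mult V U \<in> L2" "a = to_l2 U"
    "q = (to_l2 (\<lambda>x. of_real h * g x), to_l2 (sqrt_potential_mult V U))"
proof -
  obtain b c where q: "q = (b, c)" by (cases q)
  obtain u where u: "u \<in> L2" "a = to_l2 u" by (rule to_l2_cases)
  obtain b' where b: "b' \<in> L2" "b = to_l2 b'" by (rule to_l2_cases)
  obtain w where w: "w \<in> L2" "c = to_l2 w" by (rule to_l2_cases)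
  define g where "g x = b' x / of_real h" for x
  have g: "g \<in> L2" "b' = (\<lambda>x. of_real h * g x)"
    using L2_scale[OF b(1), of "1 / of_real h"] h by (auto simp: g_def[abs_def])
  have *: "has_weak_deriv u g" "AE x in lborel. w x = sqrt_potential_mult V u x"
    using assms graph_iff[OF u(1) b(1) w(1)] by (auto simp: q u b w g_def[abs_def])
  obtain U where U: "is_primitive U g" "AE x in lborel. u x = U x"
    using weak_deriv_primitive[OF L2_locally_integrable[OF u(1)] L2_locally_integrable[OF g(1)] *(1)] by blast
  have U': "AE x in lborel. U x = u x" using U(2) by eventually_elim simp
  have UL: "U \<in> L2" by (rule L2_AE_eq[OF u(1) primitive_measurable[OF U(1)] U'])
  have wU: "AE x in lborel. sqrt_potential_mult V U x = w x"
    using *(2) U(2) by eventually_elim (simp add: sqrt_potential_mult_def)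
  have VU: "sqrt_potential_mult V U \<in> L2"
    by (rule L2_AE_eq[OF w(1) sqrt_mult_measurable[OF primitive_measurable[OF U(1)]] wU])
  show ?thesis
    by (rule that[OF U(1) UL g(1) VU]) (use UL u VU w wU U(2) b g in \<open>auto simp: q to_l2_eq_iff elim: eventually_mono\<close>)
qed

lemma norm_graph:
  assumes "g \<in> L2" "w \<in> L2"
  shows "(norm (to_l2 (\<lambda>x. of_real h * g x), to_l2 w))\<^sup>2 = h\<^sup>2 * (L2_norm g)\<^sup>2 + (L2_norm w)\<^sup>2"
proof -
  have "to_l2 (\<lambda>x. of_real h * g x) = h *\<^sub>R to_l2 g" using assms by (simp add: to_l2_scaleR)
  then show ?thesis using assms by (simp add: norm_prod_def norm_to_l2 power_mult_distrib)
qed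

text \<open>Because weak derivatives are unique, the choice made in the definition of \<open>weak_deriv\<close> is immaterial.\<close>

lemma graph_functional:
  assumes "(a, q) \<in> graph" "(a, q') \<in> graph" shows "q = q'"
proof -
  have "(0, q - q') \<in> graph" using G_diff[OF assms] by simp
  then obtain U g where U: "is_primitive U g" "U \<in> L2" "g \<in> L2" "sqrt_potential_mult V U \<in> L2" "0 = to_l2 U"
    "q - q' = (to_l2 (\<lambda>x. of_real h * g x), to_l2 (sqrt_potential_mult V U))" by (rule graph_cases)
  have U0: "AE x in lborel. U x = 0"
    using to_l2_eq_iff[OF U(2) L2_zero] U(5) by (simp add: to_l2_zero[symmetric])
  have VU: "AE x in lborel. sqrt_potential_mult V U x = 0" using U0 by eventually_elim (simp add: sqrt_potential_mult_def)
  have "has_weak_deriv U (\<lambda>_. 0)"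
    unfolding has_weak_deriv_def
  proof (intro allI impI)
    fix \<phi>
    have "AE x in lborel. U x * of_real (deriv \<phi> x) = 0" using U0 by eventually_elim simp
    from integral_eq_zero_AE[OF this]
    show "(LINT x|lborel. U x * of_real (deriv \<phi> x)) = - (LINT x|lborel. 0 * of_real (\<phi> x))" by simp
  qed
  then have "AE x in lborel. g x = 0"
    by (rule weak_deriv_unique[OF L2_locally_integrable[OF U(3)] L2_locally_integrable[OF L2_zero]
        primitive_has_weak_deriv[OF U(1)]])
  then have "AE x in lborel. of_real h * g x = 0" by eventually_elim simp
  then have "to_l2 (\<lambda>x. of_real h * g x) = to_l2 (\<lambda>_. 0)" "to_l2 (sqrt_potential_mult V U) = to_l2 (\<lambda>_. 0)"
    using VU by (simp_all add: to_l2_eq_iff[OF L2_scale[OF U(3)] L2_zero] to_l2_eq_iff[OF U(4) L2_zero])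
  then have "q - q' = 0" using U(6) by (simp add: zero_prod_def to_l2_zero[symmetric])
  then show ?thesis by simp
qed

subsection \<open>Identification with the operator\<close>

lemma domain_iff: "u \<in> schroedinger_form_domain V \<longleftrightarrow> u \<in> L2 \<and> (\<exists>q. (to_l2 u, q) \<in> graph)"
proof
  assume "u \<in> schroedinger_form_domain V"
  then obtain g where "u \<in> L2" "g \<in> L2" "has_weak_deriv u g" "sqrt_potential_mult V u \<in> L2"
    by (auto simp: schroedinger_form_domain_def H1_def)
  then show "u \<in> L2 \<and> (\<exists>q. (to_l2 u, q) \<in> graph)"
    using graph_iff[of u "\<lambda>x. of_real h * g x" "sqrt_potential_mult V u"] h by (auto simp: L2_scale)
next
  assume *: "u \<in> L2 \<and> (\<exists>q. (to_l2 u, q) \<in> graph)"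
  then obtain q where q: "(to_l2 u, q) \<in> graph" by blast
  then obtain U g where U: "is_primitive U g" "U \<in> L2" "g \<in> L2" "sqrt_potential_mult V U \<in> L2" "to_l2 u = to_l2 U"
    by (rule graph_cases)
  have AE: "AE x in lborel. U x = u x" using to_l2_eq_iff[OF U(2) conjunct1[OF *]] U(5) by simp
  have "sqrt_potential_mult V u \<in> L2"
  proof (rule L2_AE_eq[OF U(4)])
    show "sqrt_potential_mult V u \<in> borel_measurable borel" using * L2_measurable sqrt_mult_measurable by blast
    show "AE x in lborel. sqrt_potential_mult V u x = sqrt_potential_mult V U x"
      using AE by eventually_elim (simp add: sqrt_potential_mult_def)
  qed
  moreover have "has_weak_deriv u g"
    unfolding has_weak_deriv_def
  proof (intro allI impI)
    fix \<phi> assume \<phi>: "test_function \<phi>"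
    have "(LINT x|lborel. u x * of_real (deriv \<phi> x)) = (LINT x|lborel. U x * of_real (deriv \<phi> x))"
    proof (rule integral_cong_AE)
      show "AE x in lborel. u x * of_real (deriv \<phi> x) = U x * of_real (deriv \<phi> x)" using AE by eventually_elim simp
      show "(\<lambda>x. u x * of_real (deriv \<phi> x)) \<in> borel_measurable lborel"
        by (intro borel_measurable_integrable integrable_mult_test_function L2_locally_integrable \<phi>) (use * in blast)
      show "(\<lambda>x. U x * of_real (deriv \<phi> x)) \<in> borel_measurable lborel"
        by (intro borel_measurable_integrable integrable_mult_test_function L2_locally_integrable \<phi> U)
    qed
    then show "(LINT x|lborel. u x * of_real (deriv \<phi> x)) = - (LINT x|lborel. g x * of_real (\<phi> x))"
      using primitive_has_weak_deriv[OF U(1)] \<phi> by (simp add: has_weak_deriv_def)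
  qed
  ultimately show "u \<in> schroedinger_form_domain V" using * U(3) by (auto simp: schroedinger_form_domain_def H1_def)
qed

lemma domain_graph:
  assumes u: "u \<in> schroedinger_form_domain V"
  shows "weak_deriv u \<in> L2" "sqrt_potential_mult V u \<in> L2" "u \<in> L2"
    "(to_l2 u, to_l2 (\<lambda>x. of_real h * weak_deriv u x), to_l2 (sqrt_potential_mult V u)) \<in> graph"
proof -
  have "\<exists>g. g \<in> L2 \<and> has_weak_deriv u g" using u by (auto simp: schroedinger_form_domain_def H1_def)
  then have w: "weak_deriv u \<in> L2 \<and> has_weak_deriv u (weak_deriv u)" unfolding weak_deriv_def by (rule someI_ex)
  then show "weak_deriv u \<in> L2" by blast
  show L: "sqrt_potential_mult V u \<in> L2" "u \<in> L2" using u by (auto simp: schroedinger_form_domain_def H1_def)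
  show "(to_l2 u, to_l2 (\<lambda>x. of_real h * weak_deriv u x), to_l2 (sqrt_potential_mult V u)) \<in> graph"
    using w L h by (simp add: graph_iff L2_scale)
qed

lemma form_eq_cinner:
  assumes u: "u \<in> schroedinger_form_domain V" and v: "v \<in> schroedinger_form_domain V"
    and "(to_l2 u, q) \<in> graph" "(to_l2 v, r) \<in> graph"
  shows "schroedinger_form h V u v = cinner q r"
proof -
  have q: "q = (to_l2 (\<lambda>x. of_real h * weak_deriv u x), to_l2 (sqrt_potential_mult V u))"
    using graph_functional[OF assms(3) domain_graph(4)[OF u]] .
  have r: "r = (to_l2 (\<lambda>x. of_real h * weak_deriv v x), to_l2 (sqrt_potential_mult V v))"
    using graph_functional[OF assms(4) domain_graph(4)[OF v]] .
  show ?thesis using domain_graph(1-3)[OF u] domain_graph(1-3)[OF v]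
    by (simp add: q r cinner_Pair to_l2_cinner L2_scale L2_inner_scale_left L2_inner_scale_right
        schroedinger_form_def power2_eq_square)
qed

lemma schroedinger_iff:
  "(u, f) \<in> schroedinger h V \<longleftrightarrow> u \<in> L2 \<and> f \<in> L2 \<and>
     (\<exists>q. (to_l2 u, q) \<in> graph \<and> (\<forall>v r. (v, r) \<in> graph \<longrightarrow> cinner q r = cinner (to_l2 f) v))"
proof
  assume "(u, f) \<in> schroedinger h V"
  then have u: "u \<in> schroedinger_form_domain V" and f: "f \<in> L2"
    and eq: "\<And>v. v \<in> schroedinger_form_domain V \<Longrightarrow> schroedinger_form h V u v = L2_inner f v"
    by (auto simp: schroedinger_def form_operator_def)
  obtain q where uq: "u \<in> L2" "(to_l2 u, q) \<in> graph" using u domain_iff by blast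
  have "cinner q r = cinner (to_l2 f) v" if vr: "(v, r) \<in> graph" for v r
  proof -
    obtain v' where v': "v' \<in> L2" "v = to_l2 v'" by (rule to_l2_cases)
    have "v' \<in> schroedinger_form_domain V" using v' vr domain_iff by blast
    then show ?thesis using eq form_eq_cinner[OF u _ uq(2), of v' r] vr v' f by (simp add: to_l2_cinner)
  qed
  then show "u \<in> L2 \<and> f \<in> L2 \<and> (\<exists>q. (to_l2 u, q) \<in> graph \<and> (\<forall>v r. (v, r) \<in> graph \<longrightarrow> cinner q r = cinner (to_l2 f) v))"
    using uq f by blast
next
  assume *: "u \<in> L2 \<and> f \<in> L2 \<and> (\<exists>q. (to_l2 u, q) \<in> graph \<and> (\<forall>v r. (v, r) \<in> graph \<longrightarrow> cinner q r = cinner (to_l2 f) v))"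
  then obtain q where q: "(to_l2 u, q) \<in> graph" "\<And>v r. (v, r) \<in> graph \<Longrightarrow> cinner q r = cinner (to_l2 f) v" by blast
  have u: "u \<in> schroedinger_form_domain V" using * q domain_iff by blast
  have "schroedinger_form h V u v = L2_inner f v" if v: "v \<in> schroedinger_form_domain V" for v
  proof -
    note g = domain_graph(3,4)[OF v]
    show ?thesis using form_eq_cinner[OF u v q(1) g(2)] q(2)[OF g(2)] g(1) * by (simp add: to_l2_cinner)
  qed
  then show "(u, f) \<in> schroedinger h V" using u * by (auto simp: schroedinger_def form_operator_def)
qed

end

locale schroedinger_system = schroedinger_setting + complete_eigen_system graph
begin

abbreviation T :: L2_operator where "T \<equiv> schroedinger h V"

lemma schroedinger_solves: "(u, f) \<in> T \<longleftrightarrow> u \<in> L2 \<and> f \<in> L2 \<and> solves 0 (to_l2 u) (to_l2 f)"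
  unfolding schroedinger_iff solves_def by simp

lemma solves_shift: "solves z u f \<longleftrightarrow> solves 0 u (f + cscale z u)"
  unfolding solves_def by (simp add: cinner_add_left cinner_cscale_left diff_eq_eq)

lemma schroedinger_solves_shift:
  assumes "u \<in> L2" "g \<in> L2"
  shows "(u, g) \<in> T \<longleftrightarrow> solves z (to_l2 u) (to_l2 (\<lambda>x. g x - z * u x))"
  using assms by (simp add: schroedinger_solves solves_shift[of z] to_l2_cscale to_l2_add L2_diff L2_scale)

lemma in_resolvent_set:
  assumes z: "Re z < c" "\<And>i. i < m \<Longrightarrow> z \<noteq> of_real (\<mu> i)"
  shows "z \<in> resolvent_set T"
  unfolding resolvent_set_def
proof (intro CollectI conjI ballI)
  obtain K where K: "\<And>u f. solves z u f \<Longrightarrow> norm u \<le> K * norm f" using resolvent_bound[OF z] by blast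
  show "\<exists>C. \<forall>(u, g)\<in>T. L2_norm u \<le> C * L2_norm (\<lambda>x. g x - z * u x)"
  proof (intro exI[of _ K] ballI, clarify)
    fix u g assume ug: "(u, g) \<in> T"
    then have L: "u \<in> L2" "g \<in> L2" by (auto simp: schroedinger_solves)
    from K[OF schroedinger_solves_shift[OF L, THEN iffD1, OF ug]]
    show "L2_norm u \<le> K * L2_norm (\<lambda>x. g x - z * u x)" using L by (simp add: norm_to_l2 L2_diff L2_scale)
  qed
  fix f assume f: "f \<in> L2"
  obtain a where a: "solves z a (to_l2 f)" using solvable[OF z] by blast
  obtain u where u: "u \<in> L2" "a = to_l2 u" by (rule to_l2_cases)
  have L: "(\<lambda>x. f x + z * u x) \<in> L2" using f u by (simp add: L2_add L2_scale)
  have "(u, \<lambda>x. f x + z * u x) \<in> T" using a u L by (simp add: schroedinger_solves_shift[of _ _ z])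
  then show "\<exists>(u, g)\<in>T. AE x in lborel. g x - z * u x = f x" by force
qed

lemma eigenspace_iff: "u \<in> eigenspace T z \<longleftrightarrow> u \<in> L2 \<and> solves z (to_l2 u) 0"
proof (cases "u \<in> L2")
  case True
  then show ?thesis
    using schroedinger_solves_shift[OF True L2_scale[OF True], of z z]
    by (simp add: eigenspace_def to_l2_zero[symmetric])
next
  case False
  then show ?thesis by (simp add: eigenspace_def schroedinger_solves)
qed

lemma L2_independent_iff:
  assumes "\<And>i. i < n \<Longrightarrow> us i \<in> L2"
  shows "L2_independent n us \<longleftrightarrow> (\<forall>a. (\<Sum>i<n. cscale (a i) (to_l2 (us i))) = 0 \<longrightarrow> (\<forall>i<n. a i = 0))"
proof -
  have "(AE x in lborel. (\<Sum>i<n. a i * us i x) = 0) \<longleftrightarrow> (\<Sum>i<n. cscale (a i) (to_l2 (us i))) = 0" for a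
  proof -
    have "(\<Sum>i<n. cscale (a i) (to_l2 (us i))) = (\<Sum>i<n. to_l2 (\<lambda>x. a i * us i x))"
      by (intro sum.cong refl) (simp add: to_l2_cscale assms)
    also have "\<dots> = to_l2 (\<lambda>x. \<Sum>i<n. a i * us i x)"
      by (intro to_l2_sum L2_scale assms) simp
    finally show ?thesis
      using to_l2_eq_iff[OF L2_sum[of "{..<n}" "\<lambda>i x. a i * us i x"] L2_zero] assms by (simp add: to_l2_zero L2_scale)
  qed
  then show ?thesis by (simp add: L2_independent_def)
qed

text \<open>The eigenspace is spanned by the \<open>e i\<close> with \<open>\<mu> i = t\<close>, by \<open>eigenvector_expansion\<close>.\<close>

lemma multiplicity_eq:
  assumes t: "t < c"
  shows "multiplicity T (of_real t) = enat (card {i. i < m \<and> \<mu> i = t})"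
proof -
  define B where "B = {i. i < m \<and> \<mu> i = t}"
  have finB: "finite B" by (simp add: B_def)
  obtain f where f: "bij_betw f {..<card B} B" using ex_bij_betw_nat_finite[OF finB] by (auto simp: atLeast0LessThan)
  have fB: "f j < m" "\<mu> (f j) = t" if "j < card B" for j
    using bij_betwE[OF f] that by (auto simp: B_def)
  have finj: "f i = f j \<longleftrightarrow> i = j" if "i < card B" "j < card B" for i j
    using f that by (auto simp: bij_betw_def inj_on_def)
  have upper: "n \<le> card B" if us: "\<forall>i<n. us i \<in> eigenspace T (of_real t)" "L2_independent n us" for n us
  proof (rule ccontr)
    assume "\<not> n \<le> card B"
    then have "card B < n" by simp
    from homogeneous_system_solvable[OF this, of "\<lambda>i j. cinner (to_l2 (us i)) (e (f j))"]
    obtain a where a: "\<exists>i<n. a i \<noteq> 0" "\<And>j. j < card B \<Longrightarrow> (\<Sum>i<n. a i * cinner (to_l2 (us i)) (e (f j))) = 0" by blast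
    have us': "us i \<in> L2" "solves (of_real t) (to_l2 (us i)) 0" if "i < n" for i
      using us that by (auto simp: eigenspace_iff)
    define w where "w = (\<Sum>i<n. cscale (a i) (to_l2 (us i)))"
    have "solves (of_real t) w (\<Sum>i<n. cscale (a i) 0)"
      unfolding w_def by (intro solves_sum solves_cscale us') simp
    then have w: "solves (of_real t) w 0" by (simp add: cscale_def)
    have "cinner w (e b) = 0" if bB: "b \<in> B" for b
    proof -
      have "b \<in> f ` {..<card B}" using bB f by (simp add: bij_betw_def)
      then obtain j where j: "j < card B" "b = f j" by blast
      show ?thesis using a(2)[OF j(1)] by (simp add: w_def cinner_sum_left cinner_cscale_left j)
    qed
    moreover have "w = (\<Sum>i | i < m \<and> complex_of_real (\<mu> i) = of_real t. cscale (cinner w (e i)) (e i))"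
      by (rule eigenvector_expansion[OF w]) (use t in simp)
    moreover have "\<dots> = (\<Sum>i\<in>B. cscale (cinner w (e i)) (e i))" by (simp add: B_def)
    ultimately have "w = (\<Sum>i\<in>B. cscale 0 (e i))" by (metis (no_types, lifting) sum.cong)
    then have "w = 0" by (simp add: cscale_def)
    then show False using us(2) a(1) us'(1) unfolding w_def by (metis L2_independent_iff)
  qed
  have "\<exists>u. u \<in> L2 \<and> e (f j) = to_l2 u" for j by (rule to_l2_cases[of "e (f j)"]) blast
  then obtain us where us: "us j \<in> L2" "e (f j) = to_l2 (us j)" for j by metis
  have "us j \<in> eigenspace T (of_real t)" if "j < card B" for j
    using solves_e[OF fB(1)[OF that]] fB(2)[OF that] us by (simp add: eigenspace_iff)
  moreover have "L2_independent (card B) us"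
  proof (subst L2_independent_iff[OF us(1)], intro allI impI)
    fix a i assume a: "(\<Sum>i<card B. cscale (a i) (to_l2 (us i))) = 0" and i: "i < card B"
    have "0 = cinner (\<Sum>j<card B. cscale (a j) (e (f j))) (e (f i))" using a by (simp add: us(2))
    also have "\<dots> = (\<Sum>j<card B. if j = i then a i else 0)"
      unfolding cinner_sum_left
      by (intro sum.cong refl) (use i in \<open>auto simp: cinner_cscale_left orthonormal fB finj\<close>)
    also have "\<dots> = a i" using i by simp
    finally show "a i = 0" by simp
  qed
  ultimately have lower: "enat (card B) \<in> {enat n | n us. (\<forall>i<n. us i \<in> eigenspace T (of_real t)) \<and> L2_independent n us}"
    by blast
  show ?thesis unfolding multiplicity_def L2_dim_def B_def[symmetric]
    by (rule Sup_eqI) (use lower upper in auto)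
qed

lemma spectrum_below:
  assumes "Re z < c" "z \<in> spectrum T"
  shows "\<exists>i<m. z = of_real (\<mu> i)"
  using in_resolvent_set[OF assms(1)] assms(2) by (auto simp: spectrum_def)

text \<open>In the half-plane to the left of \<open>c\<close> the spectrum is contained in the finite set of the \<open>\<mu> i\<close>, so its
  points are isolated there, also among complex numbers.\<close>

lemma not_essential:
  assumes t: "t < c" shows "complex_of_real t \<notin> essential_spectrum T"
proof
  assume es: "complex_of_real t \<in> essential_spectrum T"
  then have sp: "complex_of_real t \<in> spectrum T" by (simp add: essential_spectrum_def)
  then obtain i where i: "i < m" "\<mu> i = t" using spectrum_below[of "of_real t"] t by auto
  define O1 where "O1 = {z. Re z < c} - (\<lambda>i. complex_of_real (\<mu> i)) ` {i. i < m \<and> \<mu> i \<noteq> t}"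
  have "open O1" unfolding O1_def
    by (intro open_Diff open_Collect_less continuous_intros finite_imp_closed) simp
  moreover have "O1 \<inter> spectrum T = {complex_of_real t}"
  proof -
    have "z = of_real t" if z: "z \<in> O1" "z \<in> spectrum T" for z
    proof -
      from z obtain j where j: "j < m" "z = of_real (\<mu> j)" using spectrum_below[of z] by (auto simp: O1_def)
      then show ?thesis using z(1) by (auto simp: O1_def)
    qed
    moreover have "complex_of_real t \<in> O1" using t by (auto simp: O1_def)
    ultimately show ?thesis using sp by blast
  qed
  ultimately have "complex_of_real t isolated_in spectrum T" using sp by (auto simp: isolated_in_def)
  moreover have "0 < card {i. i < m \<and> \<mu> i = t}" using i by (subst card_gt_0_iff) auto
  ultimately have "complex_of_real t \<in> discrete_spectrum T"
    by (simp add: discrete_spectrum_def multiplicity_eq[OF t] zero_enat_def)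
  then show False using es by (simp add: essential_spectrum_def)
qed

lemma essential_bottom_ge: "ereal c \<le> essential_bottom T"
  unfolding essential_bottom_def
proof (rule Inf_greatest, clarify)
  fix t assume "complex_of_real t \<in> essential_spectrum T"
  then show "ereal c \<le> ereal t" using not_essential[of t] by force
qed

lemma sum_card_fibres:
  assumes "finite F"
  shows "(\<Sum>t\<in>F. card {i. i < m \<and> \<mu> i = t}) = card {i. i < m \<and> \<mu> i \<in> F}"
proof -
  have "{i. i < m \<and> \<mu> i \<in> F} = (\<Union>t\<in>F. {i. i < m \<and> \<mu> i = t})" by auto
  then show ?thesis using assms by (simp add: card_UN_disjoint disjoint_iff)
qed

lemma eigenvalue_count_eq:
  assumes A: "A \<subseteq> {..<c}"
  shows "eigenvalue_count T A = enat (card {i. i < m \<and> \<mu> i \<in> A})"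
  unfolding eigenvalue_count_def
proof (rule SUP_eqI)
  have *: "(\<Sum>t\<in>F. multiplicity T (complex_of_real t)) = enat (card {i. i < m \<and> \<mu> i \<in> F})"
    if F: "finite F" "F \<subseteq> A" for F
  proof -
    have "(\<Sum>t\<in>F. multiplicity T (complex_of_real t)) = (\<Sum>t\<in>F. enat (card {i. i < m \<and> \<mu> i = t}))"
      by (intro sum.cong refl multiplicity_eq) (use F A in auto)
    also have "\<dots> = enat (\<Sum>t\<in>F. card {i. i < m \<and> \<mu> i = t})"
      by (simp add: of_nat_eq_enat[symmetric])
    finally show ?thesis by (simp add: sum_card_fibres[OF F(1)])
  qed
  show "(\<Sum>t\<in>F. multiplicity T (complex_of_real t)) \<le> enat (card {i. i < m \<and> \<mu> i \<in> A})"
    if "F \<in> {F. finite F \<and> F \<subseteq> A}" for F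
    using that by (simp add: *) (rule card_mono, auto)
  fix y assume y: "\<And>F. F \<in> {F. finite F \<and> F \<subseteq> A} \<Longrightarrow> (\<Sum>t\<in>F. multiplicity T (complex_of_real t)) \<le> y"
  define F where "F = \<mu> ` {i. i < m \<and> \<mu> i \<in> A}"
  have F: "finite F" "F \<subseteq> A" by (auto simp: F_def)
  have "{i. i < m \<and> \<mu> i \<in> F} = {i. i < m \<and> \<mu> i \<in> A}" by (auto simp: F_def)
  then show "enat (card {i. i < m \<and> \<mu> i \<in> A}) \<le> y" using y[of F] F by (simp add: *)
qed

text \<open>All \<open>\<mu> i\<close> lie below the essential spectrum, and the number of eigenvalues up to \<open>t\<close> reaches \<open>k\<close> exactly
  at the \<open>k\<close>-th of them. Indices of \<open>\<mu>\<close> start at \<open>0\<close>.\<close>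

theorem kth_eigenvalue_eq:
  assumes k: "1 \<le> k" "k \<le> m"
  shows "kth_eigenvalue k T = ereal (\<mu> (k - 1))"
proof -
  have \<mu>c: "\<mu> (k - 1) < c" using k by (intro \<mu>_less) simp
  have "{i. i < m \<and> \<mu> i \<in> {..<c}} = {..<m}" using \<mu>_less by auto
  then have "enat k \<le> eigenvalue_count T {..<c}" using k by (simp add: eigenvalue_count_eq)
  also have "\<dots> \<le> eigenvalue_count T {t. ereal t < essential_bottom T}"
    unfolding eigenvalue_count_def
  proof (rule SUP_subset_mono)
    have "{..<c} \<subseteq> {t. ereal t < essential_bottom T}"
      by (auto intro: less_le_trans[OF _ essential_bottom_ge])
    then show "{F. finite F \<and> F \<subseteq> {..<c}} \<subseteq> {F. finite F \<and> F \<subseteq> {t. ereal t < essential_bottom T}}" by blast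
  qed simp
  finally have first: "enat k \<le> eigenvalue_count T {t. ereal t < essential_bottom T}" .
  have "Inf {ereal t | t. enat k \<le> eigenvalue_count T {..t}} = ereal (\<mu> (k - 1))"
  proof (rule Inf_eqI)
    fix y assume "y \<in> {ereal t | t. enat k \<le> eigenvalue_count T {..t}}"
    then obtain t where t: "y = ereal t" "enat k \<le> eigenvalue_count T {..t}" by blast
    show "ereal (\<mu> (k - 1)) \<le> y"
    proof (rule ccontr)
      assume "\<not> ?thesis"
      then have lt: "t < \<mu> (k - 1)" using t(1) by simp
      then have "{..t} \<subseteq> {..<c}" using \<mu>c by auto
      then have "k \<le> card {i. i < m \<and> \<mu> i \<in> {..t}}" using t(2) by (simp add: eigenvalue_count_eq)
      also have "\<dots> \<le> card {..<k - 1}"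
      proof (rule card_mono)
        show "{i. i < m \<and> \<mu> i \<in> {..t}} \<subseteq> {..<k - 1}"
        proof
          fix i assume i: "i \<in> {i. i < m \<and> \<mu> i \<in> {..t}}"
          then show "i \<in> {..<k - 1}" using lt mono_\<mu>[of "k - 1" i] by (cases "k - 1 \<le> i") auto
        qed
      qed simp
      finally show False using k by simp
    qed
  next
    fix y assume y: "\<And>x. x \<in> {ereal t | t. enat k \<le> eigenvalue_count T {..t}} \<Longrightarrow> y \<le> x"
    have "{..\<mu> (k - 1)} \<subseteq> {..<c}" using \<mu>c by auto
    moreover have "k \<le> card {i. i < m \<and> \<mu> i \<in> {..\<mu> (k - 1)}}"
    proof -
      have "{..<k} \<subseteq> {i. i < m \<and> \<mu> i \<in> {..\<mu> (k - 1)}}" using k mono_\<mu>[of _ "k - 1"] by auto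
      from card_mono[OF _ this] show ?thesis by simp
    qed
    ultimately have "enat k \<le> eigenvalue_count T {..\<mu> (k - 1)}" by (simp add: eigenvalue_count_eq)
    then show "y \<le> ereal (\<mu> (k - 1))" using y by blast
  qed
  then show ?thesis using first by (simp add: kth_eigenvalue_def)
qed

lemma normalized_eigenvector_phase:
  assumes "i < m" "u \<in> L2" "to_l2 u = cscale a (e i)" "cmod a = 1"
  shows "normalized_eigenvector T (\<mu> i) u"
proof -
  have "solves (of_real (\<mu> i)) (cscale a (e i)) (cscale a 0)" by (rule solves_cscale[OF solves_e[OF assms(1)]])
  then have "u \<in> eigenspace T (of_real (\<mu> i))" using assms by (simp add: eigenspace_iff cscale_def)
  moreover have "L2_norm u = 1"
    using norm_to_l2[OF assms(2)] assms by (simp add: norm_cscale norm_e)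
  ultimately show ?thesis by (simp add: normalized_eigenvector_def)
qed

end

section \<open>Discreteness of the spectrum below the potential at infinity\<close>

lemma L2_sq_set_integrable: "u \<in> L2 \<Longrightarrow> set_integrable lborel {x..y} (\<lambda>t. (cmod (u t))\<^sup>2)"
  unfolding set_integrable_def by (rule integrable_mult_indicator) (auto simp: L2_sq_integrable)

lemma set_integral_Icc_const: "x \<le> y \<Longrightarrow> (LINT t:{x..y}|lborel. (k::real)) = (y - x) * k"
  "set_integrable lborel {x..y} (\<lambda>_. k :: real)"
  by (simp_all add: set_lebesgue_integral_def set_integrable_def emeasure_lborel_Icc_eq)

lemma set_integral_Icc_nodes:
  fixes f :: "real \<Rightarrow> real"
  assumes "\<And>j. j < N \<Longrightarrow> s j \<le> s (Suc j)" and f: "\<And>x y. set_integrable lborel {x..y} f"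
  shows "(LINT t:{s 0..s N}|lborel. f t) = (\<Sum>j<N. LINT t:{s j..s (Suc j)}|lborel. f t)"
  using assms(1)
proof (induction N)
  case 0
  then show ?case
    using set_borel_integral_eq_integral(2)[OF f, of "s 0" "s 0"] integral_refl[of "s 0" f] by simp
next
  case (Suc N)
  have step: "s j \<le> s (Suc j)" if "j \<le> N" for j using Suc.prems that by simp
  have "s 0 \<le> s k" if "k \<le> N" for k
    using that
  proof (induction k)
    case (Suc k)
    then have "s 0 \<le> s k" "s k \<le> s (Suc k)" using step[of k] by simp_all
    then show ?case by simp
  qed simp
  then have le: "s 0 \<le> s N" by blast
  have "integral {s 0..s N} f + integral {s N..s (Suc N)} f = integral {s 0..s (Suc N)} f"
    by (rule Henstock_Kurzweil_Integration.integral_combine)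
      (use le Suc.prems set_borel_integral_eq_integral(1)[OF f] in auto)
  then show ?case using Suc.IH Suc.prems set_borel_integral_eq_integral(2)[OF f] by simp
qed

lemma L2_integral_split_le:
  assumes "u \<in> L2"
  shows "(LINT t:{x..y}|lborel. (cmod (u t))\<^sup>2) \<le> (L2_norm u)\<^sup>2"
proof -
  have "(LINT t:{x..y}|lborel. (cmod (u t))\<^sup>2) \<le> (LINT t|lborel. (cmod (u t))\<^sup>2)"
    unfolding set_lebesgue_integral_def
    by (rule integral_mono) (use L2_sq_set_integrable[OF assms] L2_sq_integrable[OF assms] in
        \<open>auto simp: set_integrable_def split: split_indicator\<close>)
  then show ?thesis by (simp add: L2_norm_def)
qed

lemma set_integral_cinner:
  assumes "u \<in> L2"
  shows "(LINT t:{x..y}|lborel. u t) = cinner (to_l2 u) (to_l2 (indicator {x..y}))"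
  using assms by (simp add: to_l2_cinner indicator_L2 L2_inner_def set_lebesgue_integral_def)
    (rule Bochner_Integration.integral_cong, auto split: split_indicator)

lemma norm_indicator_l2: "x \<le> y \<Longrightarrow> (norm (to_l2 (indicator {x..y::real})))\<^sup>2 = y - x"
proof -
  assume xy: "x \<le> y"
  have "(\<lambda>t. (cmod (indicator {x..y} t))\<^sup>2) = (\<lambda>t. indicat_real {x..y} t)" by (auto split: split_indicator)
  then show ?thesis using xy by (simp add: norm_to_l2 indicator_L2 L2_norm_def)
qed

lemma primitive_Hoelder:
  assumes U: "is_primitive U g" and g: "g \<in> L2" and xy: "x \<le> y"
  shows "(cmod (U y - U x))\<^sup>2 \<le> (y - x) * (LINT t:{x..y}|lborel. (cmod (g t))\<^sup>2)"
proof -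
  define G where "G = (\<lambda>t. indicator {x..y} t * g t)"
  have G: "G \<in> L2" unfolding G_def by (rule L2_indicator[OF g]) simp
  have "U y - U x = (LINT t:{x..y}|lborel. G t)"
    unfolding primitive_diff[OF U xy] set_lebesgue_integral_def G_def
    by (intro Bochner_Integration.integral_cong) (auto split: split_indicator)
  then have "cmod (U y - U x) \<le> norm (to_l2 G) * norm (to_l2 (indicator {x..y}))"
    unfolding set_integral_cinner[OF G] by (metis cmod_cinner_le)
  then have "(cmod (U y - U x))\<^sup>2 \<le> (norm (to_l2 G) * norm (to_l2 (indicator {x..y})))\<^sup>2"
    by (intro power_mono) auto
  also have "\<dots> = (L2_norm G)\<^sup>2 * (y - x)"
    unfolding power_mult_distrib norm_indicator_l2[OF xy] by (simp add: norm_to_l2 G)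
  also have "(L2_norm G)\<^sup>2 = (LINT t:{x..y}|lborel. (cmod (g t))\<^sup>2)"
    unfolding set_lebesgue_integral_def L2_norm_def G_def
    by (simp add: norm_mult power_mult_distrib) (rule Bochner_Integration.integral_cong, auto split: split_indicator)
  finally show ?thesis by (simp add: mult.commute)
qed

lemma primitive_oscillation:
  assumes U: "is_primitive U g" and g: "g \<in> L2" and "s \<in> {x..y}" "t \<in> {x..y}"
  shows "(cmod (U t - U s))\<^sup>2 \<le> (y - x) * (LINT t:{x..y}|lborel. (cmod (g t))\<^sup>2)"
proof -
  have *: "(cmod (U b - U a))\<^sup>2 \<le> (y - x) * (LINT t:{x..y}|lborel. (cmod (g t))\<^sup>2)"
    if "a \<in> {x..y}" "b \<in> {x..y}" "a \<le> b" for a b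
  proof -
    have mono: "(LINT t:{a..b}|lborel. (cmod (g t))\<^sup>2) \<le> (LINT t:{x..y}|lborel. (cmod (g t))\<^sup>2)"
      unfolding set_lebesgue_integral_def
      by (rule integral_mono) (use L2_sq_set_integrable[OF g] that in \<open>auto simp: set_integrable_def split: split_indicator\<close>)
    have "0 \<le> (LINT t:{x..y}|lborel. (cmod (g t))\<^sup>2)"
      unfolding set_lebesgue_integral_def by (intro integral_nonneg_AE) auto
    then show ?thesis
      using primitive_Hoelder[OF U g that(3)] mono that
        mult_mono[of "b - a" "y - x" "LINT t:{a..b}|lborel. (cmod (g t))\<^sup>2" "LINT t:{x..y}|lborel. (cmod (g t))\<^sup>2"]
      by (auto simp: set_lebesgue_integral_def intro: integral_nonneg_AE)
  qed
  show ?thesis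
    using *[of s t] *[of t s] assms(3,4) by (cases "s \<le> t") (auto simp: norm_minus_commute)
qed

text \<open>By the Cauchy--Schwarz inequality \<open>U\<close> differs from its mean value by at most the square root of
  \<open>(y - x)\<close> times the kinetic energy.\<close>

lemma Poincare_interval:
  assumes U: "is_primitive U g" and L: "U \<in> L2" "g \<in> L2" and xy: "x < y"
  shows "(LINT t:{x..y}|lborel. (cmod (U t))\<^sup>2)
    \<le> 2 * (y - x)\<^sup>2 * (LINT t:{x..y}|lborel. (cmod (g t))\<^sup>2) + 2 / (y - x) * (cmod (LINT t:{x..y}|lborel. U t))\<^sup>2"
proof -
  define D where "D = (LINT t:{x..y}|lborel. (cmod (g t))\<^sup>2)"
  define l where "l = y - x"
  define I where "I = (LINT t:{x..y}|lborel. U t)"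
  define K where "K = sqrt (l * D)"
  have l: "l > 0" using xy by (simp add: l_def)
  have D0: "0 \<le> D" unfolding D_def set_lebesgue_integral_def by (intro integral_nonneg_AE) auto
  have K2: "K\<^sup>2 = l * D" using l D0 by (simp add: K_def)
  have K: "cmod (U t - U s) \<le> K" if "s \<in> {x..y}" "t \<in> {x..y}" for s t
    using primitive_oscillation[OF U L(2) that] real_le_rsqrt by (simp add: K_def l_def D_def)
  have pointwise: "(cmod (U t))\<^sup>2 \<le> 2 * (l * D) + 2 * ((cmod I)\<^sup>2 / l\<^sup>2)" if t: "t \<in> {x..y}" for t
  proof -
    have loc: "set_integrable lborel {x..y} U" by (rule locally_integrableD[OF L2_locally_integrable[OF L(1)]])
    have "(LINT s:{x..y}|lborel. U t) = of_real l * U t"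
      using xy by (simp add: set_lebesgue_integral_def l_def scaleR_conv_of_real)
    moreover have c: "set_integrable lborel {x..y} (\<lambda>_. U t)"
      by (intro borel_integrable_atLeastAtMost' continuous_intros)
    ultimately have eq: "of_real l * U t - I = (LINT s:{x..y}|lborel. U t - U s)"
      using set_integral_diff(2)[OF c loc] by (simp add: I_def)
    have "cmod (of_real l * U t - I) \<le> (LINT s:{x..y}|lborel. cmod (U t - U s))"
      unfolding eq by (rule set_integral_norm_bound) (rule set_integral_diff(1)[OF c loc])
    also have "\<dots> \<le> (LINT s:{x..y}|lborel. K)"
      by (rule set_integral_mono)
        (use K[OF _ t] set_integral_Icc_const(2) set_integrable_norm[OF set_integral_diff(1)[OF c loc]] in auto)
    also have "\<dots> = l * K" using xy by (simp add: set_integral_Icc_const l_def)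
    finally have "cmod (of_real l * U t - I) / l \<le> K" using l by (simp add: field_simps)
    moreover have "cmod (of_real l * U t - I) / l = cmod (U t - I / of_real l)"
    proof -
      have "U t - I / of_real l = (of_real l * U t - I) / of_real l" using l by (simp add: field_simps)
      then show ?thesis using l by (simp add: norm_divide)
    qed
    ultimately have "(cmod (U t - I / of_real l))\<^sup>2 \<le> l * D" unfolding K2[symmetric] by (intro power_mono) auto
    moreover have "(cmod (U t))\<^sup>2 \<le> 2 * (cmod (U t - I / of_real l))\<^sup>2 + 2 * (cmod (I / of_real l))\<^sup>2"
      using cmod_add_sq_le[of "U t - I / of_real l" "I / of_real l"] by simp
    moreover have "(cmod (I / of_real l))\<^sup>2 = (cmod I)\<^sup>2 / l\<^sup>2" using l by (simp add: norm_divide power_divide)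
    ultimately show ?thesis by linarith
  qed
  have "(LINT t:{x..y}|lborel. (cmod (U t))\<^sup>2) \<le> (LINT t:{x..y}|lborel. 2 * (l * D) + 2 * ((cmod I)\<^sup>2 / l\<^sup>2))"
    by (intro set_integral_mono L2_sq_set_integrable L set_integral_Icc_const(2) pointwise)
  also have "\<dots> = l * (2 * (l * D) + 2 * ((cmod I)\<^sup>2 / l\<^sup>2))"
    by (simp only: set_integral_Icc_const(1)[OF less_imp_le[OF xy]] l_def)
  also have "\<dots> = 2 * l\<^sup>2 * D + 2 / l * (cmod I)\<^sup>2" using l by (simp add: field_simps power2_eq_square)
  finally show ?thesis by (simp add: l_def D_def I_def)
qed

context schroedinger_setting
begin

text \<open>Outside \<open>[-R, R]\<close> the potential alone is at least \<open>c0\<close>. The interval \<open>[-R, R]\<close> is cut into pieces so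
  short that on each of them the kinetic energy controls the function up to its mean value; the mean
  values are the finite-rank term.\<close>

lemma finite_rank:
  assumes far: "\<And>x. \<bar>x\<bar> \<ge> R \<Longrightarrow> c0 \<le> V x" and R: "R > 0" and c0: "c0 > 0"
  shows "\<exists>C S. finite_rank_form graph c0 C S"
proof -
  obtain N0 :: nat where N0: "8 * R\<^sup>2 * c0 / h\<^sup>2 < real N0" using reals_Archimedean2 by blast
  define N where "N = Suc N0"
  define l where "l = 2 * R / real N"
  have N: "real N \<ge> 1" "8 * R\<^sup>2 * c0 / h\<^sup>2 \<le> real N" using N0 by (auto simp: N_def)
  have l: "l > 0" using R N by (simp add: l_def)
  have lc: "2 * l\<^sup>2 * c0 \<le> h\<^sup>2"
  proof -
    have "8 * R\<^sup>2 * c0 \<le> h\<^sup>2 * real N" using N(2) h by (simp add: field_simps)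
    also have "\<dots> \<le> h\<^sup>2 * (real N)\<^sup>2" using N(1) self_le_power[of "real N" 2] by (intro mult_left_mono) auto
    finally show ?thesis using N(1) by (simp add: l_def field_simps power2_eq_square)
  qed
  define s where "s j = - R + real j * l" for j :: nat
  have s: "s 0 = -R" "s N = R" "s j < s (Suc j)" "s (Suc j) - s j = l" for j
  proof -
    have "real N * l = 2 * R" using N by (simp add: l_def)
    then show "s N = R" by (simp add: s_def)
  qed (use l in \<open>auto simp: s_def algebra_simps\<close>)
  define \<gamma> where "\<gamma> j = to_l2 (indicator {s j..s (Suc j)})" for j
  define S where "S = \<gamma> ` {..<N} \<union> (\<lambda>j. J (\<gamma> j)) ` {..<N}"
  have finS: "finite S" by (simp add: S_def)
  \<comment> \<open>\<open>S\<close> is a set, so equal vectors are counted once; hence each mean value is bounded by the whole sum, which costs the factor \<open>2 N\<close>\<close>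
  define C where "C = 2 * c0 / l * (2 * real N)"
  have C0: "0 \<le> C" using c0 l by (simp add: C_def)
  have "finite_rank_form graph c0 C S"
  proof (unfold_locales, rule finS, rule C0)
    fix a q assume aq: "(a, q) \<in> graph"
    obtain U g where U: "is_primitive U g" "U \<in> L2" "g \<in> L2" "sqrt_potential_mult V U \<in> L2" "a = to_l2 U"
      "q = (to_l2 (\<lambda>x. of_real h * g x), to_l2 (sqrt_potential_mult V U))" using aq by (rule graph_cases)
    define Q where "Q = (\<Sum>g\<in>S. (a \<bullet> g)\<^sup>2)"
    have Qle: "(a \<bullet> g)\<^sup>2 \<le> Q" if "g \<in> S" for g
      unfolding Q_def using that finS by (intro member_le_sum) auto
    have avg: "(cmod (LINT t:{s j..s (Suc j)}|lborel. U t))\<^sup>2 \<le> 2 * Q" if "j < N" for j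
    proof -
      have "(cmod (cinner a (\<gamma> j)))\<^sup>2 = (a \<bullet> \<gamma> j)\<^sup>2 + (a \<bullet> J (\<gamma> j))\<^sup>2"
        by (simp add: cmod_power2 Im_cinner)
      also have "\<dots> \<le> Q + Q" by (intro add_mono Qle) (use that in \<open>auto simp: S_def\<close>)
      finally show ?thesis unfolding set_integral_cinner[OF U(2)] \<gamma>_def[symmetric] U(5)[symmetric] by simp
    qed
    have "(LINT t:{-R..R}|lborel. (cmod (U t))\<^sup>2) = (\<Sum>j<N. LINT t:{s j..s (Suc j)}|lborel. (cmod (U t))\<^sup>2)"
      using set_integral_Icc_nodes[of N s "\<lambda>t. (cmod (U t))\<^sup>2"] s L2_sq_set_integrable[OF U(2)] less_imp_le by metis
    also have "\<dots> \<le> (\<Sum>j<N. 2 * l\<^sup>2 * (LINT t:{s j..s (Suc j)}|lborel. (cmod (g t))\<^sup>2) + 2 / l * (2 * Q))"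
    proof (intro sum_mono)
      fix j assume "j \<in> {..<N}"
      then have "2 / l * (cmod (LINT t:{s j..s (Suc j)}|lborel. U t))\<^sup>2 \<le> 2 / l * (2 * Q)"
        using l by (intro mult_left_mono avg) auto
      then show "(LINT t:{s j..s (Suc j)}|lborel. (cmod (U t))\<^sup>2)
          \<le> 2 * l\<^sup>2 * (LINT t:{s j..s (Suc j)}|lborel. (cmod (g t))\<^sup>2) + 2 / l * (2 * Q)"
        using Poincare_interval[OF U(1-3) s(3)[of j]] unfolding s(4) by linarith
    qed
    also have "\<dots> = 2 * l\<^sup>2 * (\<Sum>j<N. LINT t:{s j..s (Suc j)}|lborel. (cmod (g t))\<^sup>2) + real N * (2 / l * (2 * Q))"
      by (simp add: sum.distrib sum_distrib_left)
    also have "(\<Sum>j<N. LINT t:{s j..s (Suc j)}|lborel. (cmod (g t))\<^sup>2) = (LINT t:{-R..R}|lborel. (cmod (g t))\<^sup>2)"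
      using set_integral_Icc_nodes[of N s "\<lambda>t. (cmod (g t))\<^sup>2"] s L2_sq_set_integrable[OF U(3)] less_imp_le by metis
    finally have "c0 * (LINT t:{-R..R}|lborel. (cmod (U t))\<^sup>2)
        \<le> c0 * (2 * l\<^sup>2 * (LINT t:{-R..R}|lborel. (cmod (g t))\<^sup>2) + real N * (2 / l * (2 * Q)))"
      using c0 by (intro mult_left_mono) auto
    also have "\<dots> = (2 * l\<^sup>2 * c0) * (LINT t:{-R..R}|lborel. (cmod (g t))\<^sup>2) + C * Q"
      by (simp add: C_def algebra_simps)
    also have "\<dots> \<le> h\<^sup>2 * (L2_norm g)\<^sup>2 + C * Q"
    proof (intro add_right_mono mult_mono lc L2_integral_split_le U)
      show "0 \<le> (LINT t:{-R..R}|lborel. (cmod (g t))\<^sup>2)"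
        unfolding set_lebesgue_integral_def by (intro integral_nonneg_AE) auto
    qed auto
    finally have inner: "c0 * (LINT t:{-R..R}|lborel. (cmod (U t))\<^sup>2) \<le> h\<^sup>2 * (L2_norm g)\<^sup>2 + C * Q" .
    have "c0 * (L2_norm U)\<^sup>2 = (LINT t|lborel. c0 * (cmod (U t))\<^sup>2)" by (simp add: L2_norm_def)
    also have "\<dots> \<le> (LINT t|lborel. (cmod (sqrt_potential_mult V U t))\<^sup>2 + c0 * (indicat_real {-R..R} t *\<^sub>R (cmod (U t))\<^sup>2))"
    proof (rule integral_mono)
      fix t
      have eq: "(cmod (sqrt_potential_mult V U t))\<^sup>2 = V t * (cmod (U t))\<^sup>2"
        using V_nonneg[of t] by (simp add: sqrt_potential_mult_def norm_mult power_mult_distrib)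
      show "c0 * (cmod (U t))\<^sup>2 \<le> (cmod (sqrt_potential_mult V U t))\<^sup>2 + c0 * (indicat_real {-R..R} t *\<^sub>R (cmod (U t))\<^sup>2)"
      proof (cases "t \<in> {-R..R}")
        case True then show ?thesis by simp
      next
        case False
        then have "\<bar>t\<bar> \<ge> R" by auto
        then show ?thesis using False far[of t] unfolding eq by (simp add: mult_right_mono)
      qed
    qed (use L2_sq_integrable[OF U(2)] L2_sq_integrable[OF U(4)] L2_sq_set_integrable[OF U(2)] in
        \<open>auto simp: set_integrable_def\<close>)
    also have "\<dots> = (L2_norm (sqrt_potential_mult V U))\<^sup>2 + c0 * (LINT t:{-R..R}|lborel. (cmod (U t))\<^sup>2)"
      using L2_sq_integrable[OF U(4)] L2_sq_set_integrable[OF U(2)]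
      by (simp add: set_integrable_def set_lebesgue_integral_def L2_norm_def)
    finally have "c0 * (L2_norm U)\<^sup>2 \<le> (h\<^sup>2 * (L2_norm g)\<^sup>2 + (L2_norm (sqrt_potential_mult V U))\<^sup>2) + C * Q"
      using inner by linarith
    then show "c0 * (norm a)\<^sup>2 \<le> (norm q)\<^sup>2 + C * (\<Sum>g\<in>S. (a \<bullet> g)\<^sup>2)"
      unfolding U(5,6) norm_graph[OF U(3,4)] Q_def[symmetric, unfolded U(5)] by (simp add: norm_to_l2 U(2) Q_def U(5))
  qed
  then show ?thesis by blast
qed

lemma schroedinger_system_exists:
  assumes far: "\<And>x. \<bar>x\<bar> \<ge> R \<Longrightarrow> c0 \<le> V x" and R: "R > 0" and c: "0 \<le> c" "c < c0"
  shows "\<exists>m e p \<mu>. schroedinger_system h V c m e p \<mu>"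
proof -
  obtain C S where "finite_rank_form graph c0 C S" using finite_rank[OF far R] c by auto
  then interpret finite_rank_form graph c0 C S .
  obtain m e p \<mu> where es: "eigen_system c m e p \<mu>" "\<And>i j. i \<le> j \<Longrightarrow> j < m \<Longrightarrow> \<mu> i \<le> \<mu> j"
    "\<And>u r. (u, r) \<in> orth_G m e \<Longrightarrow> c * (norm u)\<^sup>2 \<le> (norm r)\<^sup>2"
    using complete_eigen_system_exists[OF c(2)] by metis
  have "schroedinger_system h V c m e p \<mu>"
    by unfold_locales (use es c in auto)
  then show ?thesis by blast
qed

end

section \<open>The edges of the well\<close>

locale flat_well =
  fixes V :: "real \<Rightarrow> real"
  assumes continuous: "continuous_on UNIV V" and nonneg: "0 \<le> V x"
    and liminf: "Liminf at_infinity (\<lambda>x. ereal (V x)) > 0"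
    and zero_set: "V -` {0} = {0}"
    and monotone: "\<exists>\<epsilon>>0. strict_mono_on {0<..<\<epsilon>} (\<lambda>x. V x / \<bar>x\<bar> ^ n) \<and>
           strict_antimono_on {-\<epsilon><..<0} (\<lambda>x. V x / \<bar>x\<bar> ^ n)"
begin

lemma V_0: "V 0 = 0" and V_pos: "x \<noteq> 0 \<Longrightarrow> 0 < V x"
  using zero_set nonneg[of x] by (auto simp: vimage_def set_eq_iff order_less_le)

lemma coercive: "\<exists>R c0. R > 0 \<and> c0 > 0 \<and> (\<forall>x. \<bar>x\<bar> \<ge> R \<longrightarrow> c0 \<le> V x)"
proof -
  obtain y where y: "0 < y" "y < Liminf at_infinity (\<lambda>x. ereal (V x))" using dense[OF liminf] by blast
  obtain c where c: "y = ereal c"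
    using y by (cases y) auto
  have "\<forall>\<^sub>F x in at_infinity. y < ereal (V x)" using less_LiminfD[OF y(2)] .
  then obtain b where b: "\<And>x. norm x \<ge> b \<Longrightarrow> c < V x" by (auto simp: eventually_at_infinity c)
  then show ?thesis using y(1) c
    by (intro exI[of _ "max b 1"] exI[of _ c]) (auto intro: less_imp_le)
qed

lemma away_from_zero: assumes r: "r > 0" shows "\<exists>m0>0. \<forall>x. \<bar>x\<bar> \<ge> r \<longrightarrow> m0 \<le> V x"
proof -
  obtain R c0 where R: "R > 0" "c0 > 0" "\<And>x. \<bar>x\<bar> \<ge> R \<Longrightarrow> c0 \<le> V x" using coercive by blast
  define K where "K = {-R..R} \<inter> {x. r \<le> \<bar>x\<bar>}"
  have "compact K" unfolding K_def
    by (intro compact_Int_closed compact_Icc closed_Collect_le continuous_intros)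
  show ?thesis
  proof (cases "K = {}")
    case True
    then have "\<bar>x\<bar> \<ge> R" if "\<bar>x\<bar> \<ge> r" for x using that by (auto simp: K_def set_eq_iff not_le abs_le_iff)
    then show ?thesis using R by blast
  next
    case False
    then obtain z where z: "z \<in> K" "\<And>x. x \<in> K \<Longrightarrow> V z \<le> V x"
      using continuous_attains_inf[OF \<open>compact K\<close> False continuous_on_subset[OF continuous]] by blast
    have "V z > 0" using z(1) r by (intro V_pos) (auto simp: K_def)
    moreover have "min c0 (V z) \<le> V x" if "\<bar>x\<bar> \<ge> r" for x
    proof (cases "\<bar>x\<bar> \<ge> R")
      case False
      then have "x \<in> K" using that unfolding K_def by simp linarith
      then show ?thesis using z(2) by (simp add: min_le_iff_disj)
    qed (use R(3) in \<open>simp add: min_le_iff_disj\<close>)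
    ultimately show ?thesis using R(2) by (intro exI[of _ "min c0 (V z)"]) auto
  qed
qed

lemma ratio_monotone:
  obtains r where "r > 0" "\<And>x y. 0 < x \<Longrightarrow> x < y \<Longrightarrow> y < r \<Longrightarrow> V x / x ^ n < V y / y ^ n"
    "\<And>x y. 0 < x \<Longrightarrow> x < y \<Longrightarrow> y < r \<Longrightarrow> V (- x) / x ^ n < V (- y) / y ^ n"
proof -
  obtain r where r: "r > 0" "strict_mono_on {0<..<r} (\<lambda>x. V x / \<bar>x\<bar> ^ n)"
    "strict_antimono_on {-r<..<0} (\<lambda>x. V x / \<bar>x\<bar> ^ n)" using monotone by blast
  show ?thesis
  proof (rule that[OF r(1)])
    show "V x / x ^ n < V y / y ^ n" if "0 < x" "x < y" "y < r" for x y
      using strict_mono_onD[OF r(2), of x y] that by auto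
    show "V (- x) / x ^ n < V (- y) / y ^ n" if "0 < x" "x < y" "y < r" for x y
      using monotone_onD[OF r(3), of "-y" "-x"] that by auto
  qed
qed

lemma strictly_monotone:
  obtains r where "r > 0" "\<And>x y. 0 \<le> x \<Longrightarrow> x < y \<Longrightarrow> y < r \<Longrightarrow> V x < V y"
    "\<And>x y. 0 \<le> x \<Longrightarrow> x < y \<Longrightarrow> y < r \<Longrightarrow> V (- x) < V (- y)"
proof -
  obtain r where r: "r > 0" "\<And>x y. 0 < x \<Longrightarrow> x < y \<Longrightarrow> y < r \<Longrightarrow> V x / x ^ 0 < V y / y ^ 0"
    "\<And>x y. 0 < x \<Longrightarrow> x < y \<Longrightarrow> y < r \<Longrightarrow> V (- x) / x ^ 0 < V (- y) / y ^ 0"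
    using ratio_monotone[of 0] by metis
  show ?thesis
  proof (rule that[OF r(1)])
    show "V x < V y" if "0 \<le> x" "x < y" "y < r" for x y
      using r(2)[of x y] that V_0 V_pos[of y] by (cases "x = 0") auto
    show "V (- x) < V (- y)" if "0 \<le> x" "x < y" "y < r" for x y
      using r(3)[of x y] that V_0 V_pos[of "-y"] by (cases "x = 0") auto
  qed
qed

text \<open>Away from \<open>0\<close> the potential is bounded below, so an edge there would make \<open>V b * (b - a)\<^sup>2\<close> larger than
  \<open>h\<^sup>2\<close>. This excludes further solutions far from \<open>0\<close>.\<close>

lemma well_edges_near_zero:
  assumes r: "r > 0"
  shows "\<forall>\<^sub>F h in at_right 0. \<forall>a b. well_edges V h (a, b) \<longrightarrow> - r < a \<and> b < r"
proof -
  obtain m0 where m0: "m0 > 0" "\<And>x. \<bar>x\<bar> \<ge> r \<Longrightarrow> m0 \<le> V x" using away_from_zero[OF r] by blast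
  define h0 where "h0 = sqrt (m0 * r\<^sup>2)"
  have h0: "h0 > 0" using m0 r by (simp add: h0_def)
  have "- r < a \<and> b < r" if h: "0 < h" "h < h0" and w: "well_edges V h (a, b)" for h a b
  proof (rule ccontr)
    assume *: "\<not> (- r < a \<and> b < r)"
    have ab: "a < 0" "0 < b" and V: "V a = h\<^sup>2 / (b - a)\<^sup>2" "V b = h\<^sup>2 / (b - a)\<^sup>2" using w by (auto simp: well_edges_def)
    have "m0 \<le> V a \<or> m0 \<le> V b" using * ab m0(2)[of a] m0(2)[of b] by auto
    then have "m0 \<le> h\<^sup>2 / (b - a)\<^sup>2" using V by simp
    then have "m0 * (b - a)\<^sup>2 \<le> h\<^sup>2" using ab by (simp add: field_simps)
    moreover have "m0 * r\<^sup>2 \<le> m0 * (b - a)\<^sup>2"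
      using * ab m0(1) r by (intro mult_left_mono power_mono) auto
    moreover have "h\<^sup>2 < m0 * r\<^sup>2"
    proof -
      have "h\<^sup>2 < h0\<^sup>2" using h by (intro power_strict_mono) auto
      then show ?thesis using m0(1) by (simp add: h0_def)
    qed
    ultimately show False by linarith
  qed
  then show ?thesis using h0 by (auto simp: eventually_at_right_field intro!: exI[of _ h0])
qed

text \<open>A higher level has both edges farther out, so \<open>V b * (b - a)\<^sup>2\<close> increases strictly with the level.\<close>

lemma well_edges_unique_eventually:
  "\<forall>\<^sub>F h in at_right 0. \<forall>p p'. well_edges V h p \<longrightarrow> well_edges V h p' \<longrightarrow> p = p'"
proof -
  obtain r where r: "r > 0" "\<And>x y. 0 \<le> x \<Longrightarrow> x < y \<Longrightarrow> y < r \<Longrightarrow> V x < V y"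
    "\<And>x y. 0 \<le> x \<Longrightarrow> x < y \<Longrightarrow> y < r \<Longrightarrow> V (- x) < V (- y)" using strictly_monotone by metis
  have key: False if w: "well_edges V h (a, b)" "well_edges V h (a', b')" and lt: "V b < V b'"
      and near: "- r < a" "b < r" "- r < a'" "b' < r" for h a b a' b'
  proof -
    have ab: "a < 0" "0 < b" "V a = h\<^sup>2 / (b - a)\<^sup>2" "V b = h\<^sup>2 / (b - a)\<^sup>2"
      and ab': "a' < 0" "0 < b'" "V a' = h\<^sup>2 / (b' - a')\<^sup>2" "V b' = h\<^sup>2 / (b' - a')\<^sup>2"
      using w by (auto simp: well_edges_def)
    have "b < b'" using r(2)[of b' b] lt ab(2) ab'(2) near by (cases b b' rule: linorder_cases) auto
    moreover have "a' < a" 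
    proof (rule ccontr)
      assume "\<not> a' < a"
      then consider "a = a'" | "a < a'" by linarith
      then have "V a' \<le> V a" using r(3)[of "-a'" "-a"] ab(1) ab'(1) near by cases auto
      then show False using lt ab(3,4) ab'(3,4) by simp
    qed
    ultimately have "(b - a)\<^sup>2 \<le> (b' - a')\<^sup>2" using ab ab' by (intro power_mono) auto
    then have "h\<^sup>2 / (b' - a')\<^sup>2 \<le> h\<^sup>2 / (b - a)\<^sup>2" using ab(1,2) ab'(1,2) by (intro divide_left_mono mult_pos_pos zero_less_power) auto
    then show False using lt ab ab' by simp
  qed
  show ?thesis using well_edges_near_zero[OF r(1)]
  proof eventually_elim
    fix h assume near: "\<forall>a b. well_edges V h (a, b) \<longrightarrow> - r < a \<and> b < r"
    have "(a, b) = (a', b')" if w: "well_edges V h (a, b)" "well_edges V h (a', b')" for a b a' b'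
    proof -
      have n: "- r < a" "b < r" "- r < a'" "b' < r" using near w by auto
      have eq: "V b = V b'"
        using key[OF w _ n] key[OF w(2,1) _ n(3,4,1,2)] by (meson linorder_neqE)
      have ab: "a < 0" "0 < b" "V a = V b" and ab': "a' < 0" "0 < b'" "V a' = V b'"
        using w by (auto simp: well_edges_def)
      have "b = b'" using r(2)[of b b'] r(2)[of b' b] eq ab ab' n by (cases b b' rule: linorder_cases) auto
      moreover have "a = a'" using r(3)[of "-a" "-a'"] r(3)[of "-a'" "-a"] eq ab ab' n
        by (cases a a' rule: linorder_cases) auto
      ultimately show ?thesis by simp
    qed
    then show "\<forall>p p'. well_edges V h p \<longrightarrow> well_edges V h p' \<longrightarrow> p = p'" by auto
  qed
qed

text \<open>With \<open>\<beta>\<close> and \<open>- \<alpha>\<close> the inverses of \<open>V\<close> on the two sides of \<open>0\<close>, the level \<open>s\<close> of the well solves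
  \<open>s * (\<beta> s + \<alpha> s)\<^sup>2 = h\<^sup>2\<close>; the intermediate value theorem applies.\<close>

lemma well_edges_exist_eventually: "\<forall>\<^sub>F h in at_right 0. \<exists>p. well_edges V h p"
proof -
  obtain r where r: "r > 0" "\<And>x y. 0 \<le> x \<Longrightarrow> x < y \<Longrightarrow> y < r \<Longrightarrow> V x < V y"
    "\<And>x y. 0 \<le> x \<Longrightarrow> x < y \<Longrightarrow> y < r \<Longrightarrow> V (- x) < V (- y)" using strictly_monotone by metis
  define q where "q = r / 2"
  have q: "0 < q" "q < r" using r(1) by (auto simp: q_def)
  define W where "W x = V (- x)" for x
  have cV: "continuous_on {0..q} V" using continuous continuous_on_subset by blast
  have cW: "continuous_on {0..q} W" unfolding W_def
    by (rule continuous_on_compose2[OF continuous]) (auto intro!: continuous_intros)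
  have inj: "inj_on V {0..q}" "inj_on W {0..q}"
    by (rule linorder_inj_onI; use r(2,3) q in \<open>force simp: W_def\<close>)+
  define s0 where "s0 = min (V q) (W q)"
  have s0: "s0 > 0" using V_pos[of q] V_pos[of "-q"] q by (simp add: s0_def W_def)
  define \<beta> where "\<beta> = the_inv_into {0..q} V"
  define \<alpha> where "\<alpha> = the_inv_into {0..q} W"
  have imV: "{0..s0} \<subseteq> V ` {0..q}" and imW: "{0..s0} \<subseteq> W ` {0..q}"
  proof -
    show "{0..s0} \<subseteq> V ` {0..q}"
    proof
      fix y assume "y \<in> {0..s0}"
      then show "y \<in> V ` {0..q}" using IVT'[of V 0 y q] q cV V_0 by (force simp: s0_def)
    qed
    show "{0..s0} \<subseteq> W ` {0..q}"
    proof
      fix y assume "y \<in> {0..s0}"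
      then show "y \<in> W ` {0..q}" using IVT'[of W 0 y q] q cW V_0 by (force simp: s0_def W_def)
    qed
  qed
  have c\<beta>: "continuous_on {0..s0} \<beta>"
    by (rule continuous_on_subset[OF continuous_on_inv[OF cV compact_Icc, of \<beta>] imV])
      (auto simp: \<beta>_def the_inv_into_f_f[OF inj(1)])
  have c\<alpha>: "continuous_on {0..s0} \<alpha>"
    by (rule continuous_on_subset[OF continuous_on_inv[OF cW compact_Icc, of \<alpha>] imW])
      (auto simp: \<alpha>_def the_inv_into_f_f[OF inj(2)])
  have \<beta>: "V (\<beta> s) = s" "\<beta> s \<in> {0..q}" and \<alpha>: "V (- \<alpha> s) = s" "\<alpha> s \<in> {0..q}" if "s \<in> {0..s0}" for s
    using that imV imW f_the_inv_into_f[OF inj(1), of s] f_the_inv_into_f[OF inj(2), of s]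
      the_inv_into_into[OF inj(1), of s "{0..q}"] the_inv_into_into[OF inj(2), of s "{0..q}"]
    by (auto simp: \<beta>_def \<alpha>_def W_def)
  define F where "F s = s * (\<beta> s + \<alpha> s)\<^sup>2" for s
  have cF: "continuous_on {0..s0} F" unfolding F_def by (intro continuous_intros c\<beta> c\<alpha>)
  have pos: "\<beta> s > 0" "\<alpha> s > 0" if "s \<in> {0..s0}" "s > 0" for s
    using \<beta>[OF that(1)] \<alpha>[OF that(1)] that(2) V_0 by (auto simp: order_less_le)
  define h0 where "h0 = sqrt (F s0)"
  have Fs0: "F s0 > 0" using pos[of s0] s0 by (simp add: F_def)
  have "\<exists>p. well_edges V h p" if h: "0 < h" "h < h0" for h
  proof -
    have "h\<^sup>2 \<le> h0\<^sup>2" using h by (intro power_mono) auto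
    then have "h\<^sup>2 \<le> F s0" using Fs0 by (simp add: h0_def)
    moreover have "F 0 \<le> h\<^sup>2" by (simp add: F_def)
    ultimately obtain s where s: "0 \<le> s" "s \<le> s0" "F s = h\<^sup>2" using IVT'[of F 0 "h\<^sup>2" s0] s0 cF by auto
    have "s \<noteq> 0" using s(3) h by (auto simp: F_def)
    then have s': "s \<in> {0..s0}" "s > 0" using s by auto
    have "(\<beta> s + \<alpha> s)\<^sup>2 > 0" using pos[OF s'] by simp
    then have "s = h\<^sup>2 / (\<beta> s - (- \<alpha> s))\<^sup>2" using s(3) by (simp add: F_def field_simps)
    then have "well_edges V h (- \<alpha> s, \<beta> s)" using pos[OF s'] \<beta>(1)[OF s'(1)] \<alpha>(1)[OF s'(1)] by (simp add: well_edges_def)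
    then show ?thesis by blast
  qed
  moreover have "h0 > 0" using Fs0 by (simp add: h0_def)
  ultimately show ?thesis unfolding eventually_at_right_field by blast
qed

lemma well_edges_unique_existence: "\<forall>\<^sub>F h in at_right 0. \<exists>!p. well_edges V h p"
  using well_edges_exist_eventually well_edges_unique_eventually by eventually_elim blast

text \<open>Monotonicity of \<open>W x / x ^ n\<close> compares values at points whose ratio is at least \<open>1 + \<eta>\<close>, or at most
  \<open>1 - \<eta>\<close>. Moving by \<open>\<eta> * l\<close> achieves this ratio since \<open>b \<le> l\<close>.\<close>

lemma one_sided_growth:
  assumes mono: "\<And>x y. 0 < x \<Longrightarrow> x < y \<Longrightarrow> y < r \<Longrightarrow> W x / x ^ n < (W y :: real) / y ^ n"
    and W: "\<And>x. 0 \<le> W x" and b: "0 < b" "b < r" "b \<le> l" and \<eta>: "0 < \<eta>"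
  shows "b + \<eta> * l \<le> x \<Longrightarrow> x < r \<Longrightarrow> W b * (1 + \<eta>) ^ n \<le> W x"
    and "0 < x \<Longrightarrow> x \<le> b - \<eta> * l \<Longrightarrow> W x \<le> W b * (1 - \<eta>) ^ n"
proof -
  have \<eta>b: "\<eta> * b \<le> \<eta> * l" using b \<eta> by simp
  have \<eta>b0: "0 < \<eta> * b" using b \<eta> by simp
  show "W b * (1 + \<eta>) ^ n \<le> W x" if x: "b + \<eta> * l \<le> x" "x < r"
  proof -
    have bx: "b < x" "b * (1 + \<eta>) \<le> x" using x \<eta>b \<eta>b0 by (auto simp: algebra_simps)
    have "W b * (1 + \<eta>) ^ n = (W b / b ^ n) * (b * (1 + \<eta>)) ^ n" using b by (simp add: power_mult_distrib)
    also have "\<dots> \<le> (W b / b ^ n) * x ^ n" using bx b \<eta> W by (intro mult_left_mono power_mono) auto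
    also have "\<dots> \<le> (W x / x ^ n) * x ^ n" using mono[OF b(1) bx(1) x(2)] bx b by (intro mult_right_mono) auto
    also have "\<dots> = W x" using bx b by simp
    finally show ?thesis .
  qed
  show "W x \<le> W b * (1 - \<eta>) ^ n" if x: "0 < x" "x \<le> b - \<eta> * l"
  proof -
    have xb: "x < b" "x \<le> b * (1 - \<eta>)" using x \<eta>b \<eta>b0 by (auto simp: algebra_simps)
    have "W x = (W x / x ^ n) * x ^ n" using x by simp
    also have "\<dots> \<le> (W b / b ^ n) * x ^ n" using mono[OF x(1) xb(1) b(2)] x by (intro mult_right_mono) auto
    also have "\<dots> \<le> (W b / b ^ n) * (b * (1 - \<eta>)) ^ n" using xb b x W by (intro mult_left_mono power_mono) auto
    also have "\<dots> = W b * (1 - \<eta>) ^ n" using b by (simp add: power_mult_distrib)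
    finally show ?thesis .
  qed
qed

lemma energy_scale_small:
  assumes c: "c > 0"
  shows "\<forall>\<^sub>F h in at_right 0. \<forall>a b. well_edges V h (a, b) \<longrightarrow> h\<^sup>2 / (b - a)\<^sup>2 < c"
proof -
  have "V \<midarrow>0\<rightarrow> V 0" using continuous by (simp add: continuous_on_eq_continuous_at isCont_def)
  then have "\<forall>\<^sub>F x in at 0. V x < c" using order_tendstoD(2) c V_0 by metis
  then obtain d where d: "d > 0" "\<And>x. x \<noteq> 0 \<Longrightarrow> dist x 0 < d \<Longrightarrow> V x < c" by (auto simp: eventually_at)
  show ?thesis using well_edges_near_zero[OF d(1)]
  proof eventually_elim
    fix h assume *: "\<forall>a b. well_edges V h (a, b) \<longrightarrow> - d < a \<and> b < d"
    show "\<forall>a b. well_edges V h (a, b) \<longrightarrow> h\<^sup>2 / (b - a)\<^sup>2 < c"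
    proof (intro allI impI)
      fix a b assume w: "well_edges V h (a, b)"
      then have "0 < b" "V b = h\<^sup>2 / (b - a)\<^sup>2" by (auto simp: well_edges_def)
      then show "h\<^sup>2 / (b - a)\<^sup>2 < c" using d(2)[of b] * w by auto
    qed
  qed
qed

text \<open>In units of \<open>h\<^sup>2 / (b - a)\<^sup>2\<close> and at the scale of its width the well tends to an infinite square well,
  because the exponent \<open>n\<close> in \<open>one_sided_growth\<close> is arbitrary. Far from \<open>0\<close>, where no monotonicity is
  known, the potential exceeds any multiple of the vanishing unit of energy.\<close>

lemma well_shape:
  assumes \<eta>: "0 < \<eta>" "\<eta> < 1"
  shows "\<forall>\<^sub>F h in at_right 0. \<forall>a b. well_edges V h (a, b) \<longrightarrow>
     (\<forall>x. x \<le> a - \<eta> * (b - a) \<or> b + \<eta> * (b - a) \<le> x \<longrightarrow> K * (h\<^sup>2 / (b - a)\<^sup>2) \<le> V x) \<and>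
     (\<forall>x\<in>{a + \<eta> * (b - a)..b - \<eta> * (b - a)}. V x \<le> \<eta> * (h\<^sup>2 / (b - a)\<^sup>2)) \<and>
     (\<forall>x\<in>{a..b}. V x \<le> h\<^sup>2 / (b - a)\<^sup>2)"
proof -
  obtain n1 where n1: "K < (1 + \<eta>) ^ n1" using real_arch_pow[of "1 + \<eta>" K] \<eta> by auto
  obtain n2 where n2: "(1 - \<eta>) ^ n2 < \<eta>" using real_arch_pow_inv[of \<eta> "1 - \<eta>"] \<eta> by auto
  define n where "n = n1 + n2"
  have nK: "K \<le> (1 + \<eta>) ^ n"
  proof -
    have "(1 + \<eta>) ^ n1 \<le> (1 + \<eta>) ^ n" using \<eta> by (intro power_increasing) (auto simp: n_def)
    then show ?thesis using n1 by linarith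
  qed
  have n\<eta>: "(1 - \<eta>) ^ n \<le> \<eta>"
  proof -
    have "(1 - \<eta>) ^ n \<le> (1 - \<eta>) ^ n2" using \<eta> by (intro power_decreasing) (auto simp: n_def)
    then show ?thesis using n2 by linarith
  qed
  obtain r where r: "r > 0" "\<And>x y. 0 < x \<Longrightarrow> x < y \<Longrightarrow> y < r \<Longrightarrow> V x / x ^ n < V y / y ^ n"
    "\<And>x y. 0 < x \<Longrightarrow> x < y \<Longrightarrow> y < r \<Longrightarrow> V (- x) / x ^ n < V (- y) / y ^ n" using ratio_monotone[of n] by metis
  obtain r0 where r0: "r0 > 0" "\<And>x y. 0 \<le> x \<Longrightarrow> x < y \<Longrightarrow> y < r0 \<Longrightarrow> V x < V y"
    "\<And>x y. 0 \<le> x \<Longrightarrow> x < y \<Longrightarrow> y < r0 \<Longrightarrow> V (- x) < V (- y)" using strictly_monotone by metis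
  obtain m0 where m0: "m0 > 0" "\<And>x. \<bar>x\<bar> \<ge> r \<Longrightarrow> m0 \<le> V x" using away_from_zero[OF r(1)] by blast
  have "0 < m0 / (\<bar>K\<bar> + 1)" using m0 by simp
  from energy_scale_small[OF this] well_edges_near_zero[OF r(1)] well_edges_near_zero[OF r0(1)]
  show ?thesis
  proof eventually_elim
    fix h assume small: "\<forall>a b. well_edges V h (a, b) \<longrightarrow> h\<^sup>2 / (b - a)\<^sup>2 < m0 / (\<bar>K\<bar> + 1)"
      and near: "\<forall>a b. well_edges V h (a, b) \<longrightarrow> - r < a \<and> b < r"
      and near0: "\<forall>a b. well_edges V h (a, b) \<longrightarrow> - r0 < a \<and> b < r0"
    have "(\<forall>x. x \<le> a - \<eta> * (b - a) \<or> b + \<eta> * (b - a) \<le> x \<longrightarrow> K * (h\<^sup>2 / (b - a)\<^sup>2) \<le> V x) \<and>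
     (\<forall>x\<in>{a + \<eta> * (b - a)..b - \<eta> * (b - a)}. V x \<le> \<eta> * (h\<^sup>2 / (b - a)\<^sup>2)) \<and>
     (\<forall>x\<in>{a..b}. V x \<le> h\<^sup>2 / (b - a)\<^sup>2)" if w: "well_edges V h (a, b)" for a b
    proof -
      define \<epsilon> where "\<epsilon> = h\<^sup>2 / (b - a)\<^sup>2"
      define l where "l = b - a"
      have ab: "a < 0" "0 < b" "V a = \<epsilon>" "V b = \<epsilon>" using w by (auto simp: well_edges_def \<epsilon>_def)
      have n: "- r < a" "b < r" "- r0 < a" "b < r0" and sm: "\<epsilon> < m0 / (\<bar>K\<bar> + 1)"
        using near near0 small w by (auto simp: \<epsilon>_def)
      have \<epsilon>0: "0 \<le> \<epsilon>" by (simp add: \<epsilon>_def)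
      have K\<epsilon>: "K * \<epsilon> \<le> m0"
      proof -
        have "\<epsilon> * (\<bar>K\<bar> + 1) \<le> m0" using sm by (simp add: field_simps)
        moreover have "K * \<epsilon> \<le> (\<bar>K\<bar> + 1) * \<epsilon>" by (intro mult_right_mono \<epsilon>0) auto
        ultimately show ?thesis by (simp add: mult.commute)
      qed
      have l: "b \<le> l" "- a \<le> l" using ab by (auto simp: l_def)
      note gb = one_sided_growth[of r V n b l \<eta>, OF r(2) nonneg ab(2) n(2) l(1) \<eta>(1)]
      have a': "0 < - a" "- a < r" using ab n by auto
      note ga = one_sided_growth[of r "\<lambda>x. V (- x)" n "-a" l \<eta>, OF r(3) nonneg a' l(2) \<eta>(1)]
      have big: "K * \<epsilon> \<le> \<epsilon> * (1 + \<eta>) ^ n" using mult_left_mono[OF nK \<epsilon>0] by (simp add: mult.commute)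
      have little: "\<epsilon> * (1 - \<eta>) ^ n \<le> \<eta> * \<epsilon>" using mult_left_mono[OF n\<eta> \<epsilon>0] by (simp add: mult.commute)
      have "K * \<epsilon> \<le> V x" if "x \<le> a - \<eta> * l \<or> b + \<eta> * l \<le> x" for x
      proof (cases "\<bar>x\<bar> \<ge> r")
        case True then show ?thesis using m0(2)[of x] K\<epsilon> by linarith
      next
        case False
        then have xr: "x < r" "- x < r" by linarith+
        show ?thesis
          using that
        proof
          assume "x \<le> a - \<eta> * l"
          then show ?thesis using ga(1)[of "-x"] xr big ab(3) by simp
        next
          assume "b + \<eta> * l \<le> x"
          then show ?thesis using gb(1)[of x] xr big ab(4) by simp
        qed
      qed
      moreover have "V x \<le> \<eta> * \<epsilon>" if "x \<in> {a + \<eta> * l..b - \<eta> * l}" for x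
      proof -
        consider "x > 0" | "x = 0" | "x < 0" by linarith
        then show ?thesis
        proof cases
          case 1 then show ?thesis using gb(2)[of x] that little ab by auto
        next
          case 2 then show ?thesis using V_0 \<eta> \<epsilon>0 by simp
        next
          case 3 then show ?thesis using ga(2)[of "-x"] that little ab by auto
        qed
      qed
      moreover have "V x \<le> \<epsilon>" if "x \<in> {a..b}" for x
      proof (cases "x \<ge> 0")
        case True
        then show ?thesis using r0(2)[of x b] that n ab by (cases "x = b") auto
      next
        case False
        then show ?thesis using r0(3)[of "-x" "-a"] that n ab by (cases "x = a") auto
      qed
      ultimately show ?thesis by (simp add: l_def \<epsilon>_def)
    qed
    then show "\<forall>a b. well_edges V h (a, b) \<longrightarrow>
     (\<forall>x. x \<le> a - \<eta> * (b - a) \<or> b + \<eta> * (b - a) \<le> x \<longrightarrow> K * (h\<^sup>2 / (b - a)\<^sup>2) \<le> V x) \<and>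
     (\<forall>x\<in>{a + \<eta> * (b - a)..b - \<eta> * (b - a)}. V x \<le> \<eta> * (h\<^sup>2 / (b - a)\<^sup>2)) \<and>
     (\<forall>x\<in>{a..b}. V x \<le> h\<^sup>2 / (b - a)\<^sup>2)" by blast
  qed
qed

end

section \<open>Dirichlet modes\<close>

text \<open>A differentiable function on an interval, continued by constants to the whole line.\<close>

lemma primitive_clip:
  fixes F F' :: "real \<Rightarrow> complex"
  assumes ab: "a \<le> b" and D: "\<And>t. t \<in> {a..b} \<Longrightarrow> (F has_vector_derivative F' t) (at t within {a..b})"
    and c: "continuous_on {a..b} F'"
  shows "is_primitive (\<lambda>t. F (max a (min b t))) (\<lambda>t. indicator {a..b} t * F' t)"
  unfolding is_primitive_def
proof (intro conjI allI impI)
  have int: "integrable lborel (\<lambda>t. indicator {a..b} t * F' t)"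
    using borel_integrable_atLeastAtMost'[OF c] unfolding set_integrable_def
    by (rule Bochner_Integration.integrable_cong[THEN iffD1, rotated 2]) (auto split: split_indicator)
  show "locally_integrable (\<lambda>t. indicator {a..b} t * F' t)"
    unfolding locally_integrable_def set_integrable_def
    by (intro allI integrable_mult_indicator int) simp
  fix x y :: real assume xy: "x \<le> y"
  have eq: "(LINT t:{x..y}|lborel. indicator {a..b} t * F' t) = (LINT t:{max x a..min y b}|lborel. F' t)"
    unfolding set_lebesgue_integral_def
    by (intro Bochner_Integration.integral_cong) (auto split: split_indicator)
  show "F (max a (min b y)) - F (max a (min b x)) = (LINT t:{x..y}|lborel. indicator {a..b} t * F' t)"
  proof (cases "max x a \<le> min y b")
    case True
    have sub: "{max x a..min y b} \<subseteq> {a..b}" by auto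
    have "(F' has_integral (F (min y b) - F (max x a))) {max x a..min y b}"
      by (rule fundamental_theorem_of_calculus[OF True]) (use D sub has_vector_derivative_within_subset in blast)
    moreover have "set_integrable lborel {max x a..min y b} F'"
      by (intro borel_integrable_atLeastAtMost' continuous_on_subset[OF c sub])
    ultimately have "(LINT t:{max x a..min y b}|lborel. F' t) = F (min y b) - F (max x a)"
      using set_borel_integral_eq_integral(2) by (metis integral_unique)
    moreover have "max a (min b y) = min y b" "max a (min b x) = max x a" using True xy ab by auto
    ultimately show ?thesis by (simp only: eq)
  next
    case False
    then have "max a (min b y) = max a (min b x)" using xy ab by auto
    then show ?thesis using False unfolding eq by (simp add: set_lebesgue_integral_def)
  qed
qed

definition mode_freq :: "nat \<Rightarrow> real \<Rightarrow> real \<Rightarrow> real" where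
  "mode_freq k a b = pi * real k / (b - a)"

definition mode_deriv :: "nat \<Rightarrow> real \<Rightarrow> real \<Rightarrow> real \<Rightarrow> complex" where
  "mode_deriv k a b x = indicator {a..b} x *
     of_real (sqrt (2 / (b - a)) * mode_freq k a b * cos (mode_freq k a b * (x - a)))"

lemma dirichlet_mode_eq:
  "dirichlet_mode k a b x = indicator {a..b} x * of_real (sqrt (2 / (b - a)) * sin (mode_freq k a b * (x - a)))"
  by (auto simp: dirichlet_mode_def mode_freq_def split: split_indicator)

lemma mode_primitive:
  assumes ab: "a < b"
  shows "is_primitive (dirichlet_mode k a b) (mode_deriv k a b)"
proof -
  let ?F = "\<lambda>t. complex_of_real (sqrt (2 / (b - a)) * sin (mode_freq k a b * (t - a)))"
  let ?F' = "\<lambda>t. complex_of_real (sqrt (2 / (b - a)) * mode_freq k a b * cos (mode_freq k a b * (t - a)))"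
  have "is_primitive (\<lambda>t. ?F (max a (min b t))) (\<lambda>t. indicator {a..b} t * ?F' t)"
  proof (rule primitive_clip)
    fix t
    have "((\<lambda>t. sqrt (2 / (b - a)) * sin (mode_freq k a b * (t - a))) has_real_derivative
        sqrt (2 / (b - a)) * mode_freq k a b * cos (mode_freq k a b * (t - a))) (at t within {a..b})"
      by (auto intro!: derivative_eq_intros)
    then show "(?F has_vector_derivative ?F' t) (at t within {a..b})"
      unfolding has_real_derivative_iff_has_vector_derivative by (rule bounded_linear.has_vector_derivative[OF bounded_linear_of_real])
  qed (use ab in \<open>auto intro!: continuous_intros\<close>)
  moreover have "?F (max a (min b t)) = dirichlet_mode k a b t" for t
  proof -
    have "sin (mode_freq k a b * (b - a)) = 0" using ab by (simp add: mode_freq_def mult.commute[of pi])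
    then show ?thesis using ab by (cases "t < a"; cases "t > b") (auto simp: dirichlet_mode_eq)
  qed
  ultimately show ?thesis by (simp add: mode_deriv_def[abs_def])
qed

lemma cutoff_L2:
  assumes "continuous_on {a..b} f"
  shows "(\<lambda>x. indicator {a..b} x * complex_of_real (f x)) \<in> L2"
proof (rule L2_dominated)
  have eq: "(\<lambda>x. indicat_real {a..b} x *\<^sub>R complex_of_real (f x)) = (\<lambda>x. indicator {a..b} x * complex_of_real (f x))"
    by (auto split: split_indicator)
  have "(\<lambda>x. indicat_real {a..b} x *\<^sub>R complex_of_real (f x)) \<in> borel_measurable borel"
    by (rule borel_measurable_continuous_on_indicator) (use assms in \<open>auto intro!: continuous_intros\<close>)
  then show "(\<lambda>x. indicator {a..b} x * complex_of_real (f x)) \<in> borel_measurable borel" unfolding eq .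
  have "set_integrable lborel {a..b} (\<lambda>x. (f x)\<^sup>2)"
    by (intro borel_integrable_atLeastAtMost' continuous_intros assms)
  then show "integrable lborel (\<lambda>x. indicat_real {a..b} x *\<^sub>R (f x)\<^sup>2)" by (simp add: set_integrable_def)
qed (auto split: split_indicator)

lemma mode_L2: "dirichlet_mode k a b \<in> L2" "mode_deriv k a b \<in> L2"
  unfolding dirichlet_mode_eq[abs_def] mode_deriv_def[abs_def]
  by (intro cutoff_L2 continuous_intros)+

lemma cutoff_inner:
  assumes "continuous_on {a..b} f" "continuous_on {a..b} g"
  shows "L2_inner (\<lambda>x. indicator {a..b} x * complex_of_real (f x)) (\<lambda>x. indicator {a..b} x * complex_of_real (g x))
    = of_real (integral {a..b} (\<lambda>x. f x * g x))"
proof -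
  have "L2_inner (\<lambda>x. indicator {a..b} x * complex_of_real (f x)) (\<lambda>x. indicator {a..b} x * complex_of_real (g x))
     = (LINT x|lborel. complex_of_real (indicat_real {a..b} x *\<^sub>R (f x * g x)))"
    unfolding L2_inner_def by (rule Bochner_Integration.integral_cong) (auto split: split_indicator)
  also have "\<dots> = of_real (LINT x:{a..b}|lborel. f x * g x)"
    unfolding set_lebesgue_integral_def by (rule integral_complex_of_real)
  also have "(LINT x:{a..b}|lborel. f x * g x) = integral {a..b} (\<lambda>x. f x * g x)"
    by (intro set_borel_integral_eq_integral borel_integrable_atLeastAtMost' continuous_intros assms)
  finally show ?thesis .
qed

text \<open>Integration of the derivative of \<open>sin (\<omega>\<^sub>k x) cos (\<omega>\<^sub>l x)\<close> gives a linear relation between the sine and the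
  cosine integral, and exchanging the indices gives a second one. For \<open>i \<noteq> j\<close> they force both integrals
  to vanish; for \<open>i = j\<close> the integrals agree and add up to the length of the interval.\<close>

lemma trig_integrals:
  assumes ab: "a < b" and ij: "1 \<le> i" "1 \<le> j"
  shows "integral {a..b} (\<lambda>x. sin (mode_freq i a b * (x - a)) * sin (mode_freq j a b * (x - a))) = (if i = j then (b - a) / 2 else 0)"
    (is "?s i j = _")
    and "integral {a..b} (\<lambda>x. cos (mode_freq i a b * (x - a)) * cos (mode_freq j a b * (x - a))) = (if i = j then (b - a) / 2 else 0)"
    (is "?c i j = _")
proof -
  let ?w = "\<lambda>i. mode_freq i a b"
  have w: "?w i > 0" "?w j > 0" "?w i = ?w j \<longleftrightarrow> i = j" using ab ij by (auto simp: mode_freq_def)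
  have end0: "sin (?w k * (b - a)) = 0" for k using ab by (simp add: mode_freq_def mult.commute[of pi])
  have parts: "?w k * ?c k l = ?w l * ?s k l" for k l
  proof -
    have A: "((\<lambda>x. ?w k * (cos (?w k * (x - a)) * cos (?w l * (x - a))) - ?w l * (sin (?w k * (x - a)) * sin (?w l * (x - a))))
       has_integral (sin (?w k * (b - a)) * cos (?w l * (b - a)) - sin (?w k * (a - a)) * cos (?w l * (a - a)))) {a..b}"
    proof (rule fundamental_theorem_of_calculus)
      fix x
      have "((\<lambda>x. sin (?w k * (x - a)) * cos (?w l * (x - a))) has_real_derivative
          ?w k * (cos (?w k * (x - a)) * cos (?w l * (x - a))) - ?w l * (sin (?w k * (x - a)) * sin (?w l * (x - a)))) (at x within {a..b})"
        by (auto intro!: derivative_eq_intros)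
      then show "((\<lambda>x. sin (?w k * (x - a)) * cos (?w l * (x - a))) has_vector_derivative
          ?w k * (cos (?w k * (x - a)) * cos (?w l * (x - a))) - ?w l * (sin (?w k * (x - a)) * sin (?w l * (x - a)))) (at x within {a..b})"
        by (simp add: has_real_derivative_iff_has_vector_derivative)
    qed (use ab in simp)
    have B: "((\<lambda>x. ?w k * (cos (?w k * (x - a)) * cos (?w l * (x - a))) - ?w l * (sin (?w k * (x - a)) * sin (?w l * (x - a))))
       has_integral (?w k * ?c k l - ?w l * ?s k l)) {a..b}"
      by (intro has_integral_diff has_integral_mult_right integrable_integral integrable_continuous_interval continuous_intros)
    show ?thesis using has_integral_unique[OF B A] end0 by simp
  qed
  have sym: "?c j i = ?c i j" "?s j i = ?s i j" by (simp_all add: mult.commute)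
  have 1: "?w i * ?c i j = ?w j * ?s i j" by (rule parts)
  have 2: "?w j * ?c i j = ?w i * ?s i j" using parts[of j i] sym by simp
  have "?s i j = (if i = j then (b - a) / 2 else 0) \<and> ?c i j = (if i = j then (b - a) / 2 else 0)"
  proof (cases "i = j")
    case False
    have "(?w i + ?w j) * (?c i j - ?s i j) = 0" using 1 2 by (simp add: algebra_simps)
    then have cs: "?c i j = ?s i j" using w by simp
    then have "(?w i - ?w j) * ?s i j = 0" using 1 by (simp add: left_diff_distrib)
    then have "?s i j = 0" using w False by simp
    then show ?thesis using cs False by simp
  next
    case True
    have cs: "?c i j = ?s i j" using 1 w True by simp
    have "?c i j + ?s i j = integral {a..b} (\<lambda>x. cos (?w i * (x - a)) * cos (?w j * (x - a)) + sin (?w i * (x - a)) * sin (?w j * (x - a)))"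
      by (intro Henstock_Kurzweil_Integration.integral_add[symmetric] integrable_continuous_interval continuous_intros)
    also have "\<dots> = integral {a..b} (\<lambda>x. 1)"
      by (rule integral_cong) (simp add: True power2_eq_square[symmetric])
    also have "\<dots> = b - a" using ab by simp
    finally show ?thesis using cs True by simp
  qed
  then show "?s i j = (if i = j then (b - a) / 2 else 0)" "?c i j = (if i = j then (b - a) / 2 else 0)" by auto
qed

lemma mode_inner:
  assumes ab: "a < b" and ij: "1 \<le> i" "1 \<le> j"
  shows "L2_inner (dirichlet_mode i a b) (dirichlet_mode j a b) = (if i = j then 1 else 0)"
    and "L2_inner (mode_deriv i a b) (mode_deriv j a b) = (if i = j then of_real ((mode_freq i a b)\<^sup>2) else 0)"
proof -
  have r: "(sqrt (2 / (b - a)) * x) * (sqrt (2 / (b - a)) * y) = 2 / (b - a) * (x * y)" for x y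
  proof -
    have "(sqrt (2 / (b - a)) * x) * (sqrt (2 / (b - a)) * y) = (sqrt (2 / (b - a)) * sqrt (2 / (b - a))) * (x * y)"
      by (simp only: mult_ac)
    then show ?thesis using ab by simp
  qed
  have "L2_inner (dirichlet_mode i a b) (dirichlet_mode j a b)
     = of_real (integral {a..b} (\<lambda>x. (sqrt (2 / (b - a)) * sin (mode_freq i a b * (x - a))) * (sqrt (2 / (b - a)) * sin (mode_freq j a b * (x - a)))))"
    unfolding dirichlet_mode_eq[abs_def] by (intro cutoff_inner continuous_intros)
  also have "\<dots> = of_real (2 / (b - a) * integral {a..b} (\<lambda>x. sin (mode_freq i a b * (x - a)) * sin (mode_freq j a b * (x - a))))"
    by (simp only: r integral_mult_right)
  finally show "L2_inner (dirichlet_mode i a b) (dirichlet_mode j a b) = (if i = j then 1 else 0)"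
    unfolding trig_integrals(1)[OF assms] using ab by simp
  have "L2_inner (mode_deriv i a b) (mode_deriv j a b)
     = of_real (integral {a..b} (\<lambda>x. (sqrt (2 / (b - a)) * (mode_freq i a b * cos (mode_freq i a b * (x - a)))) *
         (sqrt (2 / (b - a)) * (mode_freq j a b * cos (mode_freq j a b * (x - a))))))"
    unfolding mode_deriv_def[abs_def] mult.assoc[of "sqrt (2 / (b - a))" "mode_freq i a b"]
      mult.assoc[of "sqrt (2 / (b - a))" "mode_freq j a b"] by (intro cutoff_inner continuous_intros)
  also have "\<dots> = of_real ((2 / (b - a) * (mode_freq i a b * mode_freq j a b)) *
      integral {a..b} (\<lambda>x. cos (mode_freq i a b * (x - a)) * cos (mode_freq j a b * (x - a))))"
  proof -
    have "(sqrt (2 / (b - a)) * (mode_freq i a b * c)) * (sqrt (2 / (b - a)) * (mode_freq j a b * d))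
        = (2 / (b - a) * (mode_freq i a b * mode_freq j a b)) * (c * d)" for c d :: real
      unfolding r by (simp only: mult_ac)
    then show ?thesis by (simp only: integral_mult_right)
  qed
  finally show "L2_inner (mode_deriv i a b) (mode_deriv j a b) = (if i = j then of_real ((mode_freq i a b)\<^sup>2) else 0)"
    unfolding trig_integrals(2)[OF assms] using ab by (simp add: power2_eq_square)
qed

lemma mode_bound:
  assumes ab: "a < b"
  shows "(cmod (dirichlet_mode k a b x))\<^sup>2 \<le> 2 / (b - a) * indicator {a..b} x"
proof -
  have "(sin (mode_freq k a b * (x - a)))\<^sup>2 \<le> 1" by (simp add: abs_square_le_1)
  then have "2 / (b - a) * (sin (mode_freq k a b * (x - a)))\<^sup>2 \<le> 2 / (b - a) * 1"
    using ab by (intro mult_left_mono) auto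
  then show ?thesis using ab
    by (auto simp: dirichlet_mode_eq norm_mult power_mult_distrib split: split_indicator)
qed

lemma mode_potential_L2:
  assumes "continuous_on UNIV V" "\<And>x. 0 \<le> V x"
  shows "sqrt_potential_mult V (dirichlet_mode k a b) \<in> L2"
proof -
  have eq: "sqrt_potential_mult V (dirichlet_mode k a b) =
      (\<lambda>x. indicator {a..b} x * complex_of_real (sqrt (V x) * (sqrt (2 / (b - a)) * sin (mode_freq k a b * (x - a)))))"
    by (rule ext) (simp add: sqrt_potential_mult_def dirichlet_mode_eq)
  show ?thesis unfolding eq
    by (intro cutoff_L2 continuous_intros continuous_on_subset[OF assms(1)]) auto
qed

text \<open>On the well \<open>V\<close> is at most \<open>\<eta> * \<epsilon>\<close> except in two edge zones of relative width \<open>\<eta>\<close>, where it is at most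
  \<open>\<epsilon>\<close>; the modes are bounded by \<open>sqrt (2 / (b - a))\<close>.\<close>

lemma mode_potential_energy:
  assumes ab: "a < b" and V: "continuous_on UNIV V" "\<And>x. 0 \<le> V x" and \<eta>: "0 < \<eta>" and \<epsilon>: "0 \<le> \<epsilon>"
    and inside: "\<And>x. x \<in> {a + \<eta> * (b - a)..b - \<eta> * (b - a)} \<Longrightarrow> V x \<le> \<eta> * \<epsilon>"
    and well: "\<And>x. x \<in> {a..b} \<Longrightarrow> V x \<le> \<epsilon>"
  shows "(norm (\<Sum>i\<le>k. cscale (cs i) (to_l2 (sqrt_potential_mult V (dirichlet_mode (Suc i) a b)))))\<^sup>2
     \<le> 6 * \<eta> * real (Suc k) * \<epsilon> * (\<Sum>i\<le>k. (cmod (cs i))\<^sup>2)"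
proof -
  define l where "l = b - a"
  have l: "l > 0" using ab by (simp add: l_def)
  define w where "w i = sqrt_potential_mult V (dirichlet_mode (Suc i) a b)" for i
  define f where "f x = (\<Sum>i\<le>k. cs i * w i x)" for x
  define S where "S = (\<Sum>i\<le>k. (cmod (cs i))\<^sup>2)"
  have S0: "0 \<le> S" by (simp add: S_def sum_nonneg)
  have wL: "w i \<in> L2" for i unfolding w_def by (rule mode_potential_L2[OF V])
  have fL: "f \<in> L2" unfolding f_def[abs_def] by (intro L2_sum L2_scale wL)
  have "(\<Sum>i\<le>k. cscale (cs i) (to_l2 (w i))) = (\<Sum>i\<le>k. to_l2 (\<lambda>x. cs i * w i x))"
    by (intro sum.cong refl) (simp add: to_l2_cscale wL)
  also have "\<dots> = to_l2 f" unfolding f_def[abs_def] by (intro to_l2_sum L2_scale wL)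
  finally have eq: "(norm (\<Sum>i\<le>k. cscale (cs i) (to_l2 (w i))))\<^sup>2 = (LINT x|lborel. (cmod (f x))\<^sup>2)"
    using fL by (simp add: norm_to_l2 L2_norm_def)
  define B where "B = real (Suc k) * (2 / l) * S"
  have B0: "0 \<le> B" using l S0 by (simp add: B_def)
  define I where "I x y = (\<lambda>t. indicat_real {x..y::real} t)" for x y
  have I: "integrable lborel (I x y)" for x y unfolding I_def
    by (rule integrable_real_indicator) (auto simp: emeasure_lborel_Icc_eq)
  have LI: "x \<le> y \<Longrightarrow> (LINT t|lborel. I x y t) = y - x" for x y unfolding I_def by simp
  have pointwise: "(cmod (f x))\<^sup>2 \<le> B * (\<eta> * \<epsilon> * I a b x + \<epsilon> * I a (a + \<eta> * l) x + \<epsilon> * I (b - \<eta> * l) b x)" for x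
  proof (cases "x \<in> {a..b}")
    case False
    then have "f x = 0" by (simp add: f_def w_def sqrt_potential_mult_def dirichlet_mode_eq)
    moreover have "0 \<le> B * (\<eta> * \<epsilon> * I a b x + \<epsilon> * I a (a + \<eta> * l) x + \<epsilon> * I (b - \<eta> * l) b x)"
      using B0 \<eta> \<epsilon> by (intro mult_nonneg_nonneg add_nonneg_nonneg) (auto simp: I_def)
    ultimately show ?thesis by simp
  next
    case True
    have mode: "(cmod (dirichlet_mode (Suc i) a b x))\<^sup>2 \<le> 2 / l" for i
      using mode_bound[OF ab, of "Suc i" x] True by (simp add: l_def)
    have "cmod (f x) \<le> (\<Sum>i\<le>k. cmod (cs i) * cmod (w i x))"
      unfolding f_def by (intro order_trans[OF norm_sum] sum_mono) (simp add: norm_mult)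
    then have "(cmod (f x))\<^sup>2 \<le> (\<Sum>i\<le>k. cmod (cs i) * cmod (w i x))\<^sup>2" by (intro power_mono) auto
    also have "\<dots> \<le> S * (\<Sum>i\<le>k. (cmod (w i x))\<^sup>2)"
      unfolding S_def by (rule Cauchy_Schwarz_ineq_sum)
    also have "\<dots> \<le> S * (\<Sum>i\<le>k. V x * (2 / l))"
    proof (intro mult_left_mono sum_mono S0)
      fix i
      have "(cmod (w i x))\<^sup>2 = V x * (cmod (dirichlet_mode (Suc i) a b x))\<^sup>2"
        using V(2)[of x] by (simp add: w_def sqrt_potential_mult_def norm_mult power_mult_distrib)
      also have "\<dots> \<le> V x * (2 / l)" by (intro mult_left_mono mode V)
      finally show "(cmod (w i x))\<^sup>2 \<le> V x * (2 / l)" .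
    qed
    also have "\<dots> = B * V x" by (simp add: B_def)
    also have "\<dots> \<le> B * (\<eta> * \<epsilon> * I a b x + \<epsilon> * I a (a + \<eta> * l) x + \<epsilon> * I (b - \<eta> * l) b x)"
    proof (intro mult_left_mono B0)
      have nn: "0 \<le> \<eta> * \<epsilon> * I a b x" "0 \<le> \<epsilon> * I a (a + \<eta> * l) x" "0 \<le> \<epsilon> * I (b - \<eta> * l) b x"
        using \<eta> \<epsilon> by (auto simp: I_def)
      have "x \<in> {a..a + \<eta> * l} \<or> x \<in> {b - \<eta> * l..b} \<or> x \<in> {a + \<eta> * l..b - \<eta> * l}"
        using True unfolding atLeastAtMost_iff by linarith
      then consider "x \<in> {a..a + \<eta> * l}" | "x \<in> {b - \<eta> * l..b}" | "x \<in> {a + \<eta> * l..b - \<eta> * l}"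
        by blast
      then show "V x \<le> \<eta> * \<epsilon> * I a b x + \<epsilon> * I a (a + \<eta> * l) x + \<epsilon> * I (b - \<eta> * l) b x"
      proof cases
        case 1
        then have "\<epsilon> * I a (a + \<eta> * l) x = \<epsilon>" by (simp add: I_def)
        then show ?thesis using well[OF True] nn by linarith
      next
        case 2
        then have "\<epsilon> * I (b - \<eta> * l) b x = \<epsilon>" by (simp add: I_def)
        then show ?thesis using well[OF True] nn by linarith
      next
        case 3
        then have "V x \<le> \<eta> * \<epsilon>" by (intro inside) (simp add: l_def)
        moreover have "\<eta> * \<epsilon> * I a b x = \<eta> * \<epsilon>" using True by (simp add: I_def)
        ultimately show ?thesis using nn by linarith
      qed
    qed
    finally show ?thesis .
  qed
  have "(LINT x|lborel. (cmod (f x))\<^sup>2)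
      \<le> (LINT x|lborel. B * (\<eta> * \<epsilon> * I a b x + \<epsilon> * I a (a + \<eta> * l) x + \<epsilon> * I (b - \<eta> * l) b x))"
    by (intro integral_mono L2_sq_integrable fL pointwise integrable_mult_right Bochner_Integration.integrable_add I)
  also have "\<dots> = B * (\<eta> * \<epsilon> * (LINT x|lborel. I a b x) + \<epsilon> * (LINT x|lborel. I a (a + \<eta> * l) x) + \<epsilon> * (LINT x|lborel. I (b - \<eta> * l) b x))"
    by (simp add: I)
  also have "\<dots> = B * (\<eta> * \<epsilon> * l + \<epsilon> * (\<eta> * l) + \<epsilon> * (\<eta> * l))"
    using ab \<eta> l by (simp add: LI l_def)
  also have "\<dots> = 6 * \<eta> * real (Suc k) * \<epsilon> * S" using l by (simp add: B_def field_simps)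
  finally show ?thesis unfolding eq[unfolded w_def] S_def .
qed

section \<open>Lower bounds on the energy\<close>

text \<open>The function \<open>\<phi> t = - \<theta> * tan (\<theta> * (t - mid))\<close> solves the Riccati equation \<open>\<phi>' = - \<theta>\<^sup>2 - \<phi>\<^sup>2\<close>, hence
  \<open>|g|\<^sup>2 - \<theta>\<^sup>2 |U|\<^sup>2 = |g - \<phi> U|\<^sup>2 + (\<phi> |U|\<^sup>2)'\<close>. The condition on \<open>\<theta>\<close> keeps \<open>\<phi>\<close> finite up to the end points, so
  the values of \<open>U\<close> there only need to be small.\<close>

lemma Robin_inequality:
  assumes U: "is_primitive U g" and L: "U \<in> L2" "g \<in> L2" and xy: "x < y"
    and \<theta>: "0 < \<theta>" "\<theta> * (y - x) < pi"
  shows "\<theta>\<^sup>2 * (LINT t:{x..y}|lborel. (cmod (U t))\<^sup>2) \<le> (LINT t:{x..y}|lborel. (cmod (g t))\<^sup>2)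
      + \<theta> * tan (\<theta> * (y - x) / 2) * ((cmod (U x))\<^sup>2 + (cmod (U y))\<^sup>2)"
proof -
  define mid where "mid = (x + y) / 2"
  define \<phi> where "\<phi> t = - \<theta> * tan (\<theta> * (t - mid))" for t
  define \<phi>' where "\<phi>' t = - \<theta>\<^sup>2 - (\<phi> t)\<^sup>2" for t
  define T where "T t = complex_of_real (\<phi> (max x (min y t)))" for t
  have cos0: "cos (\<theta> * (t - mid)) \<noteq> 0" if "t \<in> {x..y}" for t
  proof -
    have "\<theta> * \<bar>t - mid\<bar> \<le> \<theta> * ((y - x) / 2)" using that \<theta>(1) by (intro mult_left_mono) (auto simp: mid_def abs_le_iff field_simps)
    moreover have "\<bar>\<theta> * (t - mid)\<bar> = \<theta> * \<bar>t - mid\<bar>" using \<theta>(1) by (simp add: abs_mult)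
    moreover have "\<theta> * ((y - x) / 2) = \<theta> * (y - x) / 2" by simp
    ultimately have "\<bar>\<theta> * (t - mid)\<bar> < pi / 2" using \<theta>(2) by linarith
    then have "- (pi / 2) < \<theta> * (t - mid)" "\<theta> * (t - mid) < pi / 2" by linarith+
    then show ?thesis using cos_gt_zero_pi[of "\<theta> * (t - mid)"] by linarith
  qed
  have D: "(\<phi> has_real_derivative \<phi>' t) (at t within {x..y})" if "t \<in> {x..y}" for t
  proof -
    have "(\<phi> has_real_derivative - \<theta> * (inverse ((cos (\<theta> * (t - mid)))\<^sup>2) * \<theta>)) (at t within {x..y})"
      unfolding \<phi>_def[abs_def] by (rule derivative_eq_intros refl cos0[OF that] | simp)+
    moreover have "- \<theta> * (inverse ((cos (\<theta> * (t - mid)))\<^sup>2) * \<theta>) = \<phi>' t"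
    proof -
      have sec: "inverse ((cos (\<theta> * (t - mid)))\<^sup>2) = 1 + (tan (\<theta> * (t - mid)))\<^sup>2"
        using tan_sec[OF cos0[OF that]] by (simp add: power_inverse)
      show ?thesis unfolding sec \<phi>'_def \<phi>_def by (simp add: power2_eq_square distrib_left mult_ac)
    qed
    ultimately show ?thesis by simp
  qed
  have c\<phi>: "continuous_on {x..y} \<phi>" using D DERIV_continuous_on by blast
  have prT: "is_primitive T (\<lambda>t. indicator {x..y} t * complex_of_real (\<phi>' t))"
    unfolding T_def
  proof (rule primitive_clip)
    show "((\<lambda>t. complex_of_real (\<phi> t)) has_vector_derivative complex_of_real (\<phi>' t)) (at t within {x..y})" if "t \<in> {x..y}" for t
      using D[OF that] unfolding has_real_derivative_iff_has_vector_derivative by (rule bounded_linear.has_vector_derivative[OF bounded_linear_of_real])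
    show "continuous_on {x..y} (\<lambda>t. complex_of_real (\<phi>' t))"
      unfolding \<phi>'_def by (intro continuous_intros c\<phi>)
  qed (use xy in simp)
  have prc: "is_primitive (\<lambda>t. cnj (U t)) (\<lambda>t. cnj (g t))"
    unfolding is_primitive_def
  proof (intro conjI allI impI)
    show "locally_integrable (\<lambda>t. cnj (g t))" by (rule L2_locally_integrable[OF L2_cnj[OF L(2)]])
    fix s t :: real assume "s \<le> t"
    from arg_cong[OF primitive_diff[OF U this], of cnj]
    have "cnj (U t) - cnj (U s) = (LINT r|lborel. cnj (indicat_real {s..t} r *\<^sub>R g r))"
      unfolding set_lebesgue_integral_def Bochner_Integration.integral_cnj by simp
    then show "cnj (U t) - cnj (U s) = (LINT r:{s..t}|lborel. cnj (g r))"
      unfolding set_lebesgue_integral_def by simp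
  qed
  define f where "f t = (indicator {x..y} t * complex_of_real (\<phi>' t)) * (U t * cnj (U t)) + T t * (g t * cnj (U t) + U t * cnj (g t))" for t
  have prF: "is_primitive (\<lambda>t. T t * (U t * cnj (U t))) f"
    unfolding f_def[abs_def] by (intro primitive_mult prT U prc)
  have fint: "set_integrable lborel {x..y} f" by (rule primitive_integrable[OF prF])
  have Ref: "Re (f t) \<le> (cmod (g t))\<^sup>2 - \<theta>\<^sup>2 * (cmod (U t))\<^sup>2" if t: "t \<in> {x..y}" for t
  proof -
    have "max x (min y t) = t" using t by auto
    then have "Re (f t) = \<phi>' t * (cmod (U t))\<^sup>2 + 2 * \<phi> t * Re (g t * cnj (U t))"
      using t by (simp add: f_def T_def cmod_power2) (simp add: algebra_simps power2_eq_square)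
    moreover have "(cmod (g t - of_real (\<phi> t) * U t))\<^sup>2 = (cmod (g t))\<^sup>2 - 2 * \<phi> t * Re (g t * cnj (U t)) + (\<phi> t)\<^sup>2 * (cmod (U t))\<^sup>2"
      by (simp add: cmod_power2) (simp add: power2_eq_square algebra_simps)
    moreover have "0 \<le> (cmod (g t - of_real (\<phi> t) * U t))\<^sup>2" by simp
    moreover have "\<phi>' t * (cmod (U t))\<^sup>2 = - (\<theta>\<^sup>2 * (cmod (U t))\<^sup>2) - (\<phi> t)\<^sup>2 * (cmod (U t))\<^sup>2"
      by (simp add: \<phi>'_def left_diff_distrib)
    ultimately show ?thesis by linarith
  qed
  have "Re (T y * (U y * cnj (U y)) - T x * (U x * cnj (U x))) = Re (LINT t:{x..y}|lborel. f t)"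
    using primitive_diff[OF prF] xy by simp
  also have "\<dots> = (LINT t:{x..y}|lborel. Re (f t))"
    using integral_Re[OF fint[unfolded set_integrable_def]] by (simp add: set_lebesgue_integral_def)
  also have "\<dots> \<le> (LINT t:{x..y}|lborel. (cmod (g t))\<^sup>2 - \<theta>\<^sup>2 * (cmod (U t))\<^sup>2)"
  proof (rule set_integral_mono)
    show "set_integrable lborel {x..y} (\<lambda>t. Re (f t))"
      using integrable_Re[OF fint[unfolded set_integrable_def]] by (simp add: set_integrable_def)
    show "set_integrable lborel {x..y} (\<lambda>t. (cmod (g t))\<^sup>2 - \<theta>\<^sup>2 * (cmod (U t))\<^sup>2)"
      by (intro set_integral_diff set_integrable_mult_right L2_sq_set_integrable L impI)
  qed (rule Ref)
  also have "\<dots> = (LINT t:{x..y}|lborel. (cmod (g t))\<^sup>2) - \<theta>\<^sup>2 * (LINT t:{x..y}|lborel. (cmod (U t))\<^sup>2)"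
  proof -
    have si: "set_integrable lborel {x..y} (\<lambda>t. \<theta>\<^sup>2 * (cmod (U t))\<^sup>2)"
      by (intro set_integrable_mult_right L2_sq_set_integrable L)
    show ?thesis using set_integral_diff(2)[OF L2_sq_set_integrable[OF L(2)] si] by simp
  qed
  finally have main: "Re (T y * (U y * cnj (U y)) - T x * (U x * cnj (U x)))
     \<le> (LINT t:{x..y}|lborel. (cmod (g t))\<^sup>2) - \<theta>\<^sup>2 * (LINT t:{x..y}|lborel. (cmod (U t))\<^sup>2)" .
  have y2: "\<theta> * (y - mid) = \<theta> * (y - x) / 2" and x2: "\<theta> * (x - mid) = - (\<theta> * (y - x) / 2)"
    by (auto simp: mid_def field_simps)
  have "Re (T y * (U y * cnj (U y)) - T x * (U x * cnj (U x))) = - \<theta> * tan (\<theta> * (y - x) / 2) * ((cmod (U x))\<^sup>2 + (cmod (U y))\<^sup>2)"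
  proof -
    have R: "Re (complex_of_real r * (z * cnj z)) = r * (cmod z)\<^sup>2" for r z
      unfolding cmod_power2 by (simp add: power2_eq_square)
    have "T y = complex_of_real (\<phi> y)" "T x = complex_of_real (\<phi> x)" using xy by (auto simp: T_def)
    moreover have "\<phi> y = - \<theta> * tan (\<theta> * (y - x) / 2)" "\<phi> x = \<theta> * tan (\<theta> * (y - x) / 2)"
      unfolding \<phi>_def y2 x2 by simp_all
    ultimately show ?thesis by (simp only: minus_complex.sel R) (simp add: distrib_left)
  qed
  then show ?thesis using main by simp
qed

lemma exists_small_value:
  assumes U: "U \<in> L2" and xy: "x < y"
  shows "\<exists>t\<in>{x..y}. (y - x) * (cmod (U t))\<^sup>2 \<le> (LINT t:{x..y}|lborel. (cmod (U t))\<^sup>2)"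
proof (rule ccontr)
  define I where "I = (LINT t:{x..y}|lborel. (cmod (U t))\<^sup>2)"
  assume "\<not> ?thesis"
  then have gt: "I / (y - x) < (cmod (U t))\<^sup>2" if "t \<in> {x..y}" for t
    using that xy by (auto simp: I_def not_le field_simps)
  define f where "f t = indicat_real {x..y} t *\<^sub>R ((cmod (U t))\<^sup>2 - I / (y - x))" for t
  have int: "set_integrable lborel {x..y} (\<lambda>t. (cmod (U t))\<^sup>2 - I / (y - x))"
    by (intro set_integral_diff L2_sq_set_integrable U set_integral_Icc_const)
  have fi: "integrable lborel f" using int by (simp add: f_def[abs_def] set_integrable_def)
  have "(LINT t:{x..y}|lborel. (cmod (U t))\<^sup>2 - I / (y - x)) = I - I"
    using set_integral_diff(2)[OF L2_sq_set_integrable[OF U, of x y] set_integral_Icc_const(2)[of x y "I / (y - x)"]] xy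
    by (simp add: set_integral_Icc_const I_def)
  then have "(LINT t|lborel. f t) = 0" by (simp add: f_def set_lebesgue_integral_def)
  moreover have "0 \<le> f t" for t using gt[of t] by (auto simp: f_def split: split_indicator)
  ultimately have "AE t in lborel. f t = 0" using integral_nonneg_eq_0_iff_AE[OF fi] by simp
  then have "AE t in lborel. t \<notin> {x..y}"
    by eventually_elim (use gt in \<open>force simp: f_def split: split_indicator_asm\<close>)
  then have "emeasure lborel {x..y} = 0"
    by (subst (asm) AE_iff_measurable[where N="{x..y}"]) auto
  then show False using xy by simp
qed

text \<open>Little mass fits outside the well, so just outside each edge there is a point \<open>y1\<close>, \<open>y2\<close> at which \<open>U\<close> is
  small. With the interior zeros of \<open>U\<close> these points delimit \<open>K\<close> intervals of length at most
  \<open>(b - a) * (1 / K + 4 * \<eta>)\<close>, and \<open>Robin_inequality\<close> applies to each of them.\<close>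

lemma well_lower_bound:
  assumes U: "is_primitive U g" and L2: "U \<in> L2" "g \<in> L2" "sqrt_potential_mult V U \<in> L2"
    and V: "\<And>x. 0 \<le> V x" and ab: "a < b" and h: "h > 0" and K: "1 \<le> K"
    and \<eta>: "0 < \<eta>" and \<theta>: "0 < \<theta>" "\<theta> * (1 / real K + 4 * \<eta>) < pi" and W: "W > 0" and M: "M \<ge> 0"
  defines "\<epsilon> \<equiv> h\<^sup>2 / (b - a)\<^sup>2" and "N \<equiv> (L2_norm U)\<^sup>2"
    and "E \<equiv> h\<^sup>2 * (L2_norm g)\<^sup>2 + (L2_norm (sqrt_potential_mult V U))\<^sup>2"
    and "\<tau> \<equiv> tan (\<theta> * (1 / real K + 4 * \<eta>) / 2)"
  assumes outside: "\<And>x. x \<le> a - \<eta> * (b - a) \<or> b + \<eta> * (b - a) \<le> x \<Longrightarrow> W * \<epsilon> \<le> V x"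
    and nodes: "\<And>j. 1 \<le> j \<Longrightarrow> j < K \<Longrightarrow> U (a + real j * (b - a) / real K) = 0"
    and energy: "E \<le> M * \<epsilon> * N"
  shows "(\<theta>\<^sup>2 * (1 - M / W) - 2 * \<theta> * \<tau> * M / (W * \<eta>)) * \<epsilon> * N \<le> E"
proof -
  define l where "l = b - a"
  have l: "l > 0" using ab by (simp add: l_def)
  have \<epsilon>: "\<epsilon> > 0" using h ab by (simp add: \<epsilon>_def)
  have \<eta>l: "\<eta> * l > 0" using \<eta> l by simp
  define u where "u t = (cmod (U t))\<^sup>2" for t
  have ui: "integrable lborel u" using L2_sq_integrable[OF L2(1)] by (simp add: u_def[abs_def])
  have us: "set_integrable lborel {x..y} u" for x y using L2_sq_set_integrable[OF L2(1)] by (simp add: u_def[abs_def])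
  have Vu: "(cmod (sqrt_potential_mult V U t))\<^sup>2 = V t * u t" for t
    using V[of t] by (simp add: sqrt_potential_mult_def norm_mult power_mult_distrib u_def)
  have Nu: "N = (LINT t|lborel. u t)" by (simp add: N_def L2_norm_def u_def)
  have pot: "W * \<epsilon> * (LINT t|lborel. f t) \<le> M * \<epsilon> * N"
    if f: "integrable lborel f" "\<And>t. f t \<le> u t" "\<And>t. a - \<eta> * l < t \<Longrightarrow> t < b + \<eta> * l \<Longrightarrow> f t \<le> 0" for f
  proof -
    have "W * \<epsilon> * (LINT t|lborel. f t) = (LINT t|lborel. W * \<epsilon> * f t)" by simp
    also have "\<dots> \<le> (LINT t|lborel. (cmod (sqrt_potential_mult V U t))\<^sup>2)"
    proof (rule integral_mono)
      fix t
      have u0: "0 \<le> u t" by (simp add: u_def)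
      show "W * \<epsilon> * f t \<le> (cmod (sqrt_potential_mult V U t))\<^sup>2"
      proof (cases "a - \<eta> * l < t \<and> t < b + \<eta> * l")
        case True
        then have "W * \<epsilon> * f t \<le> 0" using f(3) W \<epsilon> by (simp add: mult_le_0_iff)
        then show ?thesis by (rule order_trans) simp
      next
        case False
        then have "W * \<epsilon> \<le> V t" using outside[of t] by (auto simp: l_def)
        then have "W * \<epsilon> * u t \<le> V t * u t" by (intro mult_right_mono u0)
        moreover have "W * \<epsilon> * f t \<le> W * \<epsilon> * u t" using W \<epsilon> by (intro mult_left_mono f) auto
        ultimately show ?thesis unfolding Vu by linarith
      qed
    qed (use f L2_sq_integrable[OF L2(3)] in auto)
    also have "\<dots> \<le> E" by (simp add: E_def L2_norm_def)
    finally show ?thesis using energy by linarith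
  qed
  have pot': "(LINT t|lborel. f t) \<le> M * N / W"
    if f: "integrable lborel f" "\<And>t. f t \<le> u t" "\<And>t. a - \<eta> * l < t \<Longrightarrow> t < b + \<eta> * l \<Longrightarrow> f t \<le> 0" for f
  proof -
    have "(W * (LINT t|lborel. f t)) * \<epsilon> \<le> (M * N) * \<epsilon>" using pot[OF f] by (simp add: mult_ac)
    then have "W * (LINT t|lborel. f t) \<le> M * N" using \<epsilon> by (simp only: mult_le_cancel_right_pos)
    then show ?thesis using W by (simp add: field_simps)
  qed
  have edge: "\<exists>t\<in>{x..y}. u t \<le> M * N / (W * \<eta> * l)" if xy: "y - x = \<eta> * l" "y \<le> a - \<eta> * l \<or> b + \<eta> * l \<le> x" for x y
  proof -
    have "x < y" using xy \<eta>l by linarith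
    from exists_small_value[OF L2(1) this] obtain t where t: "t \<in> {x..y}" "\<eta> * l * u t \<le> (LINT t:{x..y}|lborel. u t)"
      unfolding xy(1) u_def by blast
    note t(2)
    also have "(LINT t:{x..y}|lborel. u t) \<le> M * N / W"
      unfolding set_lebesgue_integral_def
      by (rule pot') (use us[of x y] xy in \<open>auto simp: set_integrable_def u_def split: split_indicator\<close>)
    finally have "\<eta> * l * u t \<le> M * N / W" .
    then have "u t \<le> M * N / W / (\<eta> * l)" by (subst pos_le_divide_eq[OF \<eta>l]) (simp add: mult.commute)
    then show ?thesis using t(1) by (auto simp: mult.assoc)
  qed
  obtain y1 where y1: "y1 \<in> {a - 2 * (\<eta> * l)..a - \<eta> * l}" "u y1 \<le> M * N / (W * \<eta> * l)"
    using edge[of "a - \<eta> * l" "a - 2 * (\<eta> * l)"] by auto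
  obtain y2 where y2: "y2 \<in> {b + \<eta> * l..b + 2 * (\<eta> * l)}" "u y2 \<le> M * N / (W * \<eta> * l)"
    using edge[of "b + 2 * (\<eta> * l)" "b + \<eta> * l"] by auto
  define s where "s j = (if j = 0 then y1 else if j = K then y2 else a + real j * l / real K)" for j
  have s0K: "s 0 = y1" "s K = y2" using K by (auto simp: s_def)
  have rK: "real K > 0" using K by simp
  have step: "s j < s (Suc j) \<and> s (Suc j) - s j \<le> l * (1 / real K + 4 * \<eta>)" if j: "j < K" for j
  proof -
    define q where "q i = a + real i * l / real K" for i
    have q: "q 0 = a" "q K = b" "q (Suc j) = q j + l / real K" using rK by (auto simp: q_def l_def add_divide_distrib distrib_right)
    have lo: "q j - 2 * (\<eta> * l) \<le> s j" "s j \<le> q j" using y1 j \<eta>l q(1) by (auto simp: s_def q_def)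
    have hi: "q (Suc j) \<le> s (Suc j)" "s (Suc j) \<le> q (Suc j) + 2 * (\<eta> * l)"
      using y2 \<eta>l q(2) by (auto simp: s_def q_def)
    have "l / real K > 0" using l rK by simp
    then have "s j < s (Suc j)" using lo hi q(3) by linarith
    moreover have "s (Suc j) - s j \<le> l / real K + 4 * (\<eta> * l)" using lo hi q(3) by linarith
    ultimately show ?thesis by (simp add: algebra_simps)
  qed
  \<comment> \<open>\<open>\<theta>\<close> is measured in units of the inverse width of the well\<close>
  define \<Theta> where "\<Theta> = \<theta> / l"
  have \<Theta>: "\<Theta> > 0" "\<Theta> * l = \<theta>" using \<theta> l by (auto simp: \<Theta>_def)
  have \<tau>0: "0 \<le> \<tau>"
  proof -
    have "0 < \<theta> * (1 / real K + 4 * \<eta>) / 2" using \<theta>(1) rK \<eta> by (intro divide_pos_pos mult_pos_pos add_pos_pos) auto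
    then show ?thesis unfolding \<tau>_def using \<theta>(2) by (intro less_imp_le tan_gt_zero) auto
  qed
  have piece: "\<Theta>\<^sup>2 * (LINT t:{s j..s (Suc j)}|lborel. u t) \<le> (LINT t:{s j..s (Suc j)}|lborel. (cmod (g t))\<^sup>2)
      + \<Theta> * \<tau> * (u (s j) + u (s (Suc j)))" if j: "j < K" for j
  proof -
    define d where "d = s (Suc j) - s j"
    have d: "0 < d" "d \<le> l * (1 / real K + 4 * \<eta>)" using step[OF j] by (auto simp: d_def)
    have le: "\<Theta> * d \<le> \<theta> * (1 / real K + 4 * \<eta>)"
    proof -
      have "\<Theta> * d \<le> \<Theta> * (l * (1 / real K + 4 * \<eta>))" using d \<Theta>(1) by (intro mult_left_mono) auto
      then show ?thesis using \<Theta>(2) by (simp add: mult.assoc[symmetric])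
    qed
    have "\<Theta>\<^sup>2 * (LINT t:{s j..s (Suc j)}|lborel. u t) \<le> (LINT t:{s j..s (Suc j)}|lborel. (cmod (g t))\<^sup>2)
      + \<Theta> * tan (\<Theta> * (s (Suc j) - s j) / 2) * (u (s j) + u (s (Suc j)))"
      unfolding u_def using step[OF j] \<Theta>(1) le \<theta>(2)
      by (intro Robin_inequality[OF U L2(1,2)]) (auto simp: d_def)
    moreover have "tan (\<Theta> * d / 2) \<le> \<tau>"
      unfolding \<tau>_def
    proof (rule tan_mono_le)
      show "- (pi / 2) < \<Theta> * d / 2" using \<Theta>(1) d(1) pi_gt_zero mult_pos_pos[of \<Theta> d] by linarith
    qed (use le \<theta>(2) in auto)
    then have "\<Theta> * tan (\<Theta> * d / 2) * (u (s j) + u (s (Suc j))) \<le> \<Theta> * \<tau> * (u (s j) + u (s (Suc j)))"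
      using \<Theta>(1) by (intro mult_right_mono mult_left_mono) (auto simp: u_def)
    ultimately show ?thesis unfolding d_def by linarith
  qed
  have sumu: "(\<Sum>j<K. u (s j) + u (s (Suc j))) \<le> 2 * (M * N / (W * \<eta> * l))"
  proof -
    have z: "u (s j) = 0" if "0 < j" "j < K" for j using nodes[of j] that by (simp add: s_def u_def l_def)
    have "(\<Sum>j<K. u (s j)) = (\<Sum>j\<in>{0}. u (s j))"
      by (rule sum.mono_neutral_right) (use K z in auto)
    moreover have "(\<Sum>j<K. u (s (Suc j))) = (\<Sum>j\<in>{K - 1}. u (s (Suc j)))"
    proof (rule sum.mono_neutral_right)
      show "\<forall>i\<in>{..<K} - {K - 1}. u (s (Suc i)) = 0"
      proof
        fix i assume "i \<in> {..<K} - {K - 1}"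
        then have "Suc i < K" by auto
        then show "u (s (Suc i)) = 0" by (intro z) auto
      qed
    qed (use K in auto)
    ultimately show ?thesis using y1(2) y2(2) K s0K by (simp add: sum.distrib)
  qed
  have "\<Theta>\<^sup>2 * (LINT t:{y1..y2}|lborel. u t) = (\<Sum>j<K. \<Theta>\<^sup>2 * (LINT t:{s j..s (Suc j)}|lborel. u t))"
    using set_integral_Icc_nodes[of K s u] step us s0K by (simp add: sum_distrib_left less_imp_le)
  also have "\<dots> \<le> (\<Sum>j<K. (LINT t:{s j..s (Suc j)}|lborel. (cmod (g t))\<^sup>2) + \<Theta> * \<tau> * (u (s j) + u (s (Suc j))))"
    by (intro sum_mono piece) simp
  also have "\<dots> = (\<Sum>j<K. LINT t:{s j..s (Suc j)}|lborel. (cmod (g t))\<^sup>2) + \<Theta> * \<tau> * (\<Sum>j<K. u (s j) + u (s (Suc j)))"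
    by (simp only: sum.distrib sum_distrib_left[symmetric])
  also have "(\<Sum>j<K. LINT t:{s j..s (Suc j)}|lborel. (cmod (g t))\<^sup>2) = (LINT t:{y1..y2}|lborel. (cmod (g t))\<^sup>2)"
    using set_integral_Icc_nodes[of K s "\<lambda>t. (cmod (g t))\<^sup>2"] step L2_sq_set_integrable[OF L2(2)] s0K by (simp add: less_imp_le)
  also have "\<dots> + \<Theta> * \<tau> * (\<Sum>j<K. u (s j) + u (s (Suc j))) \<le> (L2_norm g)\<^sup>2 + \<Theta> * \<tau> * (2 * (M * N / (W * \<eta> * l)))"
    using \<Theta>(1) \<tau>0 by (intro add_mono L2_integral_split_le L2 mult_left_mono sumu) auto
  finally have 1: "\<Theta>\<^sup>2 * (LINT t:{y1..y2}|lborel. u t) \<le> (L2_norm g)\<^sup>2 + \<Theta> * \<tau> * (2 * (M * N / (W * \<eta> * l)))" .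
  have "N - (LINT t:{y1..y2}|lborel. u t) = (LINT t|lborel. u t - indicat_real {y1..y2} t *\<^sub>R u t)"
    using ui us[of y1 y2] by (simp add: Nu set_integrable_def set_lebesgue_integral_def)
  also have "\<dots> \<le> M * N / W"
  proof (rule pot')
    show "integrable lborel (\<lambda>t. u t - indicat_real {y1..y2} t *\<^sub>R u t)"
      using ui us[of y1 y2] by (auto simp: set_integrable_def)
  qed (use y1 y2 in \<open>auto simp: u_def split: split_indicator\<close>)
  finally have "N * (1 - M / W) \<le> (LINT t:{y1..y2}|lborel. u t)" by (simp add: algebra_simps)
  then have "\<Theta>\<^sup>2 * (N * (1 - M / W)) \<le> (L2_norm g)\<^sup>2 + \<Theta> * \<tau> * (2 * (M * N / (W * \<eta> * l)))"
    using 1 mult_left_mono[of "N * (1 - M / W)" "LINT t:{y1..y2}|lborel. u t" "\<Theta>\<^sup>2"] by simp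
  then have "l\<^sup>2 * \<epsilon> * (\<Theta>\<^sup>2 * (N * (1 - M / W))) \<le> l\<^sup>2 * \<epsilon> * ((L2_norm g)\<^sup>2 + \<Theta> * \<tau> * (2 * (M * N / (W * \<eta> * l))))"
    using \<epsilon> by (intro mult_left_mono) auto
  moreover have "l\<^sup>2 * \<epsilon> * (\<Theta>\<^sup>2 * (N * (1 - M / W))) = \<theta>\<^sup>2 * (1 - M / W) * \<epsilon> * N"
    unfolding \<Theta>(2)[symmetric] by (simp add: power_mult_distrib mult_ac)
  moreover have "l\<^sup>2 * \<epsilon> * (\<Theta> * \<tau> * (2 * (M * N / (W * \<eta> * l)))) = 2 * \<theta> * \<tau> * M / (W * \<eta>) * \<epsilon> * N"
    unfolding \<Theta>(2)[symmetric] using l by (simp add: power2_eq_square field_simps)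
  moreover have "l\<^sup>2 * \<epsilon> * (L2_norm g)\<^sup>2 \<le> E"
    using l by (simp add: \<epsilon>_def l_def E_def)
  ultimately show ?thesis by (simp add: left_diff_distrib distrib_left)
qed

text \<open>First \<open>\<theta>\<close> is taken slightly below \<open>\<pi> K\<close>, then \<open>\<eta>\<close> so small that the angle stays below \<open>\<pi>\<close>, and last \<open>W\<close>
  so large that the remaining terms are negligible.\<close>

lemma lower_bound_constants:
  assumes K: "1 \<le> K" and \<delta>: "0 < \<delta>"
  defines "M \<equiv> (pi * real K)\<^sup>2"
  shows "\<exists>\<theta> \<eta> W. 0 < \<theta> \<and> 0 < \<eta> \<and> \<eta> < 1 \<and> \<theta> * (1 / real K + 4 * \<eta>) < pi \<and> 0 < W \<and>
     M - \<delta> \<le> \<theta>\<^sup>2 * (1 - M / W) - 2 * \<theta> * tan (\<theta> * (1 / real K + 4 * \<eta>) / 2) * M / (W * \<eta>)"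
proof -
  have rK: "real K \<ge> 1" using K by simp
  have M: "M > 0" using rK by (simp add: M_def)
  define s where "s = min (1/2) (\<delta> / (4 * M))"
  have s: "0 < s" "s \<le> 1/2" "s * (4 * M) \<le> \<delta>" using \<delta> M by (auto simp: s_def min_def field_simps)
  define \<theta> where "\<theta> = pi * real K * (1 - s)"
  define \<eta> where "\<eta> = s / (8 * real K)"
  have \<theta>: "\<theta> > 0" using s rK by (simp add: \<theta>_def)
  have \<eta>: "0 < \<eta>" "\<eta> < 1" using s rK by (auto simp: \<eta>_def field_simps)
  have ang: "\<theta> * (1 / real K + 4 * \<eta>) < pi"
  proof -
    have "\<theta> * (1 / real K + 4 * \<eta>) = pi * ((1 - s) * (1 + s / 2))"
      using rK by (simp add: \<theta>_def \<eta>_def field_simps)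
    moreover have "(1 - s) * (1 + s / 2) = 1 - s / 2 - s * s / 2" by (simp add: field_simps)
    then have "(1 - s) * (1 + s / 2) < 1"
      using s(1) mult_pos_pos[OF s(1) s(1)] by linarith
    ultimately show ?thesis by simp
  qed
  have \<theta>2: "M - \<delta> / 2 \<le> \<theta>\<^sup>2"
  proof -
    have "\<theta>\<^sup>2 = M * (1 - s)\<^sup>2" by (simp add: \<theta>_def M_def power_mult_distrib)
    moreover have "1 - 2 * s \<le> (1 - s)\<^sup>2" by (simp add: power2_eq_square algebra_simps)
    ultimately have "M * (1 - 2 * s) \<le> \<theta>\<^sup>2" using M by simp
    then show ?thesis using s(3) by (simp add: algebra_simps)
  qed
  define X where "X = \<theta>\<^sup>2 * M + 2 * \<theta> * tan (\<theta> * (1 / real K + 4 * \<eta>) / 2) * M / \<eta>"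
  define W where "W = 2 * \<bar>X\<bar> / \<delta> + 1"
  have W: "W > 0" using \<delta> by (simp add: W_def add_nonneg_pos)
  have "X \<le> W * (\<delta> / 2)" using \<delta> by (simp add: W_def algebra_simps)
  then have XW: "X / W \<le> \<delta> / 2" using W by (simp add: field_simps)
  have "\<theta>\<^sup>2 * (1 - M / W) - 2 * \<theta> * tan (\<theta> * (1 / real K + 4 * \<eta>) / 2) * M / (W * \<eta>) = \<theta>\<^sup>2 - X / W"
    using W \<eta> by (simp add: X_def field_simps)
  then show ?thesis using \<theta> \<eta> ang W XW \<theta>2 by (intro exI[of _ \<theta>] exI[of _ \<eta>] exI[of _ W]) auto
qed

section \<open>The semiclassical limit\<close>

text \<open>For every \<open>h\<close> a complete system of eigenvectors below the fixed level \<open>c\<close> is chosen; only finitely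
  many of its members, with eigenvalues of order \<open>eps h\<close>, matter in the limit.\<close>

locale semiclassical = flat_well +
  fixes c :: real and \<delta>m \<delta>p :: "real \<Rightarrow> real"
    and m :: "real \<Rightarrow> nat" and e :: "real \<Rightarrow> nat \<Rightarrow> l2" and p :: "real \<Rightarrow> nat \<Rightarrow> l2 \<times> l2"
    and \<mu> :: "real \<Rightarrow> nat \<Rightarrow> real"
  assumes edges: "\<forall>\<^sub>F h in at_right 0. well_edges V h (\<delta>m h, \<delta>p h)"
    and sys: "0 < h \<Longrightarrow> schroedinger_system h V c (m h) (e h) (p h) (\<mu> h)"
    and c_pos: "0 < c"
begin

definition eps :: "real \<Rightarrow> real" where "eps h = h\<^sup>2 / (\<delta>p h - \<delta>m h)\<^sup>2"

definition trial :: "nat \<Rightarrow> real \<Rightarrow> l2" where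
  "trial k h = to_l2 (dirichlet_mode (Suc k) (\<delta>m h) (\<delta>p h))"

text \<open>The image of the trial function in the form space.\<close>

definition trial_image :: "nat \<Rightarrow> real \<Rightarrow> l2 \<times> l2" where
  "trial_image k h = (to_l2 (\<lambda>x. of_real h * mode_deriv (Suc k) (\<delta>m h) (\<delta>p h) x),
     to_l2 (sqrt_potential_mult V (dirichlet_mode (Suc k) (\<delta>m h) (\<delta>p h))))"

abbreviation level :: "nat \<Rightarrow> real" where "level k \<equiv> (pi * real (Suc k))\<^sup>2"

lemma shape:
  assumes "0 < \<eta>" "\<eta> < 1"
  shows "\<forall>\<^sub>F h in at_right 0. 0 < h \<and> \<delta>m h < \<delta>p h \<and> 0 < eps h \<and>
     (\<forall>x. x \<le> \<delta>m h - \<eta> * (\<delta>p h - \<delta>m h) \<or> \<delta>p h + \<eta> * (\<delta>p h - \<delta>m h) \<le> x \<longrightarrow> W * eps h \<le> V x) \<and>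
     (\<forall>x\<in>{\<delta>m h + \<eta> * (\<delta>p h - \<delta>m h)..\<delta>p h - \<eta> * (\<delta>p h - \<delta>m h)}. V x \<le> \<eta> * eps h) \<and>
     (\<forall>x\<in>{\<delta>m h..\<delta>p h}. V x \<le> eps h)"
  using edges well_shape[OF assms, of W] eventually_at_right_less[of 0]
proof eventually_elim
  case (elim h)
  then have "\<delta>m h < 0" "0 < \<delta>p h" by (auto simp: well_edges_def)
  then have "\<delta>m h < \<delta>p h" "0 < eps h" using elim(3) by (auto simp: eps_def)
  then show ?case using elim unfolding eps_def by blast
qed

lemma eps_small: assumes "0 < x" shows "\<forall>\<^sub>F h in at_right 0. eps h < x"
  using energy_scale_small[OF assms] edges by eventually_elim (auto simp: eps_def)

lemma trial_modes:
  assumes \<delta>: "0 < \<delta>"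
  shows "\<forall>\<^sub>F h in at_right 0. 0 < h \<and> 0 < eps h \<and> (\<forall>i. (trial i h, trial_image i h) \<in> schroedinger_setting.graph h V) \<and>
    (\<forall>i j. cinner (trial i h) (trial j h) = (if i = j then 1 else 0)) \<and>
    (\<forall>cs. (norm (\<Sum>i\<le>k. cscale (cs i) (trial_image i h)))\<^sup>2 \<le> (level k + \<delta>) * eps h * (\<Sum>i\<le>k. (cmod (cs i))\<^sup>2))"
proof -
  define \<eta> where "\<eta> = min (1/2) (\<delta> / (6 * real (Suc k)))"
  have le: "\<eta> \<le> \<delta> / (6 * real (Suc k))" by (simp only: \<eta>_def min.cobounded2)
  have "\<eta> * (6 * real (Suc k)) \<le> \<delta>" by (rule pos_le_divide_eq[THEN iffD1, OF _ le]) simp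
  then have "6 * \<eta> * real (Suc k) \<le> \<delta>" by (simp only: mult_ac)
  moreover have "0 < \<eta>" "\<eta> < 1" using \<delta> by (auto simp: \<eta>_def)
  ultimately have \<eta>: "0 < \<eta>" "\<eta> < 1" "6 * \<eta> * real (Suc k) \<le> \<delta>" by blast+
  show ?thesis using shape[OF \<eta>(1,2), of 0]
  proof eventually_elim
    case (elim h)
    define a where "a = \<delta>m h"
    define b where "b = \<delta>p h"
    have h: "0 < h" and ab: "a < b" and \<epsilon>: "0 < eps h" using elim by (auto simp: a_def b_def)
    interpret schroedinger_system h V c "m h" "e h" "p h" "\<mu> h" by (rule sys[OF h])
    have 1: "(trial i h, trial_image i h) \<in> graph" for i
      unfolding trial_def trial_image_def a_def[symmetric] b_def[symmetric]
      by (intro graph_of_primitive mode_primitive[OF ab] mode_L2 mode_potential_L2 continuous nonneg)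
    have 2: "cinner (trial i h) (trial j h) = (if i = j then 1 else 0)" for i j
      unfolding trial_def a_def[symmetric] b_def[symmetric]
      by (simp add: to_l2_cinner mode_L2 mode_inner(1)[OF ab])
    have 3: "(norm (\<Sum>i\<le>k. cscale (cs i) (trial_image i h)))\<^sup>2 \<le> (level k + \<delta>) * eps h * (\<Sum>i\<le>k. (cmod (cs i))\<^sup>2)" for cs
    proof -
      define S where "S = (\<Sum>i\<le>k. (cmod (cs i))\<^sup>2)"
      have S0: "0 \<le> S" by (simp add: S_def sum_nonneg)
      define d where "d i = to_l2 (\<lambda>x. of_real h * mode_deriv (Suc i) a b x)" for i
      have dd: "cinner (d i) (d j) = (if i = j then of_real (h\<^sup>2 * (mode_freq (Suc i) a b)\<^sup>2) else 0)" for i j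
        by (simp add: d_def to_l2_cinner L2_scale mode_L2 L2_inner_scale_left L2_inner_scale_right
            mode_inner(2)[OF ab] power2_eq_square)
      have "(norm ((\<Sum>i<Suc k. cscale (cs i) (d i)) + 0))\<^sup>2
          = (\<Sum>i<Suc k. (cmod (cs i))\<^sup>2 * (h\<^sup>2 * (mode_freq (Suc i) a b)\<^sup>2)) + (norm (0::l2))\<^sup>2"
        by (rule Pythagoras_system) (auto simp: dd)
      then have "(norm (\<Sum>i\<le>k. cscale (cs i) (d i)))\<^sup>2 = (\<Sum>i\<le>k. (cmod (cs i))\<^sup>2 * (h\<^sup>2 * (mode_freq (Suc i) a b)\<^sup>2))"
        by (simp add: lessThan_Suc_atMost)
      also have "\<dots> \<le> (\<Sum>i\<le>k. (cmod (cs i))\<^sup>2 * (level k * eps h))"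
      proof (intro sum_mono mult_left_mono)
        fix i assume "i \<in> {..k}"
        then have "(pi * real (Suc i))\<^sup>2 \<le> level k" by (intro power_mono mult_left_mono) auto
        then have "(pi * real (Suc i))\<^sup>2 * eps h \<le> level k * eps h" using \<epsilon> by (intro mult_right_mono) auto
        moreover have "h\<^sup>2 * (mode_freq (Suc i) a b)\<^sup>2 = (pi * real (Suc i))\<^sup>2 * eps h"
          by (simp add: mode_freq_def eps_def a_def b_def power_divide)
        ultimately show "h\<^sup>2 * (mode_freq (Suc i) a b)\<^sup>2 \<le> level k * eps h" by simp
      qed auto
      also have "\<dots> = level k * eps h * S" by (simp add: S_def sum_distrib_left mult_ac)
      finally have kin: "(norm (\<Sum>i\<le>k. cscale (cs i) (d i)))\<^sup>2 \<le> level k * eps h * S" .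
      have "(norm (\<Sum>i\<le>k. cscale (cs i) (to_l2 (sqrt_potential_mult V (dirichlet_mode (Suc i) a b)))))\<^sup>2
          \<le> 6 * \<eta> * real (Suc k) * eps h * S"
        unfolding S_def
        by (rule mode_potential_energy[OF ab continuous nonneg \<eta>(1)]) (use elim \<epsilon> in \<open>auto simp: a_def b_def\<close>)
      also have "\<dots> \<le> \<delta> * eps h * S" using \<eta>(3) \<epsilon> S0 by (intro mult_right_mono) auto
      finally have pot: "(norm (\<Sum>i\<le>k. cscale (cs i) (to_l2 (sqrt_potential_mult V (dirichlet_mode (Suc i) a b)))))\<^sup>2 \<le> \<delta> * eps h * S" .
      have "(\<Sum>i\<le>k. cscale (cs i) (trial_image i h)) = (\<Sum>i\<le>k. cscale (cs i) (d i),
          \<Sum>i\<le>k. cscale (cs i) (to_l2 (sqrt_potential_mult V (dirichlet_mode (Suc i) a b))))"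
        by (simp add: trial_image_def d_def a_def b_def cscale_Pair sum_Pair)
      then have "(norm (\<Sum>i\<le>k. cscale (cs i) (trial_image i h)))\<^sup>2 = (norm (\<Sum>i\<le>k. cscale (cs i) (d i)))\<^sup>2
          + (norm (\<Sum>i\<le>k. cscale (cs i) (to_l2 (sqrt_potential_mult V (dirichlet_mode (Suc i) a b)))))\<^sup>2"
        by (simp add: norm_prod_def)
      then show ?thesis using kin pot unfolding S_def[symmetric] by (simp add: algebra_simps)
    qed
    show ?case using h \<epsilon> 1 2 3 by blast
  qed
qed

lemma eigenvalue_upper:
  assumes \<delta>: "0 < \<delta>"
  shows "\<forall>\<^sub>F h in at_right 0. k < m h \<and> \<mu> h k \<le> (level k + \<delta>) * eps h"
proof -
  have E\<delta>: "0 < level k + \<delta>" using \<delta> by (intro add_nonneg_pos) auto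
  then have "0 < c / (level k + \<delta>)" using c_pos by simp
  from trial_modes[OF \<delta>, of k] eps_small[OF this] show ?thesis
  proof eventually_elim
    case (elim h)
    then have h: "0 < h" by blast
    interpret schroedinger_system h V c "m h" "e h" "p h" "\<mu> h" by (rule sys[OF h])
    have sc: "(level k + \<delta>) * eps h < c" using elim(2) E\<delta> by (simp add: pos_less_divide_eq mult.commute)
    have "(\<Sum>i\<le>k. cscale (a i) (trial i h)) \<noteq> 0 \<and>
       (norm (\<Sum>i\<le>k. cscale (a i) (trial_image i h)))\<^sup>2 \<le> (level k + \<delta>) * eps h * (norm (\<Sum>i\<le>k. cscale (a i) (trial i h)))\<^sup>2"
      if a: "\<exists>i\<le>k. a i \<noteq> 0" for a
    proof -
      have "(norm ((\<Sum>i<Suc k. cscale (a i) (trial i h)) + 0))\<^sup>2 = (\<Sum>i<Suc k. (cmod (a i))\<^sup>2 * 1) + (norm (0::l2))\<^sup>2"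
        by (rule Pythagoras_system) (use elim(1) in auto)
      then have n: "(norm (\<Sum>i\<le>k. cscale (a i) (trial i h)))\<^sup>2 = (\<Sum>i\<le>k. (cmod (a i))\<^sup>2)"
        by (simp add: lessThan_Suc_atMost)
      obtain i where "i \<le> k" "a i \<noteq> 0" using a by blast
      then have "0 < (\<Sum>i\<le>k. (cmod (a i))\<^sup>2)" by (intro sum_pos2[of _ i]) auto
      then have "(\<Sum>i\<le>k. cscale (a i) (trial i h)) \<noteq> 0" using n by auto
      then show ?thesis using elim(1) unfolding n by blast
    qed
    with minmax_upper_bound[of k "\<lambda>i. trial i h" "\<lambda>i. trial_image i h" "(level k + \<delta>) * eps h"] elim(1) sc
    show ?case by blast
  qed
qed

text \<open>Among the combinations of the first \<open>k + 1\<close> eigenfunctions one vanishes at the \<open>k\<close> points that divide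
  the well into equal parts, and its energy is at most \<open>\<mu> h k\<close> times its squared norm.\<close>

lemma eigenvalue_lower:
  assumes \<delta>: "0 < \<delta>"
  shows "\<forall>\<^sub>F h in at_right 0. (level k - \<delta>) * eps h \<le> \<mu> h k"
proof -
  obtain \<theta> \<eta> W where c: "0 < \<theta>" "0 < \<eta>" "\<eta> < 1" "\<theta> * (1 / real (Suc k) + 4 * \<eta>) < pi" "0 < W"
    "level k - \<delta> \<le> \<theta>\<^sup>2 * (1 - level k / W) - 2 * \<theta> * tan (\<theta> * (1 / real (Suc k) + 4 * \<eta>) / 2) * level k / (W * \<eta>)"
    using lower_bound_constants[of "Suc k" \<delta>] \<delta> by auto
  show ?thesis using shape[OF c(2,3), of W] eigenvalue_upper[OF zero_less_one, of k]
  proof eventually_elim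
    case (elim h)
    define a where "a = \<delta>m h"
    define b where "b = \<delta>p h"
    have h: "0 < h" and ab: "a < b" and \<epsilon>: "0 < eps h" and km: "k < m h" using elim by (auto simp: a_def b_def)
    interpret schroedinger_system h V c "m h" "e h" "p h" "\<mu> h" by (rule sys[OF h])
    show "(level k - \<delta>) * eps h \<le> \<mu> h k"
    \<comment> \<open>in the second case the energy satisfies the a priori bound of \<open>well_lower_bound\<close>\<close>
    proof (cases "level k * eps h \<le> \<mu> h k")
      case True
      moreover have "(level k - \<delta>) * eps h \<le> level k * eps h" using \<delta> \<epsilon> by (intro mult_right_mono) auto
      ultimately show ?thesis by linarith
    next
      case False
      have "\<exists>U g. is_primitive U g \<and> U \<in> L2 \<and> g \<in> L2 \<and> sqrt_potential_mult V U \<in> L2 \<and> e h i = to_l2 U" if "i \<le> k" for i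
      proof -
        have "(e h i, p h i) \<in> graph" using that km by (intro ep_G) auto
        then show ?thesis by (rule graph_cases) blast
      qed
      then obtain U g where Ug: "\<And>i. i \<le> k \<Longrightarrow> is_primitive (U i) (g i)" "\<And>i. i \<le> k \<Longrightarrow> U i \<in> L2"
        "\<And>i. i \<le> k \<Longrightarrow> g i \<in> L2" "\<And>i. i \<le> k \<Longrightarrow> sqrt_potential_mult V (U i) \<in> L2" "\<And>i. i \<le> k \<Longrightarrow> e h i = to_l2 (U i)"
        by metis
      define node where "node j = a + real j * (b - a) / real (Suc k)" for j
      obtain cs where cs: "\<exists>i<Suc k. cs i \<noteq> 0" "\<And>j. j < k \<Longrightarrow> (\<Sum>i<Suc k. cs i * U i (node (Suc j))) = 0"
        using homogeneous_system_solvable[of k "Suc k" "\<lambda>i j. U i (node (Suc j))"] by blast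
      define u where "u x = (\<Sum>i\<le>k. cs i * U i x)" for x
      define u' where "u' x = (\<Sum>i\<le>k. cs i * g i x)" for x
      have pr: "is_primitive u u'" unfolding u_def[abs_def] u'_def[abs_def] by (intro primitive_sum Ug) auto
      have uL: "u \<in> L2" unfolding u_def[abs_def] by (intro L2_sum L2_scale Ug) auto
      have u'L: "u' \<in> L2" unfolding u'_def[abs_def] by (intro L2_sum L2_scale Ug) auto
      have "sqrt_potential_mult V u = (\<lambda>x. \<Sum>i\<le>k. cs i * sqrt_potential_mult V (U i) x)"
        by (rule ext) (simp add: sqrt_potential_mult_def u_def sum_distrib_left mult_ac)
      also have "\<dots> \<in> L2" by (intro L2_sum L2_scale Ug) auto
      finally have VuL: "sqrt_potential_mult V u \<in> L2" .
      have "(\<Sum>i\<le>k. cscale (cs i) (e h i)) = (\<Sum>i\<le>k. to_l2 (\<lambda>x. cs i * U i x))"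
        by (intro sum.cong refl) (use Ug in \<open>simp add: to_l2_cscale\<close>)
      also have "\<dots> = to_l2 u" unfolding u_def[abs_def] by (intro to_l2_sum L2_scale Ug) auto
      finally have sum_u: "(\<Sum>i\<le>k. cscale (cs i) (e h i)) = to_l2 u" .
      note span = span_upper_bound[OF km, of cs, unfolded sum_u]
      have r: "(\<Sum>i\<le>k. cscale (cs i) (p h i)) = (to_l2 (\<lambda>x. of_real h * u' x), to_l2 (sqrt_potential_mult V u))"
        by (rule graph_functional[OF span(1) graph_of_primitive[OF pr uL u'L VuL]])
      have N: "(norm (to_l2 u))\<^sup>2 = (L2_norm u)\<^sup>2" using uL by (simp add: norm_to_l2)
      have en: "h\<^sup>2 * (L2_norm u')\<^sup>2 + (L2_norm (sqrt_potential_mult V u))\<^sup>2 \<le> \<mu> h k * (L2_norm u)\<^sup>2"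
        using span(3) unfolding r norm_graph[OF u'L VuL] N .
      obtain i where i: "i < Suc k" "cs i \<noteq> 0" using cs(1) by blast
      then have "0 < (\<Sum>i\<le>k. (cmod (cs i))\<^sup>2)" by (intro sum_pos2[of _ i]) auto
      then have N0: "0 < (L2_norm u)\<^sup>2" using span(2) N by simp
      have "(\<theta>\<^sup>2 * (1 - level k / W) - 2 * \<theta> * tan (\<theta> * (1 / real (Suc k) + 4 * \<eta>) / 2) * level k / (W * \<eta>))
          * (h\<^sup>2 / (b - a)\<^sup>2) * (L2_norm u)\<^sup>2 \<le> h\<^sup>2 * (L2_norm u')\<^sup>2 + (L2_norm (sqrt_potential_mult V u))\<^sup>2"
      proof (rule well_lower_bound[OF pr uL u'L VuL nonneg ab h _ c(2,1,4,5)])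
        show "W * (h\<^sup>2 / (b - a)\<^sup>2) \<le> V x" if "x \<le> a - \<eta> * (b - a) \<or> b + \<eta> * (b - a) \<le> x" for x
          using elim(1) that unfolding a_def b_def eps_def by blast
        show "u (a + real j * (b - a) / real (Suc k)) = 0" if "1 \<le> j" "j < Suc k" for j
          using cs(2)[of "j - 1"] that by (simp add: u_def node_def lessThan_Suc_atMost)
        have "\<mu> h k * (L2_norm u)\<^sup>2 \<le> level k * eps h * (L2_norm u)\<^sup>2"
          using False by (intro mult_right_mono) auto
        then show "h\<^sup>2 * (L2_norm u')\<^sup>2 + (L2_norm (sqrt_potential_mult V u))\<^sup>2 \<le> level k * (h\<^sup>2 / (b - a)\<^sup>2) * (L2_norm u)\<^sup>2"
          using en unfolding eps_def a_def b_def by linarith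
      qed auto
      moreover have "(level k - \<delta>) * (eps h * (L2_norm u)\<^sup>2) \<le> (\<theta>\<^sup>2 * (1 - level k / W) - 2 * \<theta> * tan (\<theta> * (1 / real (Suc k) + 4 * \<eta>) / 2) * level k / (W * \<eta>))
          * (eps h * (L2_norm u)\<^sup>2)" by (intro mult_right_mono c(6)) (use \<epsilon> in auto)
      ultimately have "(level k - \<delta>) * eps h * (L2_norm u)\<^sup>2 \<le> \<mu> h k * (L2_norm u)\<^sup>2"
        using en unfolding eps_def a_def b_def by (simp only: mult.assoc)
      then show ?thesis using N0 by simp
    qed
  qed
qed

text \<open>Let \<open>\<alpha> i\<close> be the coefficients of the \<open>k\<close>-th mode. By induction those with \<open>i < k\<close> are small, as the modes
  are orthogonal. If \<open>y\<close> is the squared norm of the part beyond \<open>e k\<close>, the energy of the mode is at least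
  about \<open>(level k * |\<alpha> k|\<^sup>2 + level (Suc k) * y) * eps h\<close> and at most about \<open>level k * eps h\<close>, which makes \<open>y\<close>
  small.\<close>

lemma eigenvector_near_mode:
  assumes "0 < \<delta>"
  shows "\<forall>\<^sub>F h in at_right 0. norm (trial k h - cscale (cinner (trial k h) (e h k)) (e h k)) \<le> \<delta>"
  using assms
proof (induction k arbitrary: \<delta> rule: less_induct)
  case (less k)
  define B where "B = level (Suc k)"
  have pi1: "1 \<le> pi\<^sup>2"
  proof -
    have "1 * 1 \<le> pi * pi" using pi_gt3 by (intro mult_mono) auto
    then show ?thesis by (simp add: power2_eq_square)
  qed
  have gap: "1 \<le> B - level k"
  proof -
    have "B - level k = pi\<^sup>2 * (2 * real k + 3)" by (simp add: B_def power_mult_distrib power2_eq_square algebra_simps)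
    also have "\<dots> \<ge> 1 * 1" using pi1 by (intro mult_mono) auto
    finally show ?thesis by simp
  qed
  have B1: "1 \<le> B" using gap zero_le_power2[of "pi * real (Suc k)"] by linarith
  define \<delta>1 where "\<delta>1 = \<delta>\<^sup>2 / 4"
  have \<delta>1: "0 < \<delta>1" using less.prems by (simp add: \<delta>1_def)
  define \<sigma> where "\<sigma> = \<delta> / (2 * B * real (Suc k))"
  have \<sigma>: "0 < \<sigma>" using less.prems B1 by (simp add: \<sigma>_def)
  have \<sigma>B: "B * (real k * \<sigma>\<^sup>2) \<le> \<delta>\<^sup>2 / 4"
  proof -
    have "B * real k * \<delta>\<^sup>2 \<le> B * (B * (real (Suc k))\<^sup>2) * \<delta>\<^sup>2"
    proof (intro mult_right_mono mult_left_mono)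
      have "real k \<le> 1 * (real (Suc k))\<^sup>2" by (simp add: power2_eq_square algebra_simps)
      also have "\<dots> \<le> B * (real (Suc k))\<^sup>2" using B1 by (intro mult_right_mono) auto
      finally show "real k \<le> B * (real (Suc k))\<^sup>2" .
    qed (use B1 in auto)
    moreover have "d / 4 * (2 * b * n)\<^sup>2 = b * (b * n\<^sup>2) * d" for d b n :: real by (simp add: power2_eq_square)
    ultimately have "B * real k * \<delta>\<^sup>2 \<le> \<delta>\<^sup>2 / 4 * (2 * B * real (Suc k))\<^sup>2" by (simp only:)
    moreover have "B * (real k * \<sigma>\<^sup>2) = B * real k * \<delta>\<^sup>2 / (2 * B * real (Suc k))\<^sup>2"
      unfolding \<sigma>_def power_divide by simp
    moreover have "0 < (2 * B * real (Suc k))\<^sup>2" using B1 by (intro zero_less_power mult_pos_pos) auto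
    ultimately show ?thesis by (simp only: pos_divide_le_eq)
  qed
  define \<sigma>' where "\<sigma>' = min (1/2) (\<sigma> / 2)"
  have \<sigma>': "0 < \<sigma>'" "\<sigma>' \<le> 1/2" "2 * \<sigma>' \<le> \<sigma>" using \<sigma> by (auto simp: \<sigma>'_def)
  have "\<forall>\<^sub>F h in at_right 0. \<forall>i\<in>{..<k}. norm (trial i h - cscale (cinner (trial i h) (e h i)) (e h i)) \<le> \<sigma>'"
    by (rule eventually_ball_finite) (use less.IH \<sigma>'(1) in auto)
  from this trial_modes[OF \<delta>1, of k] eigenvalue_lower[OF \<delta>1, of k] eigenvalue_lower[OF \<delta>1, of "Suc k"]
    eigenvalue_upper[OF \<delta>1, of "Suc k"]
  show ?case
  proof eventually_elim
    case (elim h)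
    have h: "0 < h" and \<epsilon>: "0 < eps h" and skm: "Suc k < m h" using elim by auto
    interpret schroedinger_system h V c "m h" "e h" "p h" "\<mu> h" by (rule sys[OF h])
    have ss: "cinner (trial i h) (trial j h) = (if i = j then 1 else 0)" for i j using elim(2) by blast
    have ns: "norm (trial i h) = 1" for i
    proof -
      have "complex_of_real ((norm (trial i h))\<^sup>2) = 1" unfolding cinner_self[symmetric] by (simp add: ss)
      then have "(norm (trial i h))\<^sup>2 = 1" by (metis of_real_eq_1_iff)
      then show ?thesis using norm_ge_zero[of "trial i h"] unfolding power2_eq_1_iff by linarith
    qed
    define \<alpha> where "\<alpha> i = cinner (trial k h) (e h i)" for i
    have small: "cmod (\<alpha> i) \<le> \<sigma>" if i: "i < k" for i
    proof -
      define \<beta> where "\<beta> = cinner (trial i h) (e h i)"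
      have near: "norm (trial i h - cscale \<beta> (e h i)) \<le> \<sigma>'" using elim(1) i by (auto simp: \<beta>_def)
      have "norm (cscale \<beta> (e h i)) = cmod \<beta>" using i skm by (simp add: norm_cscale norm_e)
      then have "1 - \<sigma>' \<le> cmod \<beta>"
        using near norm_triangle_ineq2[of "trial i h" "cscale \<beta> (e h i)"] ns[of i] by linarith
      then have \<beta>: "1/2 \<le> cmod \<beta>" using \<sigma>'(2) by linarith
      have "cinner (trial k h) (trial i h - cscale \<beta> (e h i)) = - (cnj \<beta> * \<alpha> i)"
        using i by (simp add: cinner_diff_right ss cinner_cscale_right \<alpha>_def)
      then have "cmod \<beta> * cmod (\<alpha> i) \<le> norm (trial k h) * norm (trial i h - cscale \<beta> (e h i))"
        using cmod_cinner_le[of "trial k h" "trial i h - cscale \<beta> (e h i)"] by (simp add: norm_mult)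
      also have "\<dots> \<le> \<sigma>'" using near by (simp add: ns)
      finally have "cmod \<beta> * cmod (\<alpha> i) \<le> \<sigma>'" .
      moreover have "1/2 * cmod (\<alpha> i) \<le> cmod \<beta> * cmod (\<alpha> i)" by (intro mult_right_mono \<beta>) auto
      ultimately show ?thesis using \<sigma>'(3) by linarith
    qed
    define S where "S = (\<Sum>i<k. (cmod (\<alpha> i))\<^sup>2)"
    have S0: "0 \<le> S" by (simp add: S_def sum_nonneg)
    have Sle: "S \<le> real k * \<sigma>\<^sup>2"
    proof -
      have "S \<le> (\<Sum>i<k. \<sigma>\<^sup>2)" unfolding S_def by (intro sum_mono power_mono small) auto
      then show ?thesis by simp
    qed
    define x where "x = (cmod (\<alpha> k))\<^sup>2"
    define y where "y = 1 - S - x"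
    have sumS: "(\<Sum>i\<le>k. (cmod (\<alpha> i))\<^sup>2) = S + x"
      by (simp add: S_def x_def lessThan_Suc_atMost[symmetric])
    have rest: "(norm (trial k h - cscale (\<alpha> k) (e h k)))\<^sup>2 = 1 - x"
    proof -
      define z where "z = trial k h - cscale (\<alpha> k) (e h k)"
      have kk: "cinner (e h k) (e h k) = 1" using orthonormal[of k k] skm by simp
      have "cinner z (e h k) = 0" by (simp add: z_def cinner_diff_left cinner_cscale_left kk \<alpha>_def)
      then have "(norm ((\<Sum>i<(1::nat). cscale (\<alpha> k) (e h k)) + z))\<^sup>2 = (\<Sum>i<(1::nat). (cmod (\<alpha> k))\<^sup>2 * 1) + (norm z)\<^sup>2"
        by (intro Pythagoras_system[where e="\<lambda>_. e h k" and a="\<lambda>_. \<alpha> k" and w="\<lambda>_. 1"]) (auto simp: kk)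
      then show ?thesis by (simp add: z_def x_def ns)
    qed
    have x1: "x \<le> 1" using rest zero_le_power2[of "norm (trial k h - cscale (\<alpha> k) (e h k))"] by linarith
    have y0: "0 \<le> y"
    proof -
      define z where "z = trial k h - (\<Sum>i<Suc k. cscale (\<alpha> i) (e h i))"
      have z0: "cinner z (e h j) = 0" if "j < Suc k" for j
      proof -
        have "cinner (\<Sum>i<Suc k. cscale (\<alpha> i) (e h i)) (e h j) = (\<Sum>i<Suc k. if i = j then \<alpha> j else 0)"
          unfolding cinner_sum_left
          by (intro sum.cong refl) (use that skm in \<open>auto simp: cinner_cscale_left orthonormal\<close>)
        then show ?thesis using that by (simp add: z_def cinner_diff_left \<alpha>_def)
      qed
      have "(norm ((\<Sum>i<Suc k. cscale (\<alpha> i) (e h i)) + z))\<^sup>2 = (\<Sum>i<Suc k. (cmod (\<alpha> i))\<^sup>2 * 1) + (norm z)\<^sup>2"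
        by (rule Pythagoras_system) (use skm orthonormal z0 in auto)
      then have "1 = S + x + (norm z)\<^sup>2" by (simp add: z_def ns S_def x_def)
      then show ?thesis using zero_le_power2[of "norm z"] unfolding y_def by linarith
    qed
    define cs where "cs i = (if i = k then 1 else 0 :: complex)" for i
    have "(\<Sum>i\<le>k. cscale (cs i) (trial_image i h)) = (\<Sum>i\<le>k. if i = k then trial_image k h else 0)"
      by (intro sum.cong refl) (auto simp: cs_def)
    then have q1: "(\<Sum>i\<le>k. cscale (cs i) (trial_image i h)) = trial_image k h" by simp
    have "(\<Sum>i\<le>k. (cmod (cs i))\<^sup>2) = (\<Sum>i\<le>k. if i = k then 1 else 0)"
      by (intro sum.cong refl) (auto simp: cs_def)
    then have cs1: "(\<Sum>i\<le>k. (cmod (cs i))\<^sup>2) = 1" by simp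
    have "(norm (\<Sum>i\<le>k. cscale (cs i) (trial_image i h)))\<^sup>2 \<le> (level k + \<delta>1) * eps h * (\<Sum>i\<le>k. (cmod (cs i))\<^sup>2)"
      using elim(2) by blast
    then have qle: "(norm (trial_image k h))\<^sup>2 \<le> (level k + \<delta>1) * eps h" unfolding q1 cs1 by simp
    have sq: "(trial k h, trial_image k h) \<in> graph" using elim(2) by blast
    have "\<mu> h k * x + \<mu> h (Suc k) * y \<le> (norm (trial_image k h))\<^sup>2"
      using form_lower_bound(2)[OF sq skm] unfolding \<alpha>_def[symmetric] sumS x_def[symmetric]
      by (simp add: ns y_def algebra_simps)
    moreover have "(level k - \<delta>1) * eps h * x \<le> \<mu> h k * x" using elim(3) by (intro mult_right_mono) (auto simp: x_def)
    moreover have "(B - \<delta>1) * eps h * y \<le> \<mu> h (Suc k) * y" using elim(4) y0 by (intro mult_right_mono) (auto simp: B_def)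
    ultimately have "((level k - \<delta>1) * x + (B - \<delta>1) * y) * eps h \<le> (level k + \<delta>1) * eps h"
      using qle by (simp add: algebra_simps)
    then have "(level k - \<delta>1) * x + (B - \<delta>1) * y \<le> level k + \<delta>1" using \<epsilon> by simp
    moreover have "y = 1 - S - x" by (simp add: y_def)
    ultimately have "(B - level k) * (1 - x) \<le> 2 * \<delta>1 + B * S - \<delta>1 * S"
      by (simp add: algebra_simps)
    moreover have "1 * (1 - x) \<le> (B - level k) * (1 - x)" using gap x1 by (intro mult_right_mono) auto
    ultimately have 1: "1 * (1 - x) \<le> 2 * \<delta>1 + B * S - \<delta>1 * S" by (rule order_trans[rotated])
    have 2: "0 \<le> \<delta>1 * S" using \<delta>1 S0 by simp
    have 3: "B * S \<le> B * (real k * \<sigma>\<^sup>2)" using B1 Sle by (intro mult_left_mono) auto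
    have lin: "r \<le> y / 2 + y / 4" if "1 * r \<le> 2 * d + t - w" "0 \<le> w" "t \<le> v" "v \<le> y / 4" "d = y / 4"
      for r d t w v y :: real using that by linarith
    have "1 - x \<le> \<delta>\<^sup>2 / 2 + \<delta>\<^sup>2 / 4" by (rule lin[OF 1 2 3 \<sigma>B \<delta>1_def])
    also have "\<dots> \<le> \<delta>\<^sup>2" by simp
    finally have "(norm (trial k h - cscale (\<alpha> k) (e h k)))\<^sup>2 \<le> \<delta>\<^sup>2" unfolding rest .
    then show "norm (trial k h - cscale (cinner (trial k h) (e h k)) (e h k)) \<le> \<delta>"
      unfolding \<alpha>_def by (rule power2_le_imp_le) (use less.prems in simp)
  qed
qed

text \<open>Multiplying \<open>e h k\<close> by the phase of its inner product with the mode turns closeness to a line into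
  closeness to the mode.\<close>

lemma eigenvector_asymptotics:
  "\<exists>u :: real \<Rightarrow> real \<Rightarrow> complex.
     (\<forall>\<^sub>F h in at_right 0. \<exists>t. kth_eigenvalue (Suc k) (schroedinger h V) = ereal t \<and>
        normalized_eigenvector (schroedinger h V) t (u h)) \<and>
     ((\<lambda>h. L2_norm (\<lambda>x. u h x - dirichlet_mode (Suc k) (\<delta>m h) (\<delta>p h) x)) \<longlongrightarrow> 0) (at_right 0)"
proof -
  define \<alpha> where "\<alpha> h = cinner (trial k h) (e h k)" for h
  have "\<exists>w. w \<in> L2 \<and> cscale (\<alpha> h / of_real (cmod (\<alpha> h))) (e h k) = to_l2 w" for h
    by (rule to_l2_cases[of "cscale (\<alpha> h / of_real (cmod (\<alpha> h))) (e h k)"]) blast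
  then obtain u where u: "\<And>h. u h \<in> L2" "\<And>h. cscale (\<alpha> h / of_real (cmod (\<alpha> h))) (e h k) = to_l2 (u h)" by metis
  \<comment> \<open>where \<open>\<alpha> h = 0\<close> the phase is \<open>0 / 0 = 0\<close>, which \<open>near\<close> rules out for small \<open>h\<close>\<close>
  have near: "\<forall>\<^sub>F h in at_right 0. 0 < h \<and> k < m h \<and> \<alpha> h \<noteq> 0 \<and>
      L2_norm (\<lambda>x. u h x - dirichlet_mode (Suc k) (\<delta>m h) (\<delta>p h) x) \<le> 2 * \<delta>" if \<delta>: "0 < \<delta>" "\<delta> < 1" for \<delta>
    using eigenvector_near_mode[OF \<delta>(1), of k] eigenvalue_upper[OF zero_less_one, of k] trial_modes[OF zero_less_one, of k]
  proof eventually_elim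
    case (elim h)
    then have h: "0 < h" and km: "k < m h" by auto
    interpret schroedinger_system h V c "m h" "e h" "p h" "\<mu> h" by (rule sys[OF h])
    have ne: "norm (e h k) = 1" by (rule norm_e[OF km])
    have "complex_of_real ((norm (trial k h))\<^sup>2) = 1" unfolding cinner_self[symmetric] using elim(3) by simp
    then have "(norm (trial k h))\<^sup>2 = 1" by (metis of_real_eq_1_iff)
    then have ns: "norm (trial k h) = 1" using norm_ge_zero[of "trial k h"] unfolding power2_eq_1_iff by linarith
    have n1: "norm (trial k h - cscale (\<alpha> h) (e h k)) \<le> \<delta>" using elim(1) by (simp add: \<alpha>_def)
    have a1: "cmod (\<alpha> h) \<le> 1" using cmod_cinner_le[of "trial k h" "e h k"] by (simp add: \<alpha>_def ns ne)
    have a2: "1 - \<delta> \<le> cmod (\<alpha> h)"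
      using n1 norm_triangle_ineq2[of "trial k h" "cscale (\<alpha> h) (e h k)"] by (simp add: ns ne norm_cscale)
    have a0: "\<alpha> h \<noteq> 0" using a2 \<delta>(2) by auto
    have "to_l2 (u h) - cscale (\<alpha> h) (e h k) = cscale (\<alpha> h / of_real (cmod (\<alpha> h)) - \<alpha> h) (e h k)"
      unfolding u(2)[symmetric] by (simp add: cscale_def algebra_simps)
    then have "norm (to_l2 (u h) - cscale (\<alpha> h) (e h k)) = cmod (\<alpha> h / of_real (cmod (\<alpha> h)) - \<alpha> h)"
      by (simp add: norm_cscale ne)
    also have "\<alpha> h / of_real (cmod (\<alpha> h)) - \<alpha> h = (\<alpha> h / of_real (cmod (\<alpha> h))) * of_real (1 - cmod (\<alpha> h))"
      using a0 by (simp add: field_simps)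
    also have "cmod \<dots> = 1 - cmod (\<alpha> h)" using a0 a1 unfolding norm_mult norm_divide norm_of_real by simp
    finally have n2: "norm (to_l2 (u h) - cscale (\<alpha> h) (e h k)) \<le> \<delta>" using a2 by linarith
    have "L2_norm (\<lambda>x. u h x - dirichlet_mode (Suc k) (\<delta>m h) (\<delta>p h) x) = norm (to_l2 (u h) - trial k h)"
      by (simp add: trial_def to_l2_diff u mode_L2 norm_to_l2 L2_diff)
    also have "\<dots> \<le> norm (to_l2 (u h) - cscale (\<alpha> h) (e h k)) + norm (cscale (\<alpha> h) (e h k) - trial k h)"
      using norm_triangle_ineq[of "to_l2 (u h) - cscale (\<alpha> h) (e h k)" "cscale (\<alpha> h) (e h k) - trial k h"] by simp
    also have "\<dots> \<le> 2 * \<delta>" using n1 n2 by (simp add: norm_minus_commute)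
    finally show ?case using h km a0 by blast
  qed
  have "\<forall>\<^sub>F h in at_right 0. \<exists>t. kth_eigenvalue (Suc k) (schroedinger h V) = ereal t \<and>
        normalized_eigenvector (schroedinger h V) t (u h)"
    using near[of "1/2", simplified]
  proof eventually_elim
    case (elim h)
    then have h: "0 < h" and km: "k < m h" and a0: "\<alpha> h \<noteq> 0" by auto
    interpret schroedinger_system h V c "m h" "e h" "p h" "\<mu> h" by (rule sys[OF h])
    have "kth_eigenvalue (Suc k) T = ereal (\<mu> h k)" using kth_eigenvalue_eq[of "Suc k"] km by simp
    moreover have "normalized_eigenvector T (\<mu> h k) (u h)"
      by (rule normalized_eigenvector_phase[OF km u(1) u(2)[symmetric]]) (use a0 in \<open>simp add: norm_divide\<close>)
    ultimately show ?case by blast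
  qed
  moreover have "((\<lambda>h. L2_norm (\<lambda>x. u h x - dirichlet_mode (Suc k) (\<delta>m h) (\<delta>p h) x)) \<longlongrightarrow> 0) (at_right 0)"
  proof (rule tendstoI)
    fix r :: real assume r: "0 < r"
    define \<delta> where "\<delta> = min (1/2) (r / 3)"
    have \<delta>: "0 < \<delta>" "\<delta> < 1" "2 * \<delta> < r" using r by (auto simp: \<delta>_def min_def)
    show "\<forall>\<^sub>F h in at_right 0. dist (L2_norm (\<lambda>x. u h x - dirichlet_mode (Suc k) (\<delta>m h) (\<delta>p h) x)) 0 < r"
      using near[OF \<delta>(1,2)]
    proof eventually_elim
      case (elim h)
      have "0 \<le> L2_norm f" for f by (simp add: L2_norm_def)
      then show ?case using elim \<delta>(3) by (simp add: dist_real_def)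
    qed
  qed
  ultimately show ?thesis by blast
qed

end

theorem proposition3p11:
  fixes V :: "real \<Rightarrow> real"
  assumes "continuous_on UNIV V"
    and "\<forall>x. 0 \<le> V x"
    and "Liminf at_infinity (\<lambda>x. ereal (V x)) > 0"
    and "V -` {0} = {0}"
    and "flat_at_0 V"
    and "\<forall>n::nat. \<exists>\<epsilon>>0.
           strict_mono_on {0<..<\<epsilon>} (\<lambda>x. V x / \<bar>x\<bar> ^ n) \<and>
           strict_antimono_on {-\<epsilon><..<0} (\<lambda>x. V x / \<bar>x\<bar> ^ n)"
  shows "(\<forall>\<^sub>F h in at_right 0. \<exists>!p. well_edges V h p) \<and>
    (\<forall>\<delta>m \<delta>p :: real \<Rightarrow> real.
       (\<forall>\<^sub>F h in at_right 0. well_edges V h (\<delta>m h, \<delta>p h)) \<longrightarrow>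
       (\<forall>k\<ge>1. \<exists>u :: real \<Rightarrow> real \<Rightarrow> complex.
          (\<forall>\<^sub>F h in at_right 0. \<exists>t. kth_eigenvalue k (schroedinger h V) = ereal t \<and>
              normalized_eigenvector (schroedinger h V) t (u h)) \<and>
          ((\<lambda>h. L2_norm (\<lambda>x. u h x - dirichlet_mode k (\<delta>m h) (\<delta>p h) x)) \<longlongrightarrow> 0)
            (at_right 0)))"
proof -
  interpret flat_well V
    using assms(1-4,6) by unfold_locales blast+
  obtain R c0 where R: "R > 0" "c0 > 0" "\<And>x. \<bar>x\<bar> \<ge> R \<Longrightarrow> c0 \<le> V x" using coercive by blast
  define c where "c = c0 / 2"
  have c: "0 < c" "c < c0" using R(2) by (auto simp: c_def)
  have ex: "\<exists>m e p \<mu>. schroedinger_system h V c m e p \<mu>" if "0 < h" for h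
  proof -
    interpret schroedinger_setting h V using that continuous nonneg by unfold_locales auto
    show ?thesis by (rule schroedinger_system_exists[OF R(3) R(1)]) (use c in auto)
  qed
  obtain m e p \<mu> where sys: "\<And>h. 0 < h \<Longrightarrow> schroedinger_system h V c (m h) (e h) (p h) (\<mu> h)"
    using ex by metis
  have "\<exists>u :: real \<Rightarrow> real \<Rightarrow> complex.
          (\<forall>\<^sub>F h in at_right 0. \<exists>t. kth_eigenvalue k (schroedinger h V) = ereal t \<and>
              normalized_eigenvector (schroedinger h V) t (u h)) \<and>
          ((\<lambda>h. L2_norm (\<lambda>x. u h x - dirichlet_mode k (\<delta>m h) (\<delta>p h) x)) \<longlongrightarrow> 0) (at_right 0)"
    if edges: "\<forall>\<^sub>F h in at_right 0. well_edges V h (\<delta>m h, \<delta>p h)" and k: "k \<ge> 1" for \<delta>m \<delta>p k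
  proof -
    interpret semiclassical V c \<delta>m \<delta>p m e p \<mu>
      by (intro semiclassical.intro flat_well_axioms semiclassical_axioms.intro edges sys c(1))
    show ?thesis using eigenvector_asymptotics[of "k - 1"] k by simp
  qed
  then show ?thesis using well_edges_unique_existence by blast
qed

end
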